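(* Let $i\in I$. The subalgebra $U^+[i]$ of $U^+$ is stable under the adjoint action of $U_i$, and the adjoint action of $U_i$ on $U^+[i]$ is an integrable representation. Furthermore $U^+[i]$ is maximal in the following sense: if $V\subseteq U^+$ is an integrable $U_i$-submodule of $U$ for the adjoint action, then $V\subseteq U^+[i]$.
   Context: Cartan and root data: $I$ is a nonempty set with a symmetric bilinear form $\cdot:\mathbb{Z}I\otimes\mathbb{Z}I\to\mathbb{Z}$ such that $i\cdot i\in2\mathbb{Z}_{>0}$ and $2(i\cdot j)/(i\cdot i)\in\mathbb{Z}_{\le0}$ for $i\ne j$; $X,Y$ are finitely generated free abelian groups with a perfect pairing $\langle\cdot,\cdot\rangle:Y\otimes X\to\mathbb{Z}$ and injections $I\hookrightarrow X$, $i\mapsto i$ and $I\hookrightarrow Y$, $i\mapsto i^\vee$ with $c_{i,j}:=\langle i^\vee,j\rangle=2(i\cdot j)/(i\cdot i)$. Put $d_i=(i\cdot i)/2$, $q_i=q^{d_i}$, $[k]_i=\frac{q_i^k-q_i^{-k}}{q_i-q_i^{-1}}$, $[k]_i!=\prod_{l=1}^k[l]_i$, $Q=\bigoplus_{i\in I}\mathbb{Z}i$. $U$ is the unital $\mathbb{Q}(q)$-algebra generated by $e_i,f_i$ ($i\in I$) and $k_\mu$ ($\mu\in Y$) with relations: $k_0=1$, $k_\mu k_{\mu'}=k_{\mu+\mu'}$; $k_\mu e_i=q^{\langle\mu,i\rangle}e_ik_\mu$, $k_\mu f_i=q^{-\langle\mu,i\rangle}f_ik_\mu$; $e_if_j-f_je_i=\delta_{i,j}\frac{k_i-k_i^{-1}}{q_i-q_i^{-1}}$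 with $k_i=k_{d_ii^\vee}$; and for $i\neq j$ the quantum Serre relations $\sum_{\ell=0}^{1-c_{i,j}}(-1)^\ell e_i^{(\ell)}e_je_i^{(1-c_{i,j}-\ell)}=0$ and $\sum_{\ell=0}^{1-c_{i,j}}(-1)^\ell f_i^{(\ell)}f_jf_i^{(1-c_{i,j}-\ell)}=0$, where $e_i^{(\ell)}=e_i^\ell/[\ell]_i!$, $f_i^{(\ell)}=f_i^\ell/[\ell]_i!$. $U$ is a Hopf algebra with $\Delta(e_i)=e_i\otimes1+k_i\otimes e_i$, $\Delta(f_i)=f_i\otimes k_i^{-1}+1\otimes f_i$, $\Delta(k_\mu)=k_\mu\otimes k_\mu$, $S(e_i)=-k_i^{-1}e_i$, $S(f_i)=-f_ik_i$, $S(k_\mu)=k_\mu^{-1}$. It is $Q$-graded with $e_i$ in degree $i$, $f_i$ in degree $-i$, $k_\mu$ in degree $0$. The (left) adjoint action of $U$ on itself is $\mathrm{ad}_z(y)=\sum z_{(1)}yS(z_{(2)})$. For $y$ homogeneous of degree $\beta$: $\mathrm{ad}_{e_i}(y)=e_iy-q_i^{\langle i^\vee,\beta\rangle}ye_i$, $\mathrm{ad}_{f_i}(y)=(f_iy-yf_i)k_i$, $\mathrm{ad}_{k_\mu}(y)=q^{\langle\mu,\beta\rangle}y$. Put $\mathrm{ad}_{e_i}^{(n)}=\mathrm{ad}_{e_i}^n/[n]_i!$. $U^+$ is the subalgebra of $U$ generated by the $e_j$, $j\in I$; $U_i$ is the subalgebra generated by $e_i,f_i,k_i$; $U^+[i]$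 is the subalgebra of $U^+$ generated by the elements $\mathrm{ad}_{e_i}^{(n)}(e_j)$ for $j\in I\setminus\{i\}$, $n\ge0$. A representation $V$ of $U_i$ is integrable if it is a weight representation, i.e. $V=\bigoplus_{w\in\mathbb{Z}}\{v\in V: k_iv=q_i^wv\}$, and $e_i,f_i$ act locally nilpotently (for all $v\in V$ there is $n\ge0$ with $e_i^nv=f_i^nv=0$). *)

theory Defs
  imports
    "HOL-Algebra.QuotRing"
    "HOL-Algebra.Subrings"
    "HOL-Algebra.Module"
    "HOL-Computational_Algebra.Polynomial"
    "HOL-Computational_Algebra.Fraction_Field"
    "HOL-Library.Poly_Mapping"
    "HOL-Library.Product_Plus"
begin

section \<open>Cartan and root data\<close>

definition zmul :: "int \<Rightarrow> 'a::ab_group_add \<Rightarrow> 'a" where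
  "zmul n x = (if 0 \<le> n then (\<Sum>_<nat n. x) else - (\<Sum>_<nat (- n). x))"

definition fg_free :: "'a::ab_group_add itself \<Rightarrow> bool" where
  "fg_free _ \<longleftrightarrow> (\<exists>B::'a set. finite B \<and>
     (\<forall>x. \<exists>!c. (\<forall>b. b \<notin> B \<longrightarrow> c b = 0) \<and> x = (\<Sum>b\<in>B. zmul (c b) b)))"

definition biadditive :: "('a::ab_group_add \<Rightarrow> 'b::ab_group_add \<Rightarrow> int) \<Rightarrow> bool" where
  "biadditive f \<longleftrightarrow> (\<forall>a. additive (f a)) \<and> (\<forall>b. additive (\<lambda>a. f a b))"

definition perfect_pairing :: "('a::ab_group_add \<Rightarrow> 'b::ab_group_add \<Rightarrow> int) \<Rightarrow> bool" where
  "perfect_pairing f \<longleftrightarrow> biadditive f \<and>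
     (\<forall>\<phi>. additive \<phi> \<longrightarrow> (\<exists>!a. \<phi> = f a)) \<and>
     (\<forall>\<phi>. additive \<phi> \<longrightarrow> (\<exists>!b. \<phi> = (\<lambda>a. f a b)))"

text \<open>The index set is the (automatically nonempty) type \<open>'i\<close>, possibly infinite;
  \<open>'i \<Rightarrow>\<^sub>0 int\<close> is the free abelian group on it.\<close>

record ('i, 'x, 'y) root_datum =
  bil_form :: "('i \<Rightarrow>\<^sub>0 int) \<Rightarrow> ('i \<Rightarrow>\<^sub>0 int) \<Rightarrow> int"
  pairing :: "'y \<Rightarrow> 'x \<Rightarrow> int"
  simple_root :: "'i \<Rightarrow> 'x"
  simple_coroot :: "'i \<Rightarrow> 'y"

definition dot :: "('i, 'x, 'y) root_datum \<Rightarrow> 'i \<Rightarrow> 'i \<Rightarrow> int" where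
  "dot D i j = bil_form D (Poly_Mapping.single i 1) (Poly_Mapping.single j 1)"

text \<open>In a Cartan datum the division is exact.\<close>

definition cartan :: "('i, 'x, 'y) root_datum \<Rightarrow> 'i \<Rightarrow> 'i \<Rightarrow> int" where
  "cartan D i j = (2 * dot D i j) div dot D i i"

definition is_cartan_datum :: "('i, 'x, 'y) root_datum \<Rightarrow> bool" where
  "is_cartan_datum D \<longleftrightarrow>
     biadditive (bil_form D) \<and> (\<forall>a b. bil_form D a b = bil_form D b a) \<and>
     (\<forall>i. even (dot D i i) \<and> 0 < dot D i i) \<and>
     (\<forall>i j. i \<noteq> j \<longrightarrow> dot D i i dvd 2 * dot D i j \<and> cartan D i j \<le> 0)"

definition is_root_datum :: "('i, 'x::ab_group_add, 'y::ab_group_add) root_datum \<Rightarrow> bool" where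
  "is_root_datum D \<longleftrightarrow>
     is_cartan_datum D \<and> fg_free TYPE('x) \<and> fg_free TYPE('y) \<and>
     perfect_pairing (pairing D) \<and> inj (simple_root D) \<and> inj (simple_coroot D) \<and>
     (\<forall>i j. pairing D (simple_coroot D i) (simple_root D j) = cartan D i j)"

section \<open>The field of rational functions and quantum integers\<close>

type_synonym qfield = "rat poly fract"

definition qvar :: qfield where
  "qvar = Fract [:0, 1:] 1"

definition d_of :: "('i, 'x, 'y) root_datum \<Rightarrow> 'i \<Rightarrow> int" where
  "d_of D i = dot D i i div 2"

definition q_of :: "('i, 'x, 'y) root_datum \<Rightarrow> 'i \<Rightarrow> qfield" where
  "q_of D i = qvar powi d_of D i"

definition qint :: "('i, 'x, 'y) root_datum \<Rightarrow> 'i \<Rightarrow> nat \<Rightarrow> qfield" where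
  "qint D i k = (q_of D i powi int k - q_of D i powi (- int k)) / (q_of D i - inverse (q_of D i))"

definition qfact :: "('i, 'x, 'y) root_datum \<Rightarrow> 'i \<Rightarrow> nat \<Rightarrow> qfield" where
  "qfact D i k = (\<Prod>l=1..k. qint D i l)"

section \<open>Free algebras\<close>

text \<open>Lists form the free monoid, so \<open>'g list \<Rightarrow>\<^sub>0 'k\<close> is the free algebra on \<open>'g\<close>, with
  concatenation of words as product. Its tensor square is the algebra
  \<open>'g list \<times> 'g list \<Rightarrow>\<^sub>0 'k\<close> of the product monoid.\<close>

instantiation list :: (type) monoid_add
begin
definition zero_list :: "'a list" where "zero_list = []"
definition plus_list :: "'a list \<Rightarrow> 'a list \<Rightarrow> 'a list" where "plus_list = append"
instance by standard (simp_all add: zero_list_def plus_list_def)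
end

definition fconst :: "qfield \<Rightarrow> ('m::monoid_add \<Rightarrow>\<^sub>0 qfield)" where
  "fconst c = Poly_Mapping.single 0 c"

definition word :: "'m \<Rightarrow> ('m \<Rightarrow>\<^sub>0 qfield)" where
  "word w = Poly_Mapping.single w 1"

definition lin_ext :: "('m \<Rightarrow> ('n::monoid_add \<Rightarrow>\<^sub>0 qfield)) \<Rightarrow> ('m \<Rightarrow>\<^sub>0 qfield) \<Rightarrow> ('n \<Rightarrow>\<^sub>0 qfield)" where
  "lin_ext g p = (\<Sum>w\<in>Poly_Mapping.keys p. fconst (Poly_Mapping.lookup p w) * g w)"

text \<open>The bridge from type-class rings to the records of HOL-Algebra.\<close>

definition type_ring :: "'a::ring_1 ring" where
  "type_ring = \<lparr>carrier = UNIV, monoid.mult = (*), one = 1, zero = 0, add = (+)\<rparr>"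

section \<open>The quantum group\<close>

datatype ('i, 'y) gen = GenE 'i | GenF 'i | GenK 'y

type_synonym ('i, 'y) free = "('i, 'y) gen list \<Rightarrow>\<^sub>0 qfield"
type_synonym ('i, 'y) free2 = "('i, 'y) gen list \<times> ('i, 'y) gen list \<Rightarrow>\<^sub>0 qfield"

definition fE :: "'i \<Rightarrow> ('i, 'y) free" where "fE i = word [GenE i]"
definition fF :: "'i \<Rightarrow> ('i, 'y) free" where "fF i = word [GenF i]"
definition fK :: "'y \<Rightarrow> ('i, 'y) free" where "fK \<mu> = word [GenK \<mu>]"

text \<open>The exponent \<open>d\<^sub>i i\<^sup>\<or>\<close> of \<open>k\<^sub>i\<close>.\<close>

definition kexp :: "('i, 'x, 'y::ab_group_add) root_datum \<Rightarrow> 'i \<Rightarrow> 'y" where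
  "kexp D i = zmul (d_of D i) (simple_coroot D i)"

definition fdiv :: "('i, 'x, 'y) root_datum \<Rightarrow> 'i \<Rightarrow> ('i, 'y) free \<Rightarrow> nat \<Rightarrow> ('i, 'y) free" where
  "fdiv D i x l = fconst (1 / qfact D i l) * x ^ l"

definition serre :: "('i, 'x, 'y) root_datum \<Rightarrow> ('i \<Rightarrow> ('i, 'y) free) \<Rightarrow> 'i \<Rightarrow> 'i \<Rightarrow> ('i, 'y) free" where
  "serre D x i j = (let n = nat (1 - cartan D i j) in
     \<Sum>l=0..n. (- 1) ^ l * fdiv D i (x i) l * x j * fdiv D i (x i) (n - l))"

text \<open>Each defining relation \<open>a = b\<close> is recorded as the element \<open>a - b\<close>.\<close>

definition relations :: "('i, 'x, 'y::ab_group_add) root_datum \<Rightarrow> ('i, 'y) free set" where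
  "relations D =
     {fK 0 - 1}
     \<union> {fK \<mu> * fK \<nu> - fK (\<mu> + \<nu>) | \<mu> \<nu>. True}
     \<union> {fK \<mu> * fE i - fconst (qvar powi pairing D \<mu> (simple_root D i)) * fE i * fK \<mu> | \<mu> i. True}
     \<union> {fK \<mu> * fF i - fconst (qvar powi (- pairing D \<mu> (simple_root D i))) * fF i * fK \<mu> | \<mu> i. True}
     \<union> {fE i * fF j - fF j * fE i -
         (if i = j then fconst (1 / (q_of D i - inverse (q_of D i))) * (fK (kexp D i) - fK (- kexp D i))
          else 0) | i j. True}
     \<union> {serre D fE i j | i j. i \<noteq> j}
     \<union> {serre D fF i j | i j. i \<noteq> j}"

definition rel_ideal :: "('i, 'x, 'y::ab_group_add) root_datum \<Rightarrow> ('i, 'y) free set" where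
  "rel_ideal D = genideal type_ring (relations D)"

definition cls :: "('i, 'x, 'y::ab_group_add) root_datum \<Rightarrow> ('i, 'y) free \<Rightarrow> ('i, 'y) free set" where
  "cls D t = rel_ideal D +>\<^bsub>type_ring\<^esub> t"

text \<open>\<open>U\<close> is the quotient ring with its scalar multiplication, packed in the record type of modules.\<close>

definition Uq :: "('i, 'x, 'y::ab_group_add) root_datum \<Rightarrow> (qfield, ('i, 'y) free set) module" where
  "Uq D = ring.extend (type_ring Quot rel_ideal D)
     (module.fields (\<lambda>c z. rcoset_mult type_ring (rel_ideal D) (cls D (fconst c)) z))"

definition eU :: "('i, 'x, 'y::ab_group_add) root_datum \<Rightarrow> 'i \<Rightarrow> ('i, 'y) free set" where
  "eU D i = cls D (fE i)"
definition fU :: "('i, 'x, 'y::ab_group_add) root_datum \<Rightarrow> 'i \<Rightarrow> ('i, 'y) free set" where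
  "fU D i = cls D (fF i)"
definition kU :: "('i, 'x, 'y::ab_group_add) root_datum \<Rightarrow> 'y \<Rightarrow> ('i, 'y) free set" where
  "kU D \<mu> = cls D (fK \<mu>)"

section \<open>The adjoint action\<close>

text \<open>The action is \<open>z \<cdot> y = \<Sum> z\<^sub>1 y S(z\<^sub>2)\<close>. Comultiplication and antipode are given on the free algebra, as the homomorphism to the tensor
  square and the anti-endomorphism with the prescribed values on generators; those of \<open>U\<close>
  are the induced maps.\<close>

fun comult_gen :: "('i, 'x, 'y::ab_group_add) root_datum \<Rightarrow> ('i, 'y) gen \<Rightarrow> ('i, 'y) free2" where
  "comult_gen D (GenE i) = word ([GenE i], []) + word ([GenK (kexp D i)], [GenE i])"
| "comult_gen D (GenF i) = word ([GenF i], [GenK (- kexp D i)]) + word ([], [GenF i])"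
| "comult_gen D (GenK \<mu>) = word ([GenK \<mu>], [GenK \<mu>])"

definition comult :: "('i, 'x, 'y::ab_group_add) root_datum \<Rightarrow> ('i, 'y) free \<Rightarrow> ('i, 'y) free2" where
  "comult D = lin_ext (\<lambda>w. prod_list (map (comult_gen D) w))"

fun antipode_gen :: "('i, 'x, 'y::ab_group_add) root_datum \<Rightarrow> ('i, 'y) gen \<Rightarrow> ('i, 'y) free" where
  "antipode_gen D (GenE i) = - (fK (- kexp D i) * fE i)"
| "antipode_gen D (GenF i) = - (fF i * fK (kexp D i))"
| "antipode_gen D (GenK \<mu>) = fK (- \<mu>)"

definition antipode :: "('i, 'x, 'y::ab_group_add) root_datum \<Rightarrow> ('i, 'y) free \<Rightarrow> ('i, 'y) free" where
  "antipode D = lin_ext (\<lambda>w. prod_list (map (antipode_gen D) (rev w)))"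

definition free_ad :: "('i, 'x, 'y::ab_group_add) root_datum \<Rightarrow> ('i, 'y) free \<Rightarrow> ('i, 'y) free \<Rightarrow> ('i, 'y) free" where
  "free_ad D t s = lin_ext (\<lambda>(u, v). word u * s * antipode D (word v)) (comult D t)"

text \<open>Induced map on cosets, following \<^const>\<open>rcoset_mult\<close>: the union is a single coset because
  \<open>free_ad\<close> respects the ideal of relations.\<close>

definition ad :: "('i, 'x, 'y::ab_group_add) root_datum \<Rightarrow>
    ('i, 'y) free set \<Rightarrow> ('i, 'y) free set \<Rightarrow> ('i, 'y) free set" where
  "ad D z y = (\<Union>t\<in>z. \<Union>s\<in>y. cls D (free_ad D t s))"

definition ad_e_div :: "('i, 'x, 'y::ab_group_add) root_datum \<Rightarrow> 'i \<Rightarrow> nat \<Rightarrow>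
    ('i, 'y) free set \<Rightarrow> ('i, 'y) free set" where
  "ad_e_div D i n y = (1 / qfact D i n) \<odot>\<^bsub>Uq D\<^esub> ((ad D (eU D i) ^^ n) y)"

section \<open>Subalgebras\<close>

text \<open>Below, \<open>Usub\<close> is \<open>U\<^sub>i\<close> and \<open>Uplus_br\<close> is \<open>U\<^sup>+[i]\<close>. Generating inside \<open>U\<close> or inside the
  subalgebra \<open>U\<^sup>+\<close> is the same.\<close>

definition gen_subalgebra :: "(qfield, 'a) module \<Rightarrow> 'a set \<Rightarrow> 'a set" where
  "gen_subalgebra A S = \<Inter>{B. subring B A \<and> submodule B type_ring A \<and> S \<subseteq> B}"

definition Uplus :: "('i, 'x, 'y::ab_group_add) root_datum \<Rightarrow> ('i, 'y) free set set" where
  "Uplus D = gen_subalgebra (Uq D) {eU D j | j. True}"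

definition Usub :: "('i, 'x, 'y::ab_group_add) root_datum \<Rightarrow> 'i \<Rightarrow> ('i, 'y) free set set" where
  "Usub D i = gen_subalgebra (Uq D) {eU D i, fU D i, kU D (kexp D i)}"

definition Uplus_br :: "('i, 'x, 'y::ab_group_add) root_datum \<Rightarrow> 'i \<Rightarrow> ('i, 'y) free set set" where
  "Uplus_br D i = gen_subalgebra (Uq D) {ad_e_div D i n (eU D j) | n j. j \<noteq> i}"

section \<open>Integrable representations\<close>

text \<open>A representation of the subalgebra \<open>B\<close> of \<open>A\<close> on the vector space \<open>M\<close>; the multiplication
  carried by the record \<open>M\<close> is ignored.\<close>

definition algebra_rep :: "(qfield, 'a) module \<Rightarrow> 'a set \<Rightarrow> (qfield, 'v) module \<Rightarrow> ('a \<Rightarrow> 'v \<Rightarrow> 'v) \<Rightarrow> bool" where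
  "algebra_rep A B M act \<longleftrightarrow>
     module type_ring M \<and>
     (\<forall>z\<in>B. \<forall>v\<in>carrier M. act z v \<in> carrier M) \<and>
     (\<forall>z\<in>B. \<forall>v\<in>carrier M. \<forall>w\<in>carrier M. act z (v \<oplus>\<^bsub>M\<^esub> w) = act z v \<oplus>\<^bsub>M\<^esub> act z w) \<and>
     (\<forall>z\<in>B. \<forall>c. \<forall>v\<in>carrier M. act z (c \<odot>\<^bsub>M\<^esub> v) = c \<odot>\<^bsub>M\<^esub> act z v) \<and>
     (\<forall>z\<in>B. \<forall>z'\<in>B. \<forall>v\<in>carrier M. act (z \<oplus>\<^bsub>A\<^esub> z') v = act z v \<oplus>\<^bsub>M\<^esub> act z' v) \<and>
     (\<forall>z\<in>B. \<forall>c. \<forall>v\<in>carrier M. act (c \<odot>\<^bsub>A\<^esub> z) v = c \<odot>\<^bsub>M\<^esub> act z v) \<and>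
     (\<forall>z\<in>B. \<forall>z'\<in>B. \<forall>v\<in>carrier M. act (z \<otimes>\<^bsub>A\<^esub> z') v = act z (act z' v)) \<and>
     (\<forall>v\<in>carrier M. act \<one>\<^bsub>A\<^esub> v = v)"

definition weight_space :: "('i, 'x, 'y::ab_group_add) root_datum \<Rightarrow> 'i \<Rightarrow> (qfield, 'v) module \<Rightarrow>
    (('i, 'y) free set \<Rightarrow> 'v \<Rightarrow> 'v) \<Rightarrow> int \<Rightarrow> 'v set" where
  "weight_space D i M act w =
     {v \<in> carrier M. act (kU D (kexp D i)) v = (q_of D i powi w) \<odot>\<^bsub>M\<^esub> v}"

definition is_direct_sum :: "(qfield, 'v) module \<Rightarrow> (int \<Rightarrow> 'v set) \<Rightarrow> bool" where
  "is_direct_sum M W \<longleftrightarrow>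
     (\<forall>v\<in>carrier M. \<exists>!c. (\<forall>w. c w \<in> W w) \<and> finite {w. c w \<noteq> \<zero>\<^bsub>M\<^esub>} \<and>
        v = finsum M c {w. c w \<noteq> \<zero>\<^bsub>M\<^esub>})"

definition integrable_rep :: "('i, 'x, 'y::ab_group_add) root_datum \<Rightarrow> 'i \<Rightarrow> (qfield, 'v) module \<Rightarrow>
    (('i, 'y) free set \<Rightarrow> 'v \<Rightarrow> 'v) \<Rightarrow> bool" where
  "integrable_rep D i M act \<longleftrightarrow>
     algebra_rep (Uq D) (Usub D i) M act \<and>
     is_direct_sum M (weight_space D i M act) \<and>
     (\<forall>v\<in>carrier M. \<exists>n::nat. act (eU D i [^]\<^bsub>Uq D\<^esub> n) v = \<zero>\<^bsub>M\<^esub> \<and> act (fU D i [^]\<^bsub>Uq D\<^esub> n) v = \<zero>\<^bsub>M\<^esub>)"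

definition ad_submodule :: "('i, 'x, 'y::ab_group_add) root_datum \<Rightarrow> 'i \<Rightarrow> ('i, 'y) free set set \<Rightarrow> bool" where
  "ad_submodule D i V \<longleftrightarrow>
     submodule V type_ring (Uq D) \<and> (\<forall>z\<in>Usub D i. \<forall>v\<in>V. ad D z v \<in> V)"

end

theory Submission
  imports Defs
begin

text \<open>Write \<open>A\<close> for \<open>U\<^sup>+[i]\<close>. Since \<open>ad\<close> acts by twisted derivations, stability of \<open>A\<close> and local nilpotence
  are checked on generators, where they follow from the Serre relations and an \<open>sl\<^sub>2\<close> computation.
  For maximality, \<open>U\<^sup>+ = \<Sum>\<^sub>n A e\<^sub>i\<^sup>n\<close>, because \<open>e\<^sub>i a = ad\<^bsub>e\<^sub>i\<^esub>(a) + (k\<^sub>i a k\<^sub>i\<^sup>-\<^sup>1) e\<^sub>i\<close>. If \<open>y = \<Sum>\<^sub>n a\<^sub>n e\<^sub>i\<^sup>n\<close>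
  and \<open>ad\<^bsub>f\<^sub>i\<^esub>(y) \<in> U\<^sup>+\<close>, then \<open>B k\<^sub>i\<^sup>2 \<in> U\<^sup>+\<close> for \<open>B = \<Sum>\<^sub>n \<beta>\<^sub>n a\<^sub>n e\<^sub>i\<^sup>n\<^sup>-\<^sup>1\<close> with \<open>\<beta>\<^sub>n \<noteq> 0\<close> for \<open>n \<ge> 1\<close>. Letting
  \<open>U\<close> act on lowest weight modules of two different weights forces \<open>B = 0\<close>; as \<open>B\<close> has smaller degree
  in \<open>e\<^sub>i\<close>, induction gives \<open>a\<^sub>n = 0\<close> for \<open>n \<ge> 1\<close>, so \<open>y \<in> A\<close>. As \<open>U\<close> is a quotient depending on
  the datum and hence not a type, the computations take place in a faithful image of \<open>U\<close> in an algebra of linear endomorphisms.\<close>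

section \<open>Modules and algebras over the field of rational functions\<close>

text \<open>The coset map \<open>ad\<close> is an action only once the operators \<open>adE\<close>,
  \<open>adF\<close>, \<open>adK\<close> are known to satisfy the defining relations themselves
  (\<open>quantum_ad\<close>). The hard ones are the Serre relations: each operator is a sum of a
  left and a right multiplication, up to twists, that commute up to a power of q, and a Serre
  expression is an iterated q-commutator in disguise, which splits additively over such sums. The
  other obstacle is \<open>B = 0\<close>, usually read off from the triangular decomposition.
  Modules on words show just enough of it: on a lowest weight vector k_i^2 is a scalar that varies
  with the weight, while an element of U^+ acts by left multiplication whatever the weight. The
  square arises because the right factor k_i in \<open>adF\<close> turns k_i - k_i^-1 into k_i^2 -
  1. Directness of the sum of the A e_i^n is not presupposed; the same induction delivers
  it.\<close>

class qmod = ab_group_add +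
  fixes scl :: "qfield \<Rightarrow> 'a \<Rightarrow> 'a" (infixr \<open>*q\<close> 75)
  assumes scl_distrib_right: "a *q (x + y) = a *q x + a *q y"
    and scl_distrib_left: "(a + b) *q x = a *q x + b *q x"
    and scl_scl [simp]: "a *q (b *q x) = (a * b) *q x"
    and scl_one [simp]: "1 *q x = x"
    and nontrivial: "\<exists>x. x \<noteq> 0"

global_interpretation qmod: vector_space "scl :: qfield \<Rightarrow> 'a \<Rightarrow> 'a::qmod"
  by unfold_locales (simp_all add: scl_distrib_right scl_distrib_left)

declare qmod.scale_zero_left [simp] qmod.scale_zero_right [simp]

lemmas scl_simps = qmod.scale_right_distrib qmod.scale_left_distrib
  qmod.scale_right_diff_distrib qmod.scale_left_diff_distrib
  qmod.scale_minus_left qmod.scale_minus_right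

class qalg = ring_1 + qmod +
  assumes scl_mult_left [simp]: "(a *q x) * y = a *q (x * y)"
    and scl_mult_right [simp]: "x * (a *q y) = a *q (x * y)"

text \<open>Operators get the same class \<open>qalg\<close> as algebras, so that one locale
  \<open>quantum\<close> serves for the generators of U and for operators such as
  \<open>adE\<close>.\<close>

typedef (overloaded) ('a::qmod) endo =
  "{f :: 'a \<Rightarrow> 'a. (\<forall>x y. f (x + y) = f x + f y) \<and> (\<forall>a x. f (a *q x) = a *q f x)}"
  morphisms app Endo
  by (rule exI[of _ id]) auto

setup_lifting type_definition_endo

notation app (infixr \<open>\<bullet>\<close> 80)

instantiation endo :: (qmod) qalg
begin

lift_definition zero_endo :: "'a endo" is "\<lambda>_. 0" by simp
lift_definition one_endo :: "'a endo" is "\<lambda>x. x" by simp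
lift_definition plus_endo :: "'a endo \<Rightarrow> 'a endo \<Rightarrow> 'a endo" is "\<lambda>f g x. f x + g x"
  by (simp add: scl_distrib_right ac_simps)
lift_definition uminus_endo :: "'a endo \<Rightarrow> 'a endo" is "\<lambda>f x. - f x"
  by simp
lift_definition minus_endo :: "'a endo \<Rightarrow> 'a endo \<Rightarrow> 'a endo" is "\<lambda>f g x. f x - g x"
  by (simp add: scl_simps)
lift_definition times_endo :: "'a endo \<Rightarrow> 'a endo \<Rightarrow> 'a endo" is "\<lambda>f g x. f (g x)"
  by simp
lift_definition scl_endo :: "qfield \<Rightarrow> 'a endo \<Rightarrow> 'a endo" is "\<lambda>a f x. a *q f x"
  by (simp add: scl_simps mult.commute)

instance
proof
  fix f g h :: "'a endo" and a b :: qfield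
  show "f + g + h = f + (g + h)" by transfer (simp add: ac_simps)
  show "f + g = g + f" by transfer (simp add: ac_simps)
  show "0 + f = f" by transfer simp
  show "- f + f = 0" by transfer simp
  show "f - g = f + - g" by transfer simp
  show "f * g * h = f * (g * h)" by transfer simp
  show "1 * f = f" by transfer simp
  show "f * 1 = f" by transfer simp
  show "(f + g) * h = f * h + g * h" by transfer simp
  show "f * (g + h) = f * g + f * h" by transfer simp
  \<comment> \<open>The class \<open>ring_1\<close> demands that 0 and 1 differ, which fails for
    endomorphisms of the zero space; hence \<open>nontrivial\<close> in \<open>qmod\<close>.\<close>
  obtain x :: 'a where "x \<noteq> 0" using nontrivial by blast
  then have "(\<lambda>_. 0) \<noteq> (\<lambda>x::'a. x)" by metis
  then show "(0::'a endo) \<noteq> 1" by transfer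
  then show "\<exists>f::'a endo. f \<noteq> 0" by metis
  show "a *q (f + g) = a *q f + a *q g" by transfer (simp add: scl_simps)
  show "(a + b) *q f = a *q f + b *q f" by transfer (simp add: scl_simps)
  show "a *q b *q f = (a * b) *q f" by transfer simp
  show "1 *q f = f" by transfer simp
  show "(a *q f) * g = a *q (f * g)" by transfer simp
  show "f * (a *q g) = a *q (f * g)" by transfer simp
qed

end

lemma app_simps [simp]:
  "0 \<bullet> x = 0" "1 \<bullet> x = x" "(f + g) \<bullet> x = f \<bullet> x + g \<bullet> x" "(- f) \<bullet> x = - (f \<bullet> x)"
  "(f - g) \<bullet> x = f \<bullet> x - g \<bullet> x" "(f * g) \<bullet> x = f \<bullet> g \<bullet> x" "(a *q f) \<bullet> x = a *q (f \<bullet> x)"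
  "f \<bullet> (x + y) = f \<bullet> x + f \<bullet> y" "f \<bullet> (a *q x) = a *q (f \<bullet> x)"
  by (transfer, simp)+

lemma app_zero [simp]: "f \<bullet> 0 = 0"
  using app_simps(9)[of f 0 0] by simp

lemma app_uminus [simp]: "f \<bullet> (- x) = - (f \<bullet> x)"
  using app_simps(9)[of f "-1" x] by simp

lemma app_diff [simp]: "f \<bullet> (x - y) = f \<bullet> x - f \<bullet> y"
  using app_simps(8)[of f x "- y"] by simp

lemma endo_eqI: "(\<And>x. f \<bullet> x = g \<bullet> x) \<Longrightarrow> f = g"
  by transfer auto

lemma app_sum_left: "sum F A \<bullet> x = (\<Sum>a\<in>A. F a \<bullet> x)"
  by (induction A rule: infinite_finite_induct) simp_all

lemma app_sum: "f \<bullet> sum F A = (\<Sum>a\<in>A. f \<bullet> F a)"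
  by (induction A rule: infinite_finite_induct) simp_all

lemma app_Endo: "(\<And>x y. F (x + y) = F x + F y) \<Longrightarrow> (\<And>a x. F (a *q x) = a *q F x) \<Longrightarrow> Endo F \<bullet> x = F x"
  by (simp add: Endo_inverse)

definition Lmul :: "'a::qalg \<Rightarrow> 'a endo" where "Lmul a = Endo (\<lambda>x. a * x)"
definition Rmul :: "'a::qalg \<Rightarrow> 'a endo" where "Rmul a = Endo (\<lambda>x. x * a)"

lemma Lmul_app [simp]: "Lmul a \<bullet> x = a * x"
  and Rmul_app [simp]: "Rmul a \<bullet> x = x * a"
  by (simp_all add: Lmul_def Rmul_def app_Endo algebra_simps)


subsection \<open>Linear extension\<close>

definition lext :: "('m \<Rightarrow> 'v::qmod) \<Rightarrow> ('m \<Rightarrow>\<^sub>0 qfield) \<Rightarrow> 'v" where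
  "lext g p = (\<Sum>w\<in>Poly_Mapping.keys p. Poly_Mapping.lookup p w *q g w)"

lemma lext_superset:
  assumes "finite A" "Poly_Mapping.keys p \<subseteq> A"
  shows "lext g p = (\<Sum>w\<in>A. Poly_Mapping.lookup p w *q g w)"
  unfolding lext_def
  by (rule sum.mono_neutral_left) (use assms in \<open>auto simp: in_keys_iff\<close>)

lemma lext_add: "lext g (p + p') = lext g p + lext g p'"
proof -
  let ?A = "Poly_Mapping.keys p \<union> Poly_Mapping.keys p'"
  have "Poly_Mapping.keys (p + p') \<subseteq> ?A" by (rule keys_add)
  then show ?thesis
    by (simp add: lext_superset[of ?A] lookup_add scl_simps sum.distrib)
qed

lemma lext_zero [simp]: "lext g 0 = 0"
  by (simp add: lext_def)

lemma lext_single [simp]: "lext g (Poly_Mapping.single w a) = a *q g w"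
  by (simp add: lext_superset[of "{w}"])

lemma poly_mapping_additive_induct [case_names zero single add]:
  fixes p :: "'m \<Rightarrow>\<^sub>0 'k::comm_monoid_add"
  assumes "P 0" "\<And>w a. P (Poly_Mapping.single w a)" "\<And>p q. P p \<Longrightarrow> P q \<Longrightarrow> P (p + q)"
  shows "P p"
proof (induction p rule: update_induct)
  case const
  show ?case by (fact assms(1))
next
  case (update p w a)
  have "Poly_Mapping.update w a p = p + Poly_Mapping.single w a"
    using update(1) by (intro poly_mapping_eqI)
      (auto simp: lookup_update lookup_add lookup_single when_def in_keys_iff)
  with update assms show ?case by metis
qed

lemma lext_mult:
  fixes g :: "'m::monoid_add \<Rightarrow> 'r::qalg"
  assumes "\<And>u v. g (u + v) = g u * g v"
  shows "lext g (p * q) = lext g p * lext g q"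
proof (induction p rule: poly_mapping_additive_induct)
  case (single u a)
  show ?case
    by (induction q rule: poly_mapping_additive_induct)
      (simp_all add: mult_single assms distrib_left lext_add mult_ac)
qed (simp_all add: distrib_right lext_add)


text \<open>A class is instantiated for a type constructor, not for
  \<open>'m \<Rightarrow>\<^sub>0 qfield\<close> with its coefficients fixed; hence this copy of the
  free vector space on \<open>'m\<close>.\<close>

typedef 'm vec = "UNIV :: ('m \<Rightarrow>\<^sub>0 qfield) set"
  morphisms coef Vec ..

setup_lifting type_definition_vec

lemma lookup_map_scale: "Poly_Mapping.lookup (Poly_Mapping.map ((*) a) p) w = a * Poly_Mapping.lookup p w"
  for a :: "'k::semiring_0"
  by (simp add: Poly_Mapping.map.rep_eq when_def)

instantiation vec :: (type) qmod
begin

lift_definition zero_vec :: "'a vec" is 0 .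
lift_definition plus_vec :: "'a vec \<Rightarrow> 'a vec \<Rightarrow> 'a vec" is "(+)" .
lift_definition uminus_vec :: "'a vec \<Rightarrow> 'a vec" is uminus .
lift_definition minus_vec :: "'a vec \<Rightarrow> 'a vec \<Rightarrow> 'a vec" is "(-)" .
definition scl_vec :: "qfield \<Rightarrow> 'a vec \<Rightarrow> 'a vec"
  where "scl_vec a v = Vec (Poly_Mapping.map ((*) a) (coef v))"

instance
proof
  fix f g h :: "'a vec" and a b :: qfield
  show "f + g + h = f + (g + h)" by transfer (simp add: ac_simps)
  show "f + g = g + f" by transfer (simp add: ac_simps)
  show "0 + f = f" by transfer simp
  show "- f + f = 0" by transfer simp
  show "f - g = f + - g" by transfer simp
  have eqI: "(\<And>w. Poly_Mapping.lookup (coef u) w = Poly_Mapping.lookup (coef v) w) \<Longrightarrow> u = v"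
    for u v :: "'a vec"
    by (metis coef_inject poly_mapping_eqI)
  note simps = scl_vec_def Vec_inverse lookup_map_scale lookup_add plus_vec.rep_eq
  show "a *q (f + g) = a *q f + a *q g" by (rule eqI) (simp add: simps distrib_left)
  show "(a + b) *q f = a *q f + b *q f" by (rule eqI) (simp add: simps distrib_right)
  show "a *q b *q f = (a * b) *q f" by (rule eqI) (simp add: simps)
  show "1 *q f = f" by (rule eqI) (simp add: simps)
  have "Poly_Mapping.single (undefined :: 'a) (1 :: qfield) \<noteq> 0"
  proof
    assume "Poly_Mapping.single (undefined :: 'a) (1 :: qfield) = 0"
    then have "Poly_Mapping.lookup (Poly_Mapping.single (undefined :: 'a) (1 :: qfield)) undefined = 0"
      by simp
    then show False by simp
  qed
  then have "Vec (Poly_Mapping.single (undefined :: 'a) 1) \<noteq> 0"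
    by (simp add: zero_vec_def Vec_inject)
  then show "\<exists>f::'a vec. f \<noteq> 0" ..
qed

end

definition bas :: "'m \<Rightarrow> 'm vec" where "bas w = Vec (Poly_Mapping.single w 1)"

definition vext :: "('m \<Rightarrow> 'v::qmod) \<Rightarrow> 'm vec \<Rightarrow> 'v" where "vext g v = lext g (coef v)"

lemma vext_bas [simp]: "vext g (bas w) = g w"
  by (simp add: vext_def bas_def Vec_inverse)

lemma vext_add: "vext g (x + y) = vext g x + vext g y"
  unfolding vext_def by transfer (simp add: lext_add)

lemma vext_scl:
  fixes g :: "'m \<Rightarrow> 'v::qmod"
  shows "vext g (a *q x) = a *q vext g x"
proof -
  have "lext g (Poly_Mapping.map ((*) a) p) = a *q lext g p" for p :: "'m \<Rightarrow>\<^sub>0 qfield"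
    by (subst lext_superset[of "Poly_Mapping.keys p"])
      (auto simp: lookup_map_scale in_keys_iff lext_def qmod.scale_sum_right)
  then show ?thesis
    by (simp add: vext_def scl_vec_def Vec_inverse)
qed

lemma vec_induct [case_names basis add scl]:
  assumes "\<And>w. P (bas w)" "\<And>x y. P x \<Longrightarrow> P y \<Longrightarrow> P (x + y)" "\<And>a x. P x \<Longrightarrow> P (a *q x)"
  shows "P v"
proof -
  have single_Vec: "Vec (Poly_Mapping.single w a) = a *q bas w" for w a
    unfolding bas_def
    by (simp add: scl_vec_def Vec_inverse map_single)
  have zero_Vec: "Vec 0 = 0 *q bas undefined"
    by (simp add: zero_vec.abs_eq)
  have "P (Vec p)" for p
  proof (induction p rule: poly_mapping_additive_induct)
    case zero
    show ?case unfolding zero_Vec by (intro assms)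
  next
    case (single w a)
    show ?case unfolding single_Vec by (intro assms)
  next
    case (add p q)
    then show ?case using assms(2) by (simp add: plus_vec.abs_eq[symmetric])
  qed
  then show ?thesis by (metis coef_inverse)
qed

lemma endo_eq_on_basis:
  fixes f g :: "'m vec endo"
  assumes "\<And>w. f \<bullet> bas w = g \<bullet> bas w"
  shows "f = g"
proof (rule endo_eqI)
  show "f \<bullet> x = g \<bullet> x" for x
    by (induction x rule: vec_induct) (simp_all add: assms)
qed

definition vendo :: "('m \<Rightarrow> 'm vec) \<Rightarrow> 'm vec endo" where "vendo g = Endo (vext g)"

lemma vendo_bas [simp]: "vendo g \<bullet> bas w = g w"
  by (simp add: vendo_def app_Endo vext_add vext_scl)


subsection \<open>Representations of the free algebra\<close>

definition ev :: "('g \<Rightarrow> 'r::qalg) \<Rightarrow> ('g list \<Rightarrow>\<^sub>0 qfield) \<Rightarrow> 'r" where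
  "ev g = lext (\<lambda>w. prod_list (map g w))"

definition alg_hom :: "(('g list \<Rightarrow>\<^sub>0 qfield) \<Rightarrow> 'r::qalg) \<Rightarrow> bool" where
  "alg_hom \<phi> \<longleftrightarrow> (\<forall>s t. \<phi> (s + t) = \<phi> s + \<phi> t) \<and> (\<forall>s t. \<phi> (s * t) = \<phi> s * \<phi> t) \<and>
     (\<forall>c. \<phi> (fconst c) = c *q 1)"

lemma word_Nil: "word [] = 1"
  unfolding word_def by (metis single_one zero_list_def)

lemma ev_alg_hom: "alg_hom (ev g)"
proof -
  have "ev g (fconst c) = c *q 1" for c
    by (simp add: ev_def fconst_def zero_list_def)
  then show ?thesis
    unfolding alg_hom_def ev_def by (simp add: lext_add lext_mult plus_list_def)
qed

lemma ev_word: "ev g (word w) = prod_list (map g w)"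
  by (simp add: ev_def word_def)

lemma
  assumes "alg_hom \<phi>"
  shows alg_hom_add: "\<phi> (s + t) = \<phi> s + \<phi> t"
    and alg_hom_mult: "\<phi> (s * t) = \<phi> s * \<phi> t"
    and alg_hom_const: "\<phi> (fconst c) = c *q 1"
    and alg_hom_zero: "\<phi> 0 = 0"
    and alg_hom_one: "\<phi> 1 = 1"
    and alg_hom_uminus: "\<phi> (- s) = - \<phi> s"
    and alg_hom_diff: "\<phi> (s - t) = \<phi> s - \<phi> t"
    and alg_hom_power: "\<phi> (s ^ n) = \<phi> s ^ n"
    and alg_hom_sum: "\<phi> (sum h A) = (\<Sum>a\<in>A. \<phi> (h a))"
proof -
  show add: "\<phi> (s + t) = \<phi> s + \<phi> t" for s t using assms by (simp add: alg_hom_def)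
  show mult: "\<phi> (s * t) = \<phi> s * \<phi> t" for s t using assms by (simp add: alg_hom_def)
  show const: "\<phi> (fconst c) = c *q 1" for c using assms by (simp add: alg_hom_def)
  show zero: "\<phi> 0 = 0" using add[of 0 0] by simp
  show one: "\<phi> 1 = 1" using const[of 1] by (simp add: fconst_def)
  show um: "\<phi> (- s) = - \<phi> s" for s using add[of s "- s"] zero by (simp add: eq_neg_iff_add_eq_0 add.commute)
  show "\<phi> (s - t) = \<phi> s - \<phi> t" using add[of s "- t"] um by simp
  show "\<phi> (s ^ n) = \<phi> s ^ n" by (induction n) (simp_all add: one mult)
  show "\<phi> (sum h A) = (\<Sum>a\<in>A. \<phi> (h a))"
    by (induction A rule: infinite_finite_induct) (simp_all add: zero add)
qed

lemmas alg_hom_simps = alg_hom_add alg_hom_mult alg_hom_const alg_hom_zero alg_hom_one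
  alg_hom_uminus alg_hom_diff alg_hom_power alg_hom_sum


section \<open>Quantum integers and the quantum Serre expression\<close>

text \<open>Nonzero and not a root of unity. Through \<open>generic_qvar\<close> this is the only
  fact about \<open>qvar\<close> that enters.\<close>

definition generic :: "qfield \<Rightarrow> bool" where
  "generic Q \<longleftrightarrow> Q \<noteq> 0 \<and> (\<forall>n. Q powi n = 1 \<longrightarrow> n = 0)"

lemma qvar_power: "qvar ^ n = Fract (monom 1 n) 1"
  by (induction n) (simp_all add: qvar_def One_fract_def monom_0 monom_Suc one_pCons)

lemma generic_qvar: "generic qvar"
proof -
  have nz: "qvar \<noteq> 0"
    by (simp add: qvar_def Zero_fract_def eq_fract)
  have pow: "n = 0" if "qvar ^ n = 1" for n
  proof -
    have "monom 1 n = (1 :: rat poly)"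
      using that by (simp add: qvar_power One_fract_def eq_fract)
    then have "degree (monom (1::rat) n) = 0" by simp
    then show ?thesis by (simp add: degree_monom_eq)
  qed
  have "n = 0" if "qvar powi n = 1" for n
  proof (cases "0 \<le> n")
    case True
    with that pow[of "nat n"] show ?thesis by (simp add: power_int_def)
  next
    case False
    with that have "qvar ^ nat (- n) = 1"
      by (simp add: power_int_def power_inverse)
    with pow[of "nat (- n)"] False show ?thesis by simp
  qed
  with nz show ?thesis by (simp add: generic_def)
qed

lemma generic_powi: "generic (Q powi d)" if "generic Q" "d \<noteq> 0"
  using that by (auto simp: generic_def power_int_mult[symmetric])

definition qn :: "qfield \<Rightarrow> int \<Rightarrow> qfield" where
  "qn Q m = (Q powi m - Q powi (- m)) / (Q - inverse Q)"

definition qnf :: "qfield \<Rightarrow> nat \<Rightarrow> qfield" where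
  "qnf Q n = (\<Prod>l=1..n. qn Q (int l))"

lemma generic_nonzero: "generic Q \<Longrightarrow> Q \<noteq> 0"
  by (simp add: generic_def)

lemma generic_diff_nonzero:
  assumes "generic Q" "m \<noteq> 0"
  shows "Q powi m - Q powi (- m) \<noteq> 0"
proof
  assume "Q powi m - Q powi (- m) = 0"
  then have "Q powi m * Q powi m = Q powi m * Q powi (- m)" by simp
  then have "Q powi (m + m) = 1"
    using generic_nonzero[OF assms(1)] power_int_add[of Q m m] by (simp add: power_int_minus)
  with assms show False by (auto simp: generic_def)
qed

lemma generic_denominator: "generic Q \<Longrightarrow> Q - inverse Q \<noteq> 0"
  using generic_diff_nonzero[of Q 1] by simp

lemma qn_nonzero: "generic Q \<Longrightarrow> m \<noteq> 0 \<Longrightarrow> qn Q m \<noteq> 0"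
  using generic_diff_nonzero generic_denominator by (simp add: qn_def)

lemma qn_zero [simp]: "qn Q 0 = 0"
  by (simp add: qn_def)

lemma qn_one: "generic Q \<Longrightarrow> qn Q 1 = 1"
  using generic_denominator by (simp add: qn_def)

lemma qnf_nonzero: "generic Q \<Longrightarrow> qnf Q n \<noteq> 0"
  by (simp add: qnf_def qn_nonzero)

lemma qnf_Suc: "qnf Q (Suc n) = qn Q (int (Suc n)) * qnf Q n"
  by (simp add: qnf_def mult.commute)

lemma qn_split:
  assumes "generic Q"
  shows "qn Q (a + b) = Q powi (- b) * qn Q a + Q powi a * qn Q b"
proof -
  have "Q powi (a + b) - Q powi (- (a + b)) =
      Q powi (- b) * (Q powi a - Q powi (- a)) + Q powi a * (Q powi b - Q powi (- b))"
    using generic_nonzero[OF assms] by (simp add: right_diff_distrib add.commute flip: power_int_add)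
  then show ?thesis by (simp add: qn_def add_divide_distrib)
qed

text \<open>Telescoping: [m][c+m-1] is the sum of the [c+2l] over l < m, the contributions that
  \<open>f_qcomm\<close> collects along a string.\<close>

lemma qn_step:
  assumes "generic Q"
  shows "qn Q (int m) * qn Q (c + int m - 1) + qn Q (c + 2 * int m) = qn Q (int (Suc m)) * qn Q (c + int m)"
proof -
  define h where "h = Q - inverse Q"
  have h: "h \<noteq> 0" using generic_denominator[OF assms] by (simp add: h_def)
  have Q: "Q \<noteq> 0" using assms by (rule generic_nonzero)
  define p where "p a = Q powi a" for a
  have pp: "p a * p b = p (a + b)" for a b using Q by (simp add: p_def power_int_add)
  have hp: "h = p 1 - p (-1)" by (simp add: h_def p_def power_int_minus)
  have "(p (int m) - p (- int m)) * (p (c + int m - 1) - p (- (c + int m - 1)))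
      + (p (c + 2 * int m) - p (- (c + 2 * int m))) * h
     = (p (int (Suc m)) - p (- int (Suc m))) * (p (c + int m) - p (- (c + int m)))"
    unfolding hp by (simp add: left_diff_distrib right_diff_distrib pp)
      (simp add: algebra_simps, rule arg_cong[where f = p], simp)
  moreover have "(s / h) * (t / h) + u / h = (v / h) * (z / h)" if "s * t + u * h = v * z" for s t u v z
    using that h by (simp add: field_simps)
  ultimately show ?thesis
    unfolding qn_def p_def[symmetric] h_def[symmetric] by blast
qed

section \<open>Gaussian binomials and iterated q-commutators\<close>

fun qbinom :: "qfield \<Rightarrow> nat \<Rightarrow> nat \<Rightarrow> qfield" where
  "qbinom Q n 0 = 1"
| "qbinom Q 0 (Suc l) = 0"
| "qbinom Q (Suc n) (Suc l) =
     Q powi (- int (Suc l)) * qbinom Q n (Suc l) + Q powi (int n - int l) * qbinom Q n l"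

lemma qbinom_gt [simp]: "n < l \<Longrightarrow> qbinom Q n l = 0"
  by (induction Q n l rule: qbinom.induct) simp_all

text \<open>The recursion is the Pascal rule that \<open>qn_split\<close> yields for n + 1 = (n - l)
  + (l + 1); this identifies \<open>qbinom\<close> with the balanced Gaussian binomial.\<close>

lemma qbinom_fact:
  assumes "generic Q" "l \<le> n"
  shows "qbinom Q n l * (qnf Q l * qnf Q (n - l)) = qnf Q n"
  using assms
proof (induction Q n l rule: qbinom.induct)
  case (1 Q n)
  then show ?case by (simp add: qnf_def)
next
  case (3 Q n l)
  have b: "qbinom Q n l * (qnf Q l * qnf Q (n - l)) = qnf Q n" using 3 by simp
  have a: "qbinom Q n (Suc l) * (qnf Q (Suc l) * qnf Q (n - l)) = qn Q (int n - int l) * qnf Q n"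
  proof (cases "l = n")
    case False
    then have *: "n - l = Suc (n - Suc l)" "int (Suc (n - Suc l)) = int n - int l" using 3 by auto
    have "qbinom Q n (Suc l) * (qnf Q (Suc l) * qnf Q (n - Suc l)) = qnf Q n"
      using False 3 by simp
    then show ?thesis unfolding *(1) qnf_Suc[of Q "n - Suc l"] *(2) by (simp add: mult_ac)
  qed simp
  have s: "qn Q (int (Suc n)) = Q powi (- int (Suc l)) * qn Q (int n - int l)
      + Q powi (int n - int l) * qn Q (int (Suc l))"
    using qn_split[OF 3(3), of "int n - int l" "int (Suc l)"] by (simp add: add.commute)
  have "qbinom Q (Suc n) (Suc l) * (qnf Q (Suc l) * qnf Q (Suc n - Suc l)) =
      Q powi (- int (Suc l)) * (qbinom Q n (Suc l) * (qnf Q (Suc l) * qnf Q (n - l)))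
      + Q powi (int n - int l) * qn Q (int (Suc l)) * (qbinom Q n l * (qnf Q l * qnf Q (n - l)))"
    by (simp add: qnf_Suc algebra_simps del: of_nat_Suc)
  also have "\<dots> = qnf Q (Suc n)"
    unfolding a b qnf_Suc[of Q n] s by (simp add: algebra_simps del: of_nat_Suc)
  finally show ?case .
qed simp

text \<open>For \<open>c = 1 - n\<close> the \<open>n\<close>-th iterated \<open>q\<close>-commutator is, up to a unit, the Serre expression.
  Its operators \<open>y \<mapsto> x y - Q\<^bsup>c + 2 m\<^esup> y x\<close> commute with each other.\<close>

fun qcomm :: "qfield \<Rightarrow> int \<Rightarrow> 'r::qalg \<Rightarrow> 'r \<Rightarrow> nat \<Rightarrow> 'r" where
  "qcomm Q c x y 0 = y"
| "qcomm Q c x y (Suc m) = x * qcomm Q c x y m - Q powi (c + 2 * int m) *q (qcomm Q c x y m * x)"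

text \<open>The Gaussian binomial theorem for the product over m < n of L - Q^(c+2m) R, where L and
  R are left and right multiplication by \<open>x\<close>.\<close>

lemma qcomm_expand:
  fixes x y :: "'r::qalg"
  assumes "Q \<noteq> 0"
  shows "qcomm Q c x y n =
    (\<Sum>l\<le>n. ((-1) ^ l * Q powi (int l * (c + int n - 1)) * qbinom Q n l) *q (x ^ (n - l) * y * x ^ l))"
proof (induction n)
  case (Suc n)
  define g where "g n l = (-1) ^ l * Q powi (int l * (c + int n - 1)) * qbinom Q n l" for n l
  define A where "A l = x ^ (Suc n - l) * y * x ^ l" for l
  have IH: "qcomm Q c x y n = (\<Sum>l\<le>n. g n l *q (x ^ (n - l) * y * x ^ l))"
    using Suc by (simp add: g_def)
  have "x * qcomm Q c x y n = (\<Sum>l\<le>n. g n l *q A l)"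
    unfolding IH sum_distrib_left A_def
    by (intro sum.cong) (simp_all add: Suc_diff_le mult.assoc)
  also have "\<dots> = (\<Sum>l\<le>Suc n. g n l *q A l)"
    by (simp add: g_def)
  also have "\<dots> = g n 0 *q A 0 + (\<Sum>l\<le>n. g n (Suc l) *q A (Suc l))"
    by (rule sum.atMost_Suc_shift)
  finally have 1: "x * qcomm Q c x y n = \<dots>" .
  have 2: "qcomm Q c x y n * x = (\<Sum>l\<le>n. g n l *q A (Suc l))"
    unfolding IH sum_distrib_right A_def
    by (intro sum.cong) (simp_all add: mult.assoc power_commutes)
  have 3: "g (Suc n) (Suc l) = g n (Suc l) - Q powi (c + 2 * int n) * g n l" for l
  proof -
    have e: "Q powi (int (Suc l) * (c + int (Suc n) - 1)) * Q powi (- int (Suc l))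
        = Q powi (int (Suc l) * (c + int n - 1))"
      "Q powi (int (Suc l) * (c + int (Suc n) - 1)) * Q powi (int n - int l)
        = Q powi (c + 2 * int n) * Q powi (int l * (c + int n - 1))"
      using assms by (simp_all flip: power_int_add) (simp_all add: algebra_simps)
    have "g (Suc n) (Suc l) = (-1) ^ Suc l * ((Q powi (int (Suc l) * (c + int (Suc n) - 1)) * Q powi (- int (Suc l))) * qbinom Q n (Suc l))
       + (-1) ^ Suc l * ((Q powi (int (Suc l) * (c + int (Suc n) - 1)) * Q powi (int n - int l)) * qbinom Q n l)"
      unfolding g_def qbinom.simps by (simp add: distrib_left mult.assoc)
    then show ?thesis unfolding e by (simp add: g_def mult_ac)
  qed
  have "qcomm Q c x y (Suc n) = g (Suc n) 0 *q A 0 + (\<Sum>l\<le>n. g (Suc n) (Suc l) *q A (Suc l))"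
    unfolding qcomm.simps 1 2 3
    by (simp add: g_def scl_simps sum_subtractf qmod.scale_sum_right)
  also have "\<dots> = (\<Sum>l\<le>Suc n. g (Suc n) l *q A l)"
    by (rule sum.atMost_Suc_shift[symmetric])
  finally show ?case by (simp only: g_def A_def)
qed simp

definition qserre :: "qfield \<Rightarrow> 'r::qalg \<Rightarrow> 'r \<Rightarrow> nat \<Rightarrow> 'r" where
  "qserre Q x y n = (\<Sum>l\<le>n. ((-1) ^ l / (qnf Q l * qnf Q (n - l))) *q (x ^ l * y * x ^ (n - l)))"

lemma minus_one_power_diff: "l \<le> n \<Longrightarrow> (-1) ^ (n - l) = (-1) ^ n * (-1::'a::comm_ring_1) ^ l"
  by (metis (no_types, lifting) add_diff_inverse_nat left_minus_one_mult_self linorder_not_le mult.assoc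
      mult.commute power_add)

lemma qserre_reverse:
  "(\<Sum>l\<le>n. ((-1) ^ l / (qnf Q l * qnf Q (n - l))) *q (x ^ (n - l) * y * x ^ l)) = (-1) ^ n *q qserre Q x y n"
proof -
  have "(\<Sum>l\<le>n. ((-1) ^ l / (qnf Q l * qnf Q (n - l))) *q (x ^ (n - l) * y * x ^ l))
     = (\<Sum>l\<le>n. ((-1) ^ (n - l) / (qnf Q l * qnf Q (n - l))) *q (x ^ l * y * x ^ (n - l)))"
    by (rule sum.reindex_bij_witness[where i = "\<lambda>l. n - l" and j = "\<lambda>l. n - l"])
      (auto simp: mult.commute)
  also have "\<dots> = (-1) ^ n *q qserre Q x y n"
    unfolding qserre_def qmod.scale_sum_right
    by (intro sum.cong) (simp_all add: minus_one_power_diff)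
  finally show ?thesis .
qed

text \<open>For c = 1 - n the exponent l (c + n - 1) in \<open>qcomm_expand\<close> is 0, so only
  signs and binomials survive. The sign (-1)^n comes from reversing the order of summation.\<close>

lemma qcomm_eq_qserre:
  assumes "generic Q" "c = 1 - int n"
  shows "qcomm Q c x y n = (qnf Q n * (-1) ^ n) *q qserre Q x y n"
proof -
  have "qbinom Q n l = qnf Q n / (qnf Q l * qnf Q (n - l))" if "l \<le> n" for l
    using qbinom_fact[OF assms(1) that] qnf_nonzero[OF assms(1)] by (simp add: field_simps)
  then have "qcomm Q c x y n
     = (\<Sum>l\<le>n. qnf Q n *q (((-1) ^ l / (qnf Q l * qnf Q (n - l))) *q (x ^ (n - l) * y * x ^ l)))"
    unfolding qcomm_expand[OF generic_nonzero[OF assms(1)]] using assms(2)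
    by (intro sum.cong) (simp_all add: mult_ac)
  also have "\<dots> = qnf Q n *q ((-1) ^ n *q qserre Q x y n)"
    by (simp only: qserre_reverse flip: qmod.scale_sum_right)
  finally show ?thesis by simp
qed

lemma qcomm_zero_iff:
  assumes "generic Q" "c = 1 - int n"
  shows "qcomm Q c x y n = 0 \<longleftrightarrow> qserre Q x y n = 0"
  using qcomm_eq_qserre[OF assms, of x y] qnf_nonzero[OF assms(1)] by simp

lemma qcomm_add: "qcomm Q c x (y + y') n = qcomm Q c x y n + qcomm Q c x y' n"
  by (induction n) (simp_all add: algebra_simps scl_simps)

lemma qcomm_mult_commute:
  assumes "g * x = x * g"
  shows "g * qcomm Q c x y m = qcomm Q c x (g * y) m" "qcomm Q c x y m * g = qcomm Q c x (y * g) m"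
proof -
  have g: "g * (x * z) = x * (g * z)" for z using assms by (metis mult.assoc)
  show "g * qcomm Q c x y m = qcomm Q c x (g * y) m"
  proof (induction m)
    case (Suc m)
    show ?case by (simp add: right_diff_distrib g Suc[symmetric] mult.assoc)
  qed simp
  show "qcomm Q c x y m * g = qcomm Q c x (y * g) m"
  proof (induction m)
    case (Suc m)
    show ?case by (simp add: left_diff_distrib mult.assoc assms[symmetric] Suc[symmetric])
  qed simp
qed

lemma qcomm_diff: "qcomm Q c x (y - y') m = qcomm Q c x y m - qcomm Q c x y' m"
  using qcomm_add[of Q c x "y - y'" y' m] by simp

lemma qcomm_scl: "qcomm Q c x (a *q y) m = a *q qcomm Q c x y m"
  by (induction m) (simp_all add: scl_simps mult.commute)

lemma qcomm_zero_right: "qcomm Q c x 0 m = 0"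
  by (induction m) simp_all

text \<open>The factors commute, so the one with the largest exponent may be applied first instead
  of last.\<close>

lemma qcomm_Suc_first:
  "qcomm Q c x y (Suc n) = qcomm Q c x (x * y - Q powi (c + 2 * int n) *q (y * x)) n"
proof -
  have "x * qcomm Q c x y m - a *q (qcomm Q c x y m * x) = qcomm Q c x (x * y - a *q (y * x)) m" for a m
  proof (induction m)
    case (Suc m)
    show ?case
      unfolding qcomm.simps(2)[of Q c x "x * y - a *q (y * x)"] Suc[symmetric]
      by (simp add: algebra_simps scl_simps)
  qed simp
  then show ?thesis by simp
qed

text \<open>The two summands of \<open>y + y'\<close> are treated separately: for \<open>y\<close> the \<open>q\<close>-commutators are
  formed in the given order, for \<open>y'\<close> in the reversed one.\<close>

lemma qserre_sum:
  fixes x x' y y' :: "'r::qalg"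
  assumes Q: "generic Q" and n: "c = 1 - int n"
    and comm: "x' * x = Q powi 2 *q (x * x')" "x' * y = Q powi c *q (y * x')"
      "y' * x = Q powi c *q (x * y')"
    and serre: "qserre Q x y n = 0" "qserre Q x' y' n = 0"
  shows "qserre Q (x + x') (y + y') n = 0"
proof -
  have Q0: "Q \<noteq> 0" using Q by (rule generic_nonzero)
  \<comment> \<open>The scalar by which \<open>x'\<close> moves past the m-th commutator is the one
    subtracted by the next factor, so \<open>x'\<close> contributes nothing.\<close>
  have "qcomm Q c (x + x') y m = qcomm Q c x y m \<and>
      x' * qcomm Q c x y m = Q powi (c + 2 * int m) *q (qcomm Q c x y m * x')" for m
  proof (induction m)
    case 0
    show ?case using comm by simp
  next
    case (Suc m)
    let ?z = "qcomm Q c x y m"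
    have z: "x' * ?z = Q powi (c + 2 * int m) *q (?z * x')" using Suc by simp
    have "x' * (x * ?z) = Q powi 2 *q (x * (x' * ?z))"
      by (metis comm(1) mult.assoc scl_mult_left)
    then have 1: "x' * (x * ?z) = Q powi (c + 2 * int (Suc m)) *q (x * ?z * x')"
      using Q0 unfolding z by (simp add: mult.assoc power_int_add algebra_simps)
    have "x' * (?z * x) = Q powi (c + 2 * int m) *q (?z * (x' * x))"
      by (metis z mult.assoc scl_mult_left)
    then have 2: "x' * (?z * x) = Q powi (c + 2 * int (Suc m)) *q (?z * x * x')"
      using Q0 unfolding comm by (simp add: mult.assoc power_int_add algebra_simps)
    have "x' * qcomm Q c x y (Suc m) = Q powi (c + 2 * int (Suc m)) *q (qcomm Q c x y (Suc m) * x')"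
      using 1 2 by (simp add: right_diff_distrib left_diff_distrib scl_simps mult.commute)
    moreover have "qcomm Q c (x + x') y (Suc m) = qcomm Q c x y (Suc m)"
      using Suc by (simp add: distrib_left distrib_right scl_simps)
    ultimately show ?case by simp
  qed
  then have A: "qcomm Q c (x + x') y n = qcomm Q c x y n" by blast
  \<comment> \<open>The exponent assumed for \<open>z\<close> is that of the factor which
    \<open>qcomm_Suc_first\<close> applies first: the terms with \<open>x\<close> cancel there, and
    the new argument satisfies the assumption with the exponent lowered by 2.\<close>
  have "qcomm Q c (x + x') z m = qcomm Q c x' z m"
    if "x * z = Q powi (c + 2 * (int m - 1)) *q (z * x)" for z m
    using that
  proof (induction m arbitrary: z)
    case (Suc m)
    let ?w = "c + 2 * int m"
    define z' where "z' = x' * z - Q powi ?w *q (z * x')"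
    have xz: "x * z = Q powi ?w *q (z * x)" using Suc(2) by simp
    have xx': "x * x' = Q powi (-2) *q (x' * x)"
      using Q0 unfolding comm by (simp add: power_int_minus)
    have "x * (x' * z) = Q powi (-2) *q (x' * (x * z))"
      by (metis xx' mult.assoc scl_mult_left)
    then have 1: "x * (x' * z) = Q powi (c + 2 * (int m - 1)) *q (x' * z * x)"
      using Q0 unfolding xz by (simp add: mult.assoc power_int_add power_int_diff power_int_minus field_simps)
    have "x * (z * x') = Q powi ?w *q (z * (x * x'))"
      by (metis xz mult.assoc scl_mult_left)
    then have 2: "x * (z * x') = Q powi (c + 2 * (int m - 1)) *q (z * x' * x)"
      using Q0 unfolding xx' by (simp add: mult.assoc power_int_add power_int_diff power_int_minus field_simps)
    have "x * z' = Q powi (c + 2 * (int m - 1)) *q (z' * x)"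
      unfolding z'_def using 1 2 by (simp add: right_diff_distrib left_diff_distrib scl_simps mult.commute)
    then have "qcomm Q c (x + x') z' m = qcomm Q c x' z' m" by (rule Suc)
    moreover have "(x + x') * z - Q powi ?w *q (z * (x + x')) = z'"
      using xz by (simp add: z'_def distrib_left distrib_right scl_simps)
    ultimately show ?case unfolding qcomm_Suc_first z'_def by simp
  qed simp
  \<comment> \<open>For c = 1 - n the top exponent c + 2 (n - 1) equals -c.\<close>
  moreover have "x * y' = Q powi (c + 2 * (int n - 1)) *q (y' * x)"
    using Q0 n unfolding comm by (simp flip: power_int_add)
  ultimately have B: "qcomm Q c (x + x') y' n = qcomm Q c x' y' n" by blast
  from A B serre show ?thesis
    unfolding qcomm_zero_iff[OF Q n, symmetric] by (simp add: qcomm_add)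
qed

text \<open>Collecting the factors \<open>u\<close> and \<open>v\<close> on the left costs every
  monomial the same scalar. An \<open>x\<close> left of \<open>y\<close> has to pass
  \<open>v\<close>, an \<open>x\<close> right of \<open>y\<close> brings a \<open>u\<close> that
  \<open>y\<close> has to pass; both cost \<open>b\<close>, which is why one \<open>b\<close> occurs
  in two hypotheses.\<close>

lemma qserre_twist:
  fixes x y u v :: "'r::qalg"
  assumes Q: "generic Q" and n: "c = 1 - int n"
    and uv: "u * v = v * u" and s: "a \<noteq> 0" "b \<noteq> 0"
    and comm: "x * u = a *q (u * x)" "x * v = b *q (v * x)" "y * u = b *q (u * y)"
    and serre: "qserre Q x y n = 0"
  shows "qserre Q (u * x) (v * y) n = 0"
proof -
  have xu: "x * (u * z) = a *q (u * (x * z))" for z by (metis comm(1) mult.assoc scl_mult_left)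
  have xv: "x * (v * z) = b *q (v * (x * z))" for z by (metis comm(2) mult.assoc scl_mult_left)
  have yu: "y * (u * z) = b *q (u * (y * z))" for z by (metis comm(3) mult.assoc scl_mult_left)
  have vu: "v * (u * z) = u * (v * z)" for z by (metis uv mult.assoc)
  have "\<exists>t. qcomm Q c (u * x) (v * y) m = t *q (u ^ m * v * qcomm Q c x y m) \<and>
     (\<forall>z. x * (u ^ m * (v * z)) = (a ^ m * b) *q (u ^ m * (v * (x * z)))) \<and>
     (\<forall>z. qcomm Q c x y m * (u * z) = (a ^ m * b) *q (u * (qcomm Q c x y m * z))) \<and>
     (\<forall>z. u ^ m * (v * (u * z)) = u * (u ^ m * (v * z)))" for m
  proof (induction m)
    case 0
    show ?case by (simp add: xv yu vu) (rule exI[of _ 1], simp)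
  next
    case (Suc m)
    then obtain t where t: "qcomm Q c (u * x) (v * y) m = t *q (u ^ m * v * qcomm Q c x y m)"
      and 1: "\<And>z. x * (u ^ m * (v * z)) = (a ^ m * b) *q (u ^ m * (v * (x * z)))"
      and 2: "\<And>z. qcomm Q c x y m * (u * z) = (a ^ m * b) *q (u * (qcomm Q c x y m * z))"
      and 3: "\<And>z. u ^ m * (v * (u * z)) = u * (u ^ m * (v * z))"
      by blast
    have "qcomm Q c (u * x) (v * y) (Suc m) = (t * a ^ m * b) *q (u ^ Suc m * v * qcomm Q c x y (Suc m))"
      by (simp add: t mult.assoc 1 2 3 right_diff_distrib scl_simps mult_ac)
    moreover have "x * (u ^ Suc m * (v * z)) = (a ^ Suc m * b) *q (u ^ Suc m * (v * (x * z)))" for z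
      by (simp add: mult.assoc xu 1)
    moreover have "qcomm Q c x y (Suc m) * (u * z) = (a ^ Suc m * b) *q (u * (qcomm Q c x y (Suc m) * z))" for z
      by (simp add: mult.assoc left_diff_distrib right_diff_distrib scl_simps xu 2 mult_ac)
    moreover have "u ^ Suc m * (v * (u * z)) = u * (u ^ Suc m * (v * z))" for z
      by (simp add: mult.assoc 3)
    ultimately show ?case by blast
  qed
  then obtain t where "qcomm Q c (u * x) (v * y) n = t *q (u ^ n * v * qcomm Q c x y n)" by blast
  with serre show ?thesis
    unfolding qcomm_zero_iff[OF Q n, symmetric] by simp
qed


section \<open>Realisations of the defining relations\<close>

lemma additive_int_simps:
  fixes F :: "'a::ab_group_add \<Rightarrow> int"
  assumes "additive F"
  shows "F (x + y) = F x + F y" "F 0 = 0" "F (- x) = - F x" "F (zmul n x) = n * F x"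
proof -
  interpret additive F by fact
  show "F (x + y) = F x + F y" "F 0 = 0" "F (- x) = - F x"
    by (simp_all add: add zero minus)
  show "F (zmul n x) = n * F x"
    by (simp add: zmul_def sum minus)
qed

locale root_datum =
  fixes D :: "('i, 'x::ab_group_add, 'y::ab_group_add) root_datum"
  assumes D: "is_root_datum D"
begin

abbreviation pair :: "'y \<Rightarrow> 'i \<Rightarrow> int" where "pair \<mu> j \<equiv> pairing D \<mu> (simple_root D j)"

lemma cartan_datum: "is_cartan_datum D"
  using D by (simp add: is_root_datum_def)

lemma pair_simps [simp]:
  "pair (\<mu> + \<nu>) j = pair \<mu> j + pair \<nu> j" "pair 0 j = 0" "pair (- \<mu>) j = - pair \<mu> j"
proof -
  have "additive (\<lambda>\<mu>. pair \<mu> j)"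
    using D by (simp add: is_root_datum_def perfect_pairing_def biadditive_def)
  note F = additive_int_simps[OF this]
  show "pair (\<mu> + \<nu>) j = pair \<mu> j + pair \<nu> j" "pair 0 j = 0" "pair (- \<mu>) j = - pair \<mu> j" by (fact F)+
qed

lemma d_of_pos: "0 < d_of D i"
  and dot_self: "dot D i i = 2 * d_of D i"
  using cartan_datum by (auto simp: is_cartan_datum_def d_of_def elim!: evenE dest: spec[of _ i])

lemma dot_commute: "dot D i j = dot D j i"
  using cartan_datum by (simp add: is_cartan_datum_def dot_def)

lemma cartan_self: "cartan D i i = 2"
  using dot_self[of i] d_of_pos[of i] by (simp add: cartan_def)

lemma cartan_le: "i \<noteq> j \<Longrightarrow> cartan D i j \<le> 0"
  using cartan_datum by (simp add: is_cartan_datum_def)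

lemma d_of_cartan: "d_of D i * cartan D i j = dot D i j"
proof (cases "i = j")
  case False
  then have "dot D i i dvd 2 * dot D i j"
    using cartan_datum by (simp add: is_cartan_datum_def)
  then have "dot D i i * cartan D i j = 2 * dot D i j" by (simp add: cartan_def)
  then show ?thesis by (simp add: dot_self)
qed (simp add: cartan_self dot_self)

lemma pair_kexp [simp]: "pair (kexp D i) j = dot D i j"
proof -
  have "additive (\<lambda>\<mu>. pair \<mu> j)"
    using D by (simp add: is_root_datum_def perfect_pairing_def biadditive_def)
  from additive_int_simps(4)[OF this] have "pair (kexp D i) j = d_of D i * pair (simple_coroot D i) j"
    by (simp add: kexp_def)
  also have "pair (simple_coroot D i) j = cartan D i j"
    using D by (simp add: is_root_datum_def)
  finally show ?thesis by (simp add: d_of_cartan)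
qed

lemma generic_q_of: "generic (q_of D i)"
  unfolding q_of_def using generic_powi[OF generic_qvar] d_of_pos[of i] by simp

lemma qvar_nonzero [simp]: "qvar \<noteq> 0"
  using generic_qvar by (rule generic_nonzero)

lemma q_of_nonzero [simp]: "q_of D i \<noteq> 0"
  using generic_q_of by (rule generic_nonzero)

lemma q_of_powi: "q_of D i powi m = qvar powi (d_of D i * m)"
  by (simp add: q_of_def power_int_mult)

lemma q_of_cartan: "q_of D i powi cartan D i j = qvar powi dot D i j"
  by (simp add: q_of_powi d_of_cartan)

lemma q_of_two: "q_of D i powi 2 = qvar powi dot D i i"
  using q_of_cartan[of i i] by (simp add: cartan_self)

lemma qfact_eq: "qfact D i n = qnf (q_of D i) n"
  by (simp add: qfact_def qnf_def qint_def qn_def)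

abbreviation serre_deg :: "'i \<Rightarrow> 'i \<Rightarrow> nat" where "serre_deg i j \<equiv> nat (1 - cartan D i j)"

lemma serre_deg: "i \<noteq> j \<Longrightarrow> cartan D i j = 1 - int (serre_deg i j)"
  using cartan_le[of i j] by simp

end

text \<open>The Serre relations are split off because the modules on words below do not satisfy them
  for \<open>e\<close>, and because \<open>f_serre_e\<close>, which deals with this, must itself be
  available without them.\<close>

locale pre_quantum = root_datum D
  for D :: "('i, 'x::ab_group_add, 'y::ab_group_add) root_datum" +
  fixes e f :: "'i \<Rightarrow> 'r::qalg" and k :: "'y \<Rightarrow> 'r"
  assumes k_zero [simp]: "k 0 = 1"
    and k_add: "k \<mu> * k \<nu> = k (\<mu> + \<nu>)"
    and k_e: "k \<mu> * e i = qvar powi pair \<mu> i *q (e i * k \<mu>)"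
    and k_f: "k \<mu> * f i = qvar powi (- pair \<mu> i) *q (f i * k \<mu>)"
    and e_f: "e i * f j - f j * e i =
      (if i = j then (1 / (q_of D i - inverse (q_of D i))) *q (k (kexp D i) - k (- kexp D i)) else 0)"
begin

lemma k_add': "k \<mu> * (k \<nu> * z) = k (\<mu> + \<nu>) * z"
  by (simp flip: k_add mult.assoc)

lemma k_e': "k \<mu> * (e i * z) = qvar powi pair \<mu> i *q (e i * (k \<mu> * z))"
  by (simp add: k_e flip: mult.assoc)

lemma k_f': "k \<mu> * (f i * z) = qvar powi (- pair \<mu> i) *q (f i * (k \<mu> * z))"
  by (simp add: k_f flip: mult.assoc)

lemmas k_simps = k_add k_add' k_e k_e' k_f k_f'

lemma k_qcomm:
  "k \<mu> * qcomm Q c (e i) (e j) m = qvar powi (pair \<mu> j + int m * pair \<mu> i) *q (qcomm Q c (e i) (e j) m * k \<mu>)"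
proof (induction m)
  case (Suc m)
  let ?x = "qcomm Q c (e i) (e j) m"
  have "k \<mu> * (e i * ?x) = qvar powi (pair \<mu> j + int (Suc m) * pair \<mu> i) *q (e i * ?x * k \<mu>)"
    by (simp add: k_e' Suc mult.assoc power_int_add algebra_simps)
  moreover have "k \<mu> * (?x * e i) = qvar powi (pair \<mu> j + int (Suc m) * pair \<mu> i) *q (?x * e i * k \<mu>)"
  proof -
    have "k \<mu> * (?x * e i) = (k \<mu> * ?x) * e i" by (simp add: mult.assoc)
    then show ?thesis by (simp add: k_e Suc mult.assoc power_int_add algebra_simps)
  qed
  ultimately show ?case
    by (simp add: right_diff_distrib left_diff_distrib scl_simps mult_ac)
qed (simp add: k_e)

text \<open>Lowering operators in the string of \<open>e\<^sub>j\<close> under \<open>q\<close>-commutation with \<open>e\<^sub>i\<close>. The scalar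
  vanishes at the end of the string, which is why \<open>f\<^sub>i\<close> commutes with the Serre expression.\<close>

lemma f_qcomm:
  assumes "i \<noteq> j"
  defines "c \<equiv> cartan D i j" and "Q \<equiv> q_of D i"
  defines "x \<equiv> qcomm Q c (e i) (e j)"
  shows "f i * x m = x m * f i - (qn Q (int m) * qn Q (c + int m - 1)) *q (x (m - 1) * k (- kexp D i))"
proof (induction m)
  case 0
  show ?case using e_f[of j i] assms(1) by (auto simp: x_def)
next
  case (Suc m)
  define K K' h where "K = k (kexp D i)" and "K' = k (- kexp D i)" and "h = Q - inverse Q"
  define w where "w = c + 2 * int m"
  have Q: "generic Q" unfolding Q_def by (rule generic_q_of)
  have h: "h \<noteq> 0" unfolding h_def using generic_denominator[OF Q] .
  have fe: "f i * e i = e i * f i - (1 / h) *q (K - K')"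
    using e_f[of i i] by (simp add: K_def K'_def h_def Q_def algebra_simps)
  have fe': "f i * (e i * z) = e i * (f i * z) - (1 / h) *q (K * z - K' * z)" for z
    using arg_cong[OF fe, of "\<lambda>t. t * z"] by (simp add: left_diff_distrib mult.assoc scl_simps)
  have Kx: "K * x m = Q powi w *q (x m * K)"
  proof -
    have "dot D i j + int m * dot D i i = d_of D i * w"
      by (simp add: w_def c_def distrib_left flip: d_of_cartan) (simp add: cartan_self)
    then show ?thesis by (simp add: K_def x_def k_qcomm Q_def q_of_powi)
  qed
  have K'x: "K' * x m = Q powi (- w) *q (x m * K')"
  proof -
    have "- dot D i j - int m * dot D i i = - (d_of D i * w)"
      by (simp add: w_def c_def distrib_left flip: d_of_cartan) (simp add: cartan_self)
    then show ?thesis by (simp add: K'_def x_def k_qcomm Q_def q_of_powi)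
  qed
  have K'e: "K' * e i = Q powi (- 2) *q (e i * K')"
    using q_of_two[of i] by (simp add: K'_def k_e Q_def power_int_minus)
  define A where "A = qn Q (int m) * qn Q (c + int m - 1)"
  have IH: "f i * x m = x m * f i - A *q (x (m - 1) * K')"
    using Suc by (simp add: A_def K'_def)
  have IH': "f i * (x m * z) = x m * (f i * z) - A *q (x (m - 1) * (K' * z))" for z
    using arg_cong[OF IH, of "\<lambda>t. t * z"] by (simp add: left_diff_distrib mult.assoc scl_simps)
  have xS: "x (Suc m) = e i * x m - Q powi w *q (x m * e i)"
    by (simp add: x_def w_def)
  \<comment> \<open>For \<open>m = 0\<close> the truncated index \<open>m - 1\<close> does no harm,
    since then \<open>A = 0\<close>.\<close>
  have tail: "A *q (e i * (x (m - 1) * K')) - (A * Q powi (w - 2)) *q (x (m - 1) * (e i * K'))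
      = A *q (x m * K')"
  proof (cases m)
    case 0
    then show ?thesis by (simp add: A_def)
  next
    case (Suc m')
    then have "x m = e i * x m' - Q powi (w - 2) *q (x m' * e i)"
      by (simp add: x_def w_def algebra_simps)
    then show ?thesis using Suc by (simp add: left_diff_distrib mult.assoc scl_simps)
  qed
  have "f i * x (Suc m) = x (Suc m) * f i
      - (1 / h) *q (K * x m - K' * x m) + (Q powi w / h) *q (x m * K - x m * K')
      - (A *q (e i * (x (m - 1) * K')) - (A * Q powi w) *q (x (m - 1) * (K' * e i)))"
    unfolding xS
    by (simp add: left_diff_distrib right_diff_distrib mult.assoc fe fe' IH IH' scl_simps)
  also have "(A * Q powi w) *q (x (m - 1) * (K' * e i)) = (A * Q powi (w - 2)) *q (x (m - 1) * (e i * K'))"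
    using generic_nonzero[OF Q] by (simp add: K'e power_int_diff power_int_minus field_simps)
  also note tail
  also have "(1 / h) *q (K * x m - K' * x m) = (Q powi w / h) *q (x m * K) - (Q powi (- w) / h) *q (x m * K')"
    by (simp add: Kx K'x scl_simps)
  also have "x (Suc m) * f i - ((Q powi w / h) *q (x m * K) - (Q powi (- w) / h) *q (x m * K'))
      + (Q powi w / h) *q (x m * K - x m * K') - A *q (x m * K')
      = x (Suc m) * f i - (A + qn Q w) *q (x m * K')"
    by (simp add: qn_def h_def[symmetric] diff_divide_distrib scl_simps)
  also have "A + qn Q w = qn Q (int (Suc m)) * qn Q (c + int (Suc m) - 1)"
    unfolding A_def w_def qn_step[OF Q] by simp
  finally show ?case by (simp add: K'_def)
qed

text \<open>Used on the lowest weight modules: it makes the submodule generated by Serre elements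
  stable under the f's, and its mirror image \<open>e_serre_f\<close> yields the Serre relations for
  the f's.\<close>

lemma f_serre_e:
  assumes ij: "i \<noteq> j"
  shows "f l * qserre (q_of D i) (e i) (e j) (serre_deg i j) = qserre (q_of D i) (e i) (e j) (serre_deg i j) * f l"
proof -
  define c Q n where "c = cartan D i j" and "Q = q_of D i" and "n = serre_deg i j"
  have Q: "generic Q" unfolding Q_def by (rule generic_q_of)
  have c: "c = 1 - int n" unfolding c_def n_def using serre_deg[OF ij] .
  define x where "x = qcomm Q c (e i) (e j)"
  have n0: "n = Suc (n - 1)" using cartan_le[OF ij] by (simp add: n_def)
  have "f l * x n = x n * f l"
  proof (cases "l = i")
    case True
    have "c + int n - 1 = 0" using c by simp
    then show ?thesis
      using f_qcomm[OF ij, of n] True by (simp add: x_def c_def Q_def)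
  next
    case li: False
    then have comm: "f l * e i = e i * f l" using e_f[of i l] by simp
    have "f l * x n - x n * f l = qcomm Q c (e i) (f l * e j - e j * f l) n"
      unfolding x_def by (simp add: qcomm_mult_commute[OF comm] qcomm_diff)
    also have "\<dots> = 0"
    proof (cases "l = j")
      case False
      then show ?thesis using e_f[of j l] by (simp add: qcomm_zero_right)
    next
      case True
      \<comment> \<open>The commutator of f_j and e_j is a combination of \<open>K\<close> and
        \<open>K'\<close>, and the two extreme factors of the q-commutator kill them: exponent -c,
        the largest, kills \<open>K\<close>, and exponent c, the smallest, kills
        \<open>K'\<close>.\<close>
      define K K' where "K = k (kexp D j)" and "K' = k (- kexp D j)"
      have c': "Q powi c = qvar powi dot D j i"
        unfolding Q_def c_def q_of_cartan by (simp add: dot_commute)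
      have "K * e i = Q powi c *q (e i * K)" by (simp add: K_def k_e c')
      then have "e i * K = Q powi (- c) *q (K * e i)" using generic_nonzero[OF Q] by (simp add: power_int_minus)
      moreover have "c + 2 * int (n - 1) = - c" using c n0 by simp
      ultimately have "e i * K - Q powi (c + 2 * int (n - 1)) *q (K * e i) = 0" by (simp only: diff_self)
      then have 1: "qcomm Q c (e i) K n = 0"
        by (subst n0, subst qcomm_Suc_first) (simp only: qcomm_zero_right)
      have "K' * e i = Q powi (- c) *q (e i * K')" by (simp add: K'_def k_e c' power_int_minus)
      then have e: "e i * K' = Q powi c *q (K' * e i)" using generic_nonzero[OF Q] by (simp add: power_int_minus)
      have "qcomm Q c (e i) K' (Suc m) = 0" for m
        by (induction m) (use e in simp_all)
      then have 2: "qcomm Q c (e i) K' n = 0" using n0 by metis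
      have fe: "f l * e j - e j * f l = (- (1 / (q_of D j - inverse (q_of D j)))) *q (K - K')"
        using e_f[of j j] True by (simp add: K_def K'_def algebra_simps)
      have "qcomm Q c (e i) (f l * e j - e j * f l) n
          = (- (1 / (q_of D j - inverse (q_of D j)))) *q (qcomm Q c (e i) K n - qcomm Q c (e i) K' n)"
        by (simp only: fe qcomm_scl qcomm_diff)
      with 1 2 show ?thesis by simp
    qed
    finally show ?thesis by simp
  qed
  then have "(qnf Q n * (-1) ^ n) *q (f l * qserre Q (e i) (e j) n) = (qnf Q n * (-1) ^ n) *q (qserre Q (e i) (e j) n * f l)"
    unfolding x_def qcomm_eq_qserre[OF Q c] by simp
  then show ?thesis
    using qnf_nonzero[OF Q, of n] by (simp add: Q_def n_def)
qed

text \<open>The Chevalley involution; it transfers statements about e to statements about f.\<close>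

lemma swap: "pre_quantum D f e (\<lambda>\<mu>. k (- \<mu>))"
proof
  show "f i * e j - e j * f i = (if i = j then (1 / (q_of D i - inverse (q_of D i))) *q (k (- kexp D i) - k (- (- kexp D i))) else 0)" for i j
    using e_f[of j i] by (auto simp: algebra_simps)
qed (simp_all add: k_simps add.commute)

lemma e_serre_f:
  assumes "i \<noteq> j"
  shows "e l * qserre (q_of D i) (f i) (f j) (serre_deg i j) = qserre (q_of D i) (f i) (f j) (serre_deg i j) * e l"
  using pre_quantum.f_serre_e[OF swap assms] .

end

locale quantum = pre_quantum D e f k
  for D :: "('i, 'x::ab_group_add, 'y::ab_group_add) root_datum"
    and e f :: "'i \<Rightarrow> 'r::qalg" and k +
  assumes serre_e: "i \<noteq> j \<Longrightarrow> qserre (q_of D i) (e i) (e j) (nat (1 - cartan D i j)) = 0"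
    and serre_f: "i \<noteq> j \<Longrightarrow> qserre (q_of D i) (f i) (f j) (nat (1 - cartan D i j)) = 0"

section \<open>Defining relations under homomorphisms from the free algebra\<close>

context root_datum
begin

lemma alg_hom_serre:
  fixes \<phi> :: "('i, 'y) free \<Rightarrow> 'r::qalg"
  assumes "alg_hom \<phi>"
  shows "\<phi> (serre D x i j) = qserre (q_of D i) (\<phi> (x i)) (\<phi> (x j)) (serre_deg i j)"
proof -
  have m1: "(- 1) ^ l = (- 1) ^ l *q (1 :: 'r)" for l
    by (induction l) simp_all
  show ?thesis
    by (simp add: serre_def Let_def qserre_def alg_hom_sum[OF assms] alg_hom_mult[OF assms] m1
        alg_hom_uminus[OF assms] alg_hom_one[OF assms]
        fdiv_def mult.commute[of "qnf _ _" "qnf _ _"]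
        alg_hom_const[OF assms] alg_hom_power[OF assms] qfact_eq atLeast0AtMost)
qed

text \<open>The Serre expressions are left unevaluated so that the lemma covers both images where
  they vanish and the lowest weight modules, where they only map into
  \<open>serre_module\<close>.\<close>

lemma alg_hom_relation_cases:
  fixes \<phi> :: "('i, 'y) free \<Rightarrow> 'r::qalg"
  assumes "alg_hom \<phi>" "pre_quantum D (\<lambda>i. \<phi> (fE i)) (\<lambda>i. \<phi> (fF i)) (\<lambda>\<mu>. \<phi> (fK \<mu>))"
    and "r \<in> relations D"
  shows "\<phi> r = 0 \<or>
    (\<exists>i j. i \<noteq> j \<and> \<phi> r = qserre (q_of D i) (\<phi> (fE i)) (\<phi> (fE j)) (serre_deg i j)) \<or>
    (\<exists>i j. i \<noteq> j \<and> \<phi> r = qserre (q_of D i) (\<phi> (fF i)) (\<phi> (fF j)) (serre_deg i j))"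
    (is "?P r")
proof -
  note \<phi> = alg_hom_simps[OF assms(1)] alg_hom_serre[OF assms(1)]
  interpret pre_quantum D "\<lambda>i. \<phi> (fE i)" "\<lambda>i. \<phi> (fF i)" "\<lambda>\<mu>. \<phi> (fK \<mu>)" by fact
  have ef: "\<phi> (fE i * fF j - fF j * fE i -
         (if i = j then fconst (1 / (q_of D i - inverse (q_of D i))) * (fK (kexp D i) - fK (- kexp D i))
          else 0)) = 0" for i j
    using e_f[of i j] by (simp add: \<phi>)
  have "relations D \<subseteq> {r. ?P r}"
    unfolding relations_def Un_subset_iff
  proof (intro conjI)
    show "{fE i * fF j - fF j * fE i -
         (if i = j then fconst (1 / (q_of D i - inverse (q_of D i))) * (fK (kexp D i) - fK (- kexp D i))
          else 0) | i j. True} \<subseteq> {r. ?P r}"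
      using ef by blast
    show "{serre D fE i j | i j. i \<noteq> j} \<subseteq> {r. ?P r}" "{serre D fF i j | i j. i \<noteq> j} \<subseteq> {r. ?P r}"
      using alg_hom_serre[OF assms(1)] by blast+
  qed (auto simp: \<phi> k_add k_e k_f mult.assoc)
  with assms(3) show ?thesis by blast
qed

lemma alg_hom_relations_iff:
  fixes \<phi> :: "('i, 'y) free \<Rightarrow> 'r::qalg"
  assumes "alg_hom \<phi>"
  shows "quantum D (\<lambda>i. \<phi> (fE i)) (\<lambda>i. \<phi> (fF i)) (\<lambda>\<mu>. \<phi> (fK \<mu>)) \<longleftrightarrow> (\<forall>r\<in>relations D. \<phi> r = 0)"
proof
  assume "quantum D (\<lambda>i. \<phi> (fE i)) (\<lambda>i. \<phi> (fF i)) (\<lambda>\<mu>. \<phi> (fK \<mu>))"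
  then interpret quantum D "\<lambda>i. \<phi> (fE i)" "\<lambda>i. \<phi> (fF i)" "\<lambda>\<mu>. \<phi> (fK \<mu>)" .
  show "\<forall>r\<in>relations D. \<phi> r = 0"
    using alg_hom_relation_cases[OF assms pre_quantum_axioms] serre_e serre_f by metis
next
  note \<phi> = alg_hom_simps[OF assms] alg_hom_serre[OF assms]
  assume "\<forall>r\<in>relations D. \<phi> r = 0"
  then have rel: "\<phi> r = 0" if "r \<in> relations D" for r using that by blast
  have 1: "fK 0 - 1 \<in> relations D"
    and 2: "fK \<mu> * fK \<nu> - fK (\<mu> + \<nu>) \<in> relations D"
    and 3: "fK \<mu> * fE i - fconst (qvar powi pair \<mu> i) * fE i * fK \<mu> \<in> relations D"
    and 4: "fK \<mu> * fF i - fconst (qvar powi (- pair \<mu> i)) * fF i * fK \<mu> \<in> relations D"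
    and 5: "fE i * fF j - fF j * fE i -
         (if i = j then fconst (1 / (q_of D i - inverse (q_of D i))) * (fK (kexp D i) - fK (- kexp D i))
          else 0) \<in> relations D" for \<mu> \<nu> i j
    unfolding relations_def by blast+
  have 6: "serre D fE i j \<in> relations D" and 7: "serre D fF i j \<in> relations D" if "i \<noteq> j" for i j
    unfolding relations_def using that by blast+
  show "quantum D (\<lambda>i. \<phi> (fE i)) (\<lambda>i. \<phi> (fF i)) (\<lambda>\<mu>. \<phi> (fK \<mu>))"
  proof
    fix i j
    show "\<phi> (fE i) * \<phi> (fF j) - \<phi> (fF j) * \<phi> (fE i) = (if i = j
        then (1 / (q_of D i - inverse (q_of D i))) *q (\<phi> (fK (kexp D i)) - \<phi> (fK (- kexp D i))) else 0)"
      using rel[OF 5, of i j] by (cases "i = j") (simp_all add: \<phi>)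
  qed (use rel[OF 1] rel[OF 2] rel[OF 3] rel[OF 4] rel[OF 6] rel[OF 7] in \<open>simp_all add: \<phi> mult.assoc\<close>)
qed

end


section \<open>The adjoint action on a model of the quantum group\<close>

lemma Lmul_mult: "Lmul (a * b) = Lmul a * Lmul b"
  and Rmul_mult: "Rmul (a * b) = Rmul b * Rmul a"
  and Lmul_Rmul: "Lmul a * Rmul b = Rmul b * Lmul a"
  and Lmul_one: "Lmul 1 = 1" and Rmul_one: "Rmul 1 = 1"
  by (rule endo_eqI; simp add: mult.assoc)+

lemma Lmul_zero [simp]: "Lmul 0 = 0" and Rmul_zero [simp]: "Rmul 0 = 0"
  by (rule endo_eqI; simp)+

lemma Lmul_power: "Lmul (a ^ n) = Lmul a ^ n"
  and Rmul_power: "Rmul (a ^ n) = Rmul a ^ n"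
  by (induction n) (simp_all add: Lmul_mult Rmul_mult Lmul_one Rmul_one power_commutes)

lemma qserre_Lmul: "qserre Q (Lmul x) (Lmul y) n = Lmul (qserre Q x y n)"
  by (rule endo_eqI)
    (simp add: qserre_def app_sum_left sum_distrib_right mult.assoc flip: Lmul_power)

text \<open>Right multiplication reverses products, and a reversed Serre expression differs from the
  original by the sign in \<open>qserre_reverse\<close>.\<close>

lemma qserre_Rmul: "qserre Q (Rmul x) (Rmul y) n = (-1) ^ n *q Rmul (qserre Q x y n)"
  by (rule endo_eqI)
    (simp add: qserre_def[of _ "Rmul _"] app_sum_left mult.assoc flip: Rmul_power scl_mult_right qserre_reverse,
     simp add: sum_distrib_left mult.assoc)

context root_datum
begin

lemma pair_diff [simp]: "pair (\<mu> - \<nu>) j = pair \<mu> j - pair \<nu> j"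
  using pair_simps(1)[of \<mu> "- \<nu>"] by simp

lemma qvar_mult: "qvar powi a * qvar powi b = qvar powi (a + b)"
  by (simp add: power_int_add)

lemma qvar_mult': "qvar powi a * (qvar powi b * z) = qvar powi (a + b) * z"
  by (simp add: power_int_add)

end

context pre_quantum
begin

definition adE :: "'i \<Rightarrow> 'r endo" where
  "adE i = Lmul (e i) - Lmul (k (kexp D i)) * Rmul (k (- kexp D i) * e i)"

definition adF :: "'i \<Rightarrow> 'r endo" where
  "adF i = Lmul (f i) * Rmul (k (kexp D i)) - Rmul (f i * k (kexp D i))"

definition adK :: "'y \<Rightarrow> 'r endo" where
  "adK \<mu> = Lmul (k \<mu>) * Rmul (k (- \<mu>))"

lemma adE_app: "adE i \<bullet> y = e i * y - k (kexp D i) * y * k (- kexp D i) * e i"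
  and adF_app: "adF i \<bullet> y = (f i * y - y * f i) * k (kexp D i)"
  and adK_app: "adK \<mu> \<bullet> y = k \<mu> * y * k (- \<mu>)"
  by (simp_all add: adE_def adF_def adK_def mult.assoc left_diff_distrib)

lemma e_f_assoc: "e i * (f j * z) = f j * (e i * z) +
    (if i = j then (1 / (q_of D i - inverse (q_of D i))) *q (k (kexp D i) * z - k (- kexp D i) * z) else 0)"
  using arg_cong[OF e_f[of i j], of "\<lambda>t. t * z"]
  by (simp add: left_diff_distrib mult.assoc algebra_simps split: if_splits)

lemma pre_quantum_ad: "pre_quantum D adE adF adK"
proof
  note simps = mult.assoc left_diff_distrib right_diff_distrib distrib_left distrib_right
    k_simps e_f_assoc scl_simps qvar_mult qvar_mult' dot_commute
  show "adK 0 = 1"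
    by (rule endo_eqI) (simp add: adK_app)
  show "adK \<mu> * adK \<nu> = adK (\<mu> + \<nu>)" for \<mu> \<nu>
    by (rule endo_eqI) (simp add: adK_app simps add.commute)
  show "adK \<mu> * adE i = qvar powi pair \<mu> i *q (adE i * adK \<mu>)" for \<mu> i
    by (rule endo_eqI) (simp add: adK_app adE_app simps add.commute)
  show "adK \<mu> * adF i = qvar powi (- pair \<mu> i) *q (adF i * adK \<mu>)" for \<mu> i
    by (rule endo_eqI) (simp add: adK_app adF_app simps add.commute)
  show "adE i * adF j - adF j * adE i =
      (if i = j then (1 / (q_of D i - inverse (q_of D i))) *q (adK (kexp D i) - adK (- kexp D i)) else 0)" for i j
    by (rule endo_eqI) (cases "i = j"; simp add: adK_app adE_app adF_app simps algebra_simps)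
qed

end

context quantum
begin

text \<open>For the Serre relations both operators are split into a part built on
  \<open>Lmul\<close> and one built on \<open>Rmul\<close>. Each part satisfies them, directly or by
  \<open>qserre_twist\<close>, and the parts q-commute as \<open>qserre_sum\<close> asks.\<close>

lemma quantum_ad: "quantum D adE adF adK"
proof -
  interpret ad: pre_quantum D adE adF adK by (rule pre_quantum_ad)
  have "qserre (q_of D i) (adE i) (adE j) (serre_deg i j) = 0
      \<and> qserre (q_of D i) (adF i) (adF j) (serre_deg i j) = 0" if ij: "i \<noteq> j" for i j
  proof
    define Q c n where "Q = q_of D i" and "c = cartan D i j" and "n = serre_deg i j"
    have Q: "generic Q" unfolding Q_def by (rule generic_q_of)
    have c: "c = 1 - int n" unfolding c_def n_def using serre_deg[OF ij] .
    have Qc: "Q powi c = qvar powi dot D i j" and Q2: "Q powi 2 = qvar powi dot D i i"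
      unfolding Q_def c_def by (rule q_of_cartan q_of_two)+
    note simps = mult.assoc left_diff_distrib right_diff_distrib k_simps scl_simps
      qvar_mult qvar_mult' dot_commute
    have Re: "qserre Q (Rmul (e i)) (Rmul (e j)) n = 0" and Le: "qserre Q (Lmul (e i)) (Lmul (e j)) n = 0"
      using serre_e[OF ij] by (simp_all add: qserre_Rmul qserre_Lmul Q_def n_def)
    have Rf: "qserre Q (Rmul (f i)) (Rmul (f j)) n = 0" and Lf: "qserre Q (Lmul (f i)) (Lmul (f j)) n = 0"
      using serre_f[OF ij] by (simp_all add: qserre_Rmul qserre_Lmul Q_def n_def)
    \<comment> \<open>In \<open>u a * Rmul (e a)\<close> the factor e_a is multiplied on before the
      conjugation by k_a; the power of q undoes its passage through k_a^-1.\<close>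
    define u where "u a = (- (qvar powi (- dot D a a))) *q adK (kexp D a)" for a
    have adE: "adE a = Lmul (e a) + u a * Rmul (e a)" for a
      by (rule endo_eqI) (simp add: adE_app u_def adK_app simps)
    have "qserre Q (u i * Rmul (e i)) (u j * Rmul (e j)) n = 0"
    proof (rule qserre_twist[OF Q c _ _ _ _ _ _ Re])
      show "u i * u j = u j * u i" by (simp add: u_def ad.k_add add.commute mult.commute)
      have "Rmul (e a) * u b = qvar powi (- dot D a b) *q (u b * Rmul (e a))" for a b
        by (rule endo_eqI) (simp add: u_def adK_app simps,
              intro disjI1 arg_cong[where f = "(powi) qvar"], simp)
      then show "Rmul (e i) * u i = qvar powi (- dot D i i) *q (u i * Rmul (e i))"
        "Rmul (e i) * u j = qvar powi (- dot D i j) *q (u j * Rmul (e i))"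
        "Rmul (e j) * u i = qvar powi (- dot D i j) *q (u i * Rmul (e j))"
        by (simp_all add: dot_commute)
    qed simp_all
    moreover have "(u a * Rmul (e a)) * Lmul (e b) = qvar powi dot D a b *q (Lmul (e b) * (u a * Rmul (e a)))" for a b
      by (rule endo_eqI) (simp add: u_def adK_app simps)
    ultimately show "qserre (q_of D i) (adE i) (adE j) (serre_deg i j) = 0"
      unfolding adE Q_def[symmetric] n_def[symmetric]
      by (intro qserre_sum[OF Q c _ _ _ Le]) (simp_all add: Qc Q2[simplified] dot_commute)
    define v where "v a = Rmul (k (kexp D a))" for a
    have adF: "adF a = (- v a) * Rmul (f a) + v a * Lmul (f a)" for a
      by (rule endo_eqI) (simp add: adF_app v_def simps)
    have vv: "v i * v j = v j * v i"
      by (rule endo_eqI) (simp add: v_def simps add.commute)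
    have "qserre Q ((- v i) * Rmul (f i)) ((- v j) * Rmul (f j)) n = 0"
    proof (rule qserre_twist[OF Q c _ _ _ _ _ _ Rf])
      show "(- v i) * (- v j) = (- v j) * (- v i)" using vv by simp
      have "Rmul (f a) * (- v b) = qvar powi (- dot D a b) *q ((- v b) * Rmul (f a))" for a b
        by (rule endo_eqI) (simp add: v_def simps)
      then show "Rmul (f i) * (- v i) = qvar powi (- dot D i i) *q ((- v i) * Rmul (f i))"
        "Rmul (f i) * (- v j) = qvar powi (- dot D i j) *q ((- v j) * Rmul (f i))"
        "Rmul (f j) * (- v i) = qvar powi (- dot D i j) *q ((- v i) * Rmul (f j))"
        by (simp_all add: dot_commute)
    qed simp_all
    moreover have "qserre Q (v i * Lmul (f i)) (v j * Lmul (f j)) n = 0"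
      \<comment> \<open>Left and right multiplications commute, so both twisting scalars are
        1.\<close>
      by (rule qserre_twist[OF Q c vv _ _ _ _ _ Lf, of 1 1]) (simp_all add: v_def Lmul_Rmul)
    moreover have "(v a * Lmul (f a)) * ((- v b) * Rmul (f b)) =
        qvar powi dot D a b *q (((- v b) * Rmul (f b)) * (v a * Lmul (f a)))" for a b
      by (rule endo_eqI) (simp add: v_def simps add.commute)
    ultimately show "qserre (q_of D i) (adF i) (adF j) (serre_deg i j) = 0"
      unfolding adF Q_def[symmetric] n_def[symmetric]
      by (intro qserre_sum[OF Q c]) (simp_all add: Qc Q2[simplified] dot_commute del: mult_minus_left)
  qed
  then show ?thesis by unfold_locales blast+
qed

end


subsection \<open>The ideal of relations and its models\<close>

lemma ring_type_ring: "ring (type_ring :: 'a::ring_1 ring)"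
proof (rule ringI)
  show "abelian_group (type_ring :: 'a ring)"
    by (rule abelian_groupI) (auto simp: type_ring_def ac_simps intro: exI[of _ "- _"] left_minus)
  show "monoid (type_ring :: 'a ring)"
    by (rule monoidI) (auto simp: type_ring_def mult.assoc)
qed (auto simp: type_ring_def algebra_simps)

lemma type_ring_simps [simp]:
  "carrier type_ring = UNIV" "x \<otimes>\<^bsub>type_ring\<^esub> y = x * y" "\<one>\<^bsub>type_ring\<^esub> = 1" "\<zero>\<^bsub>type_ring\<^esub> = 0"
  "x \<oplus>\<^bsub>type_ring\<^esub> y = x + y"
  by (simp_all add: type_ring_def)

lemma type_ring_a_inv [simp]: "\<ominus>\<^bsub>type_ring\<^esub> x = - (x :: 'a::ring_1)"
proof -
  interpret ring "type_ring :: 'a ring" by (rule ring_type_ring)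
  show ?thesis by (rule minus_equality) simp_all
qed

lemma ideal_rel_ideal: "ideal (rel_ideal D) type_ring"
  unfolding rel_ideal_def by (rule ring.genideal_ideal[OF ring_type_ring]) simp

lemma
  shows rel_ideal_zero: "0 \<in> rel_ideal D"
    and rel_ideal_add: "s \<in> rel_ideal D \<Longrightarrow> t \<in> rel_ideal D \<Longrightarrow> s + t \<in> rel_ideal D"
    and rel_ideal_mult: "s \<in> rel_ideal D \<Longrightarrow> x * s \<in> rel_ideal D" "s \<in> rel_ideal D \<Longrightarrow> s * x \<in> rel_ideal D"
proof -
  interpret ideal "rel_ideal D" type_ring by (rule ideal_rel_ideal)
  show "0 \<in> rel_ideal D" using additive_subgroup.zero_closed[OF is_additive_subgroup] by simp
  show "s \<in> rel_ideal D \<Longrightarrow> t \<in> rel_ideal D \<Longrightarrow> s + t \<in> rel_ideal D" using additive_subgroup.a_closed[OF is_additive_subgroup, of s t] by simp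
  show "s \<in> rel_ideal D \<Longrightarrow> x * s \<in> rel_ideal D" "s \<in> rel_ideal D \<Longrightarrow> s * x \<in> rel_ideal D"
    using I_l_closed[of s x] I_r_closed[of s x] by simp_all
qed

lemma relations_subset: "relations D \<subseteq> rel_ideal D"
  unfolding rel_ideal_def by (rule ring.genideal_self[OF ring_type_ring]) simp

lemma rel_ideal_minimal:
  fixes D :: "('i, 'x, 'y::ab_group_add) root_datum"
  assumes "relations D \<subseteq> I" "0 \<in> I" "\<And>s t. s \<in> I \<Longrightarrow> t \<in> I \<Longrightarrow> s + t \<in> I"
    "\<And>s x. s \<in> I \<Longrightarrow> x * s \<in> I" "\<And>s x. s \<in> I \<Longrightarrow> s * x \<in> I"
  shows "rel_ideal D \<subseteq> I"
proof -
  interpret R: ring "type_ring :: ('i, 'y) free ring" by (rule ring_type_ring)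
  have "ideal I type_ring"
  proof (rule idealI[OF ring_type_ring])
    have "- s \<in> I" if "s \<in> I" for s using assms(4)[OF that, of "-1"] by simp
    with assms show "subgroup I (add_monoid type_ring)"
      by (intro R.add.subgroupI) (auto simp flip: a_inv_def)
  qed (use assms in auto)
  then show ?thesis
    unfolding rel_ideal_def using assms(1) by (rule R.genideal_minimal)
qed

lemma alg_hom_kills:
  assumes "alg_hom \<phi>" "\<forall>r\<in>relations D. \<phi> r = 0" "t \<in> rel_ideal D"
  shows "\<phi> t = 0"
proof -
  have "rel_ideal D \<subseteq> {t. \<phi> t = 0}"
    by (rule rel_ideal_minimal) (use assms in \<open>auto simp: alg_hom_simps\<close>)
  with assms(3) show ?thesis by blast
qed

locale model = root_datum D
  for D :: "('i, 'x::ab_group_add, 'y::ab_group_add) root_datum" +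
  fixes \<Phi> :: "('i, 'y) free \<Rightarrow> 'r::qalg"
  assumes hom: "alg_hom \<Phi>"
    and kernel: "\<Phi> t = 0 \<longleftrightarrow> t \<in> rel_ideal D"
begin

lemma quantum: "quantum D (\<lambda>i. \<Phi> (fE i)) (\<lambda>i. \<Phi> (fF i)) (\<lambda>\<mu>. \<Phi> (fK \<mu>))"
  unfolding alg_hom_relations_iff[OF hom] using relations_subset kernel by blast

sublocale quantum D "\<lambda>i. \<Phi> (fE i)" "\<lambda>i. \<Phi> (fF i)" "\<lambda>\<mu>. \<Phi> (fK \<mu>)"
  by (rule quantum)

abbreviation "e i \<equiv> \<Phi> (fE i)"
abbreviation "f i \<equiv> \<Phi> (fF i)"
abbreviation "k \<mu> \<equiv> \<Phi> (fK \<mu>)"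

fun ad_gen :: "('i, 'y) gen \<Rightarrow> 'r endo" where
  "ad_gen (GenE i) = adE i" | "ad_gen (GenF i) = adF i" | "ad_gen (GenK \<mu>) = adK \<mu>"

abbreviation "adh \<equiv> ev ad_gen"

lemma adh_gen [simp]: "adh (fE i) = adE i" "adh (fF i) = adF i" "adh (fK \<mu>) = adK \<mu>"
  by (simp_all add: fE_def fF_def fK_def ev_word)

text \<open>The payoff of \<open>quantum_ad\<close>: the action of a coset does not depend on its
  representative.\<close>

lemma adh_kills: "t \<in> rel_ideal D \<Longrightarrow> adh t = 0"
  using alg_hom_kills[OF ev_alg_hom] alg_hom_relations_iff[OF ev_alg_hom, of ad_gen] quantum_ad
  by simp

end

section \<open>Comultiplication and antipode as two-sided multiplication\<close>

lemma lext_lin_ext: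
  fixes A :: "'n::monoid_add \<Rightarrow> 'r::qalg" and p :: "'m \<Rightarrow>\<^sub>0 qfield"
  assumes "\<And>u v. A (u + v) = A u * A v" "A 0 = 1"
  shows "lext A (lin_ext g p) = lext (\<lambda>w. lext A (g w)) p"
proof -
  have "lext A (fconst c * x) = c *q lext A x" for c x
    by (simp add: lext_mult[of A, OF assms(1)] fconst_def assms(2))
  moreover have "lext A (sum F S) = (\<Sum>w\<in>S. lext A (F w))" for F :: "'m \<Rightarrow> _" and S
    by (induction S rule: infinite_finite_induct) (simp_all add: lext_add)
  ultimately show ?thesis
    by (simp add: lin_ext_def lext_def[of "\<lambda>w. lext A (g w)"])
qed

lemma lin_ext_word: "lin_ext g (word w) = g w"
  by (simp add: lin_ext_def word_def fconst_def)

lemma lext_word: "lext A (word w) = A w"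
  by (simp add: word_def)

lemma word_append: "word (u @ v) = word u * word v"
  by (simp add: word_def mult_single plus_list_def)

context model
begin

lemma \<Phi>_lin_ext: "\<Phi> (lin_ext g p) = lext (\<lambda>w. \<Phi> (g w)) p"
  by (simp add: lin_ext_def lext_def alg_hom_simps[OF hom])

definition two_sided :: "('i, 'y) gen list \<times> ('i, 'y) gen list \<Rightarrow> 'r endo" where
  "two_sided = (\<lambda>(u, v). Lmul (\<Phi> (word u)) * Rmul (\<Phi> (antipode D (word v))))"

lemma antipode_word: "antipode D (word v) = prod_list (map (antipode_gen D) (rev v))"
  by (simp add: antipode_def lin_ext_word)

text \<open>The antipode and right multiplication both reverse products, and the reversals cancel.
  The tensor square thus acts through a homomorphism, so \<open>free_ad\<close> has to be identified
  on generators only.\<close>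

lemma two_sided_hom: "two_sided (w + w') = two_sided w * two_sided w'" "two_sided 0 = 1"
proof -
  show "two_sided (w + w') = two_sided w * two_sided w'"
    by (rule endo_eqI)
      (simp add: two_sided_def split_beta antipode_word word_append plus_list_def
        alg_hom_simps[OF hom] mult.assoc)
  show "two_sided 0 = 1"
    by (rule endo_eqI)
      (simp add: two_sided_def split_beta antipode_word zero_prod_def zero_list_def word_Nil
        alg_hom_simps[OF hom])
qed

lemma two_sided_comult_gen: "lext two_sided (comult_gen D g) = ad_gen g"
proof (rule endo_eqI)
  note simps = lext_add lext_word two_sided_def antipode_word word_Nil alg_hom_simps[OF hom] mult.assoc
  show "lext two_sided (comult_gen D g) \<bullet> y = ad_gen g \<bullet> y" for y
    by (cases g) (simp_all add: simps adE_app adF_app adK_app left_diff_distrib flip: fE_def fF_def fK_def)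
qed

lemma \<Phi>_free_ad: "\<Phi> (free_ad D t s) = adh t \<bullet> \<Phi> s"
proof -
  have prod: "lext two_sided (prod_list gs) = prod_list (map (lext two_sided) gs)" for gs
  proof (induction gs)
    case Nil
    have "lext two_sided (1 :: ('i, 'y) free2) = 1"
      using lext_single[of two_sided 0 1] two_sided_hom(2) by simp
    then show ?case by simp
  qed (simp add: lext_mult two_sided_hom)
  have "lext two_sided (comult D t) = adh t"
    unfolding comult_def ev_def
    by (simp add: lext_lin_ext two_sided_hom prod comp_def two_sided_comult_gen)
  moreover have "\<Phi> (free_ad D t s) = lext two_sided (comult D t) \<bullet> \<Phi> s"
    unfolding free_ad_def \<Phi>_lin_ext
    by (simp add: lext_def app_sum_left two_sided_def split_beta alg_hom_simps[OF hom] mult.assoc)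
  ultimately show ?thesis by simp
qed

end


section \<open>Existence of a faithful model\<close>

lemma coef_scl: "coef (a *q x) = fconst a * coef x"
  for x :: "'g list vec"
  by (simp add: scl_vec_def Vec_inverse fconst_def mult_map_scale_conv_mult)

lemma coef_add: "coef (x + y) = coef x + coef y"
  by (simp add: plus_vec.rep_eq)

lemma fconst_commute: "fconst a * p = p * fconst a"
  for p :: "'g list \<Rightarrow>\<^sub>0 qfield"
  by (induction p rule: poly_mapping_additive_induct)
    (simp_all add: fconst_def mult_single distrib_left distrib_right mult.commute)

text \<open>The quotient by the ideal is a direct summand of the free algebra as a vector space. Acting on
  the complementary summand, the ideal itself, through the counit turns the regular representation
  into a faithful one on the whole type.\<close>

lemma (in root_datum) model_exists:
  "\<exists>\<Phi> :: ('i, 'y) free \<Rightarrow> ('i, 'y) gen list vec endo. model D \<Phi>"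
proof -
  let ?J = "rel_ideal D"
  define J where "J = {x :: ('i, 'y) gen list vec. coef x \<in> ?J}"
  have sub: "qmod.subspace J"
    unfolding J_def
    by (rule qmod.subspaceI)
      (auto simp: coef_scl coef_add zero_vec.rep_eq rel_ideal_zero intro: rel_ideal_add rel_ideal_mult)
  interpret vs: vector_space_pair "scl :: qfield \<Rightarrow> ('i, 'y) gen list vec \<Rightarrow> _" "scl :: qfield \<Rightarrow> ('i, 'y) gen list vec \<Rightarrow> _"
    by unfold_locales
  have "Vector_Spaces.linear scl scl (\<lambda>x :: ('i, 'y) gen list vec. x)"
    by (simp add: Vector_Spaces.linear_iff qmod.vector_space_axioms)
  from vs.linear_exists_left_inverse_on[OF this sub] obtain g
    where g: "\<And>x. g x \<in> J" "Vector_Spaces.linear scl scl g" "\<And>x. x \<in> J \<Longrightarrow> g x = x"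
    by (force simp: inj_on_def)
  have glin: "g (x + y) = g x + g y" "g (a *q x) = a *q g x" for x y a
    using g(2) by (auto simp: Vector_Spaces.linear_iff)
  define P where "P = 1 - Endo g"
  have P_app: "P \<bullet> x = x - g x" for x
    by (simp add: P_def app_Endo glin)
  have P_zero: "P \<bullet> x = 0" if "x \<in> J" for x
    using g(3)[OF that] by (simp add: P_app)
  have PP: "P * P = P"
    by (rule endo_eqI) (simp add: P_app g P_zero flip: app_simps(6) del: app_simps(6), simp add: P_app g)
  define M where "M t = Endo (\<lambda>x. Vec (t * coef x))" for t :: "('i, 'y) free"
  have M_app: "M t \<bullet> x = Vec (t * coef x)" for t x
  proof -
    have "t * (fconst a * p) = fconst a * (t * p)" for a p
      by (metis fconst_commute mult.assoc)
    then show ?thesis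
      unfolding M_def
      by (intro app_Endo)
        (simp_all add: coef_add coef_scl distrib_left coef_inject[symmetric] Vec_inverse)
  qed
  have M_hom: "M (s + t) = M s + M t" "M (s * t) = M s * M t" "M (fconst a) = a *q 1" for s t a
    by (rule endo_eqI; simp add: M_app coef_inject[symmetric] Vec_inverse coef_add coef_scl
        distrib_right mult.assoc)+
  have M_J: "M t \<bullet> x \<in> J" if "x \<in> J" for t x
    using that rel_ideal_mult(1) by (simp add: J_def M_app Vec_inverse)
  have PMP: "P * M t * P = P * M t" for t
  proof (rule endo_eqI)
    have "P \<bullet> M t \<bullet> g x = 0" for x by (simp add: P_zero M_J g)
    then show "(P * M t * P) \<bullet> x = (P * M t) \<bullet> x" for x
      by (simp add: P_app[of x])
  qed
  \<comment> \<open>The compressed operators \<open>P * M t\<close> multiply correctly but send 1 to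
    \<open>P\<close>. The counit has scalar, hence central, values, so
    \<open>eps t * (1 - P)\<close> can supply the missing part of the unit.\<close>
  define eps where "eps = ev (\<lambda>h :: ('i, 'y) gen. case h of GenK _ \<Rightarrow> 1 | _ \<Rightarrow> (0 :: ('i, 'y) gen list vec endo))"
  have eps: "alg_hom eps" unfolding eps_def by (rule ev_alg_hom)
  have eps_comm: "eps t * A = A * eps t" for t A
  proof -
    have "prod_list (map (\<lambda>h. case h of GenK _ \<Rightarrow> 1 | _ \<Rightarrow> 0) w) * A
        = A * prod_list (map (\<lambda>h. case h of GenK _ \<Rightarrow> 1 | _ \<Rightarrow> 0) w)" for w :: "('i, 'y) gen list"
      by (induction w) (auto split: gen.split)
    then show ?thesis
      by (simp add: eps_def ev_def lext_def sum_distrib_left sum_distrib_right)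
  qed
  have eps_gen: "eps (fE i) = 0" "eps (fF i) = 0" "eps (fK \<mu>) = 1" for i \<mu>
    by (simp_all add: eps_def ev_word fE_def fF_def fK_def)
  have "quantum D (\<lambda>i. eps (fE i)) (\<lambda>i. eps (fF i)) (\<lambda>\<mu>. eps (fK \<mu>))"
    unfolding eps_gen
  by unfold_locales (simp_all add: qserre_def)
  then have eps_J: "eps t = 0" if "t \<in> ?J" for t
    using alg_hom_kills[OF eps] alg_hom_relations_iff[OF eps] that by blast
  define \<Phi> where "\<Phi> t = P * M t + eps t * (1 - P)" for t
  have P0: "(1 - P) * P = 0" "P * (1 - P) = 0"
    by (simp_all add: left_diff_distrib right_diff_distrib PP)
  have PM: "P * M t = P * M t * P" for t using PMP by simp
  have "model D \<Phi>"
  proof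
    have "\<Phi> (s * t) = \<Phi> s * \<Phi> t" for s t
    proof -
      have "\<Phi> s * \<Phi> t = P * M s * (P * M t) + P * M s * (eps t * (1 - P))
          + eps s * (1 - P) * (P * M t) + eps s * (1 - P) * (eps t * (1 - P))"
        by (simp add: \<Phi>_def distrib_left distrib_right)
      also have "P * M s * (P * M t) = P * M (s * t)"
        using PMP[of s] by (simp add: M_hom(2) mult.assoc[symmetric])
      also have "P * M s * (eps t * (1 - P)) = P * M s * P * (eps t * (1 - P))"
        by (simp only: PMP)
      also have "\<dots> = P * M s * (P * (1 - P)) * eps t"
        by (simp only: eps_comm mult.assoc)
      also have "eps s * (1 - P) * (P * M t) = eps s * ((1 - P) * P) * M t"
        by (simp only: mult.assoc)
      also have "eps s * (1 - P) * (eps t * (1 - P)) = eps s * eps t * ((1 - P) * (1 - P))"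
        by (simp only: mult.assoc eps_comm[of t])
      also have "(1 - P) * (1 - P) = 1 - P"
        by (simp add: left_diff_distrib right_diff_distrib PP)
      finally show ?thesis
        by (simp add: P0 \<Phi>_def alg_hom_mult[OF eps])
    qed
    moreover have "\<Phi> (s + t) = \<Phi> s + \<Phi> t" for s t
      by (simp add: \<Phi>_def M_hom alg_hom_add[OF eps] distrib_left distrib_right)
    moreover have "\<Phi> (fconst c) = c *q 1" for c
      by (simp add: \<Phi>_def M_hom alg_hom_const[OF eps] scl_simps)
    ultimately show "alg_hom \<Phi>" by (simp add: alg_hom_def)
    show "\<Phi> t = 0 \<longleftrightarrow> t \<in> ?J" for t
    proof
      assume "\<Phi> t = 0"
      then have "P * \<Phi> t = 0" by simp
      then have "P * M t = 0"
        by (simp add: \<Phi>_def distrib_left PP P0 eps_comm[of t P, symmetric] flip: mult.assoc)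
          (simp add: mult.assoc P0)
      \<comment> \<open>Acting on the unit of the free algebra recovers \<open>t\<close> modulo the
        ideal, whence faithfulness.\<close>
      then have "P \<bullet> M t \<bullet> Vec 1 = 0" by (metis app_simps(1,6))
      then have "Vec t = g (Vec t)" by (simp add: P_app M_app Vec_inverse)
      with g(1) have "Vec t \<in> J" by metis
      then show "t \<in> ?J" by (simp add: J_def Vec_inverse)
    next
      assume t: "t \<in> ?J"
      have "P * M t = 0"
        by (rule endo_eqI) (simp add: P_zero M_app J_def Vec_inverse rel_ideal_mult(2) t)
      then show "\<Phi> t = 0" by (simp add: \<Phi>_def eps_J[OF t])
    qed
  qed
  then show ?thesis by blast
qed


section \<open>Lowest weight modules\<close>

context root_datum
begin

text \<open>A word stands for the product of its e's applied to the lowest weight vector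
  \<open>bas []\<close>; the Serre relations are imposed later through
  \<open>serre_module\<close>.\<close>

definition vE :: "'i \<Rightarrow> 'i list vec endo" where
  "vE j = vendo (\<lambda>w. bas (j # w))"

text \<open>The lowest weight is \<open>m\<close> times the simple root of \<open>i\<close>: if
  \<open>pair \<mu> i\<close> is nonzero, varying \<open>m\<close> changes the scalar by which
  k_\<mu> acts on \<open>bas []\<close>.\<close>

definition wt :: "int \<Rightarrow> 'i \<Rightarrow> 'y \<Rightarrow> 'i list \<Rightarrow> int" where
  "wt m i \<mu> w = m * pair \<mu> i + sum_list (map (pair \<mu>) w)"

definition vK :: "int \<Rightarrow> 'i \<Rightarrow> 'y \<Rightarrow> 'i list vec endo" where
  "vK m i \<mu> = vendo (\<lambda>w. qvar powi wt m i \<mu> w *q bas w)"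

text \<open>The only possibility once f_j kills \<open>bas []\<close>: the recursion is the
  commutation relation of f_j with the leading e_l.\<close>

fun vF_word :: "int \<Rightarrow> 'i \<Rightarrow> 'i \<Rightarrow> 'i list \<Rightarrow> 'i list vec" where
  "vF_word m i j [] = 0"
| "vF_word m i j (l # w) = vE l \<bullet> vF_word m i j w -
     (if l = j then (1 / (q_of D j - inverse (q_of D j))) *q
        (vK m i (kexp D j) \<bullet> bas w - vK m i (- kexp D j) \<bullet> bas w) else 0)"

definition vF :: "int \<Rightarrow> 'i \<Rightarrow> 'i \<Rightarrow> 'i list vec endo" where
  "vF m i j = vendo (vF_word m i j)"

lemma vE_bas [simp]: "vE j \<bullet> bas w = bas (j # w)"
  and vK_bas: "vK m i \<mu> \<bullet> bas w = qvar powi wt m i \<mu> w *q bas w"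
  and vF_bas [simp]: "vF m i j \<bullet> bas w = vF_word m i j w"
  by (simp_all add: vE_def vK_def vF_def)

lemma wt_simps [simp]: "wt m i 0 w = 0" "wt m i (\<mu> + \<nu>) w = wt m i \<mu> w + wt m i \<nu> w"
  "wt m i \<mu> (j # w) = pair \<mu> j + wt m i \<mu> w"
proof -
  show "wt m i 0 w = 0" by (induction w) (simp_all add: wt_def)
  show "wt m i (\<mu> + \<nu>) w = wt m i \<mu> w + wt m i \<nu> w" by (simp add: wt_def sum_list_addf distrib_left)
  show "wt m i \<mu> (j # w) = pair \<mu> j + wt m i \<mu> w" by (simp add: wt_def)
qed

lemma pre_quantum_verma: "pre_quantum D vE (vF m i) (vK m i)"
proof
  show "vK m i 0 = 1" by (rule endo_eq_on_basis) (simp add: vK_bas)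
  show "vK m i \<mu> * vK m i \<nu> = vK m i (\<mu> + \<nu>)" for \<mu> \<nu>
    by (rule endo_eq_on_basis) (simp add: vK_bas qvar_mult add.commute)
  show KE: "vK m i \<mu> * vE j = qvar powi pair \<mu> j *q (vE j * vK m i \<mu>)" for \<mu> j
    by (rule endo_eq_on_basis) (simp add: vK_bas qvar_mult)
  have KE': "vK m i \<mu> \<bullet> vE j \<bullet> v = qvar powi pair \<mu> j *q (vE j \<bullet> vK m i \<mu> \<bullet> v)" for \<mu> j v
    by (metis KE app_simps(6,7))
  have "vK m i \<mu> \<bullet> vF_word m i j w = qvar powi (wt m i \<mu> w - pair \<mu> j) *q vF_word m i j w" for \<mu> j w
  proof (induction w)
    case (Cons l w)
    have KKw: "vK m i \<mu> \<bullet> vK m i \<nu> \<bullet> bas w = qvar powi wt m i \<mu> w *q (vK m i \<nu> \<bullet> bas w)" for \<nu>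
      by (simp add: vK_bas mult.commute)
    show ?case
      by (simp add: KE' Cons qvar_mult scl_simps KKw mult.commute algebra_simps)
  qed simp
  then show "vK m i \<mu> * vF m i j = qvar powi (- pair \<mu> j) *q (vF m i j * vK m i \<mu>)" for \<mu> j
    by (intro endo_eq_on_basis) (simp add: vK_bas qvar_mult)
  show "vE j * vF m i l - vF m i l * vE j = (if j = l then
      (1 / (q_of D j - inverse (q_of D j))) *q (vK m i (kexp D j) - vK m i (- kexp D j)) else 0)" for j l
    by (rule endo_eq_on_basis) simp
qed

text \<open>The expression commutes with every \<open>vE\<close> by \<open>e_serre_f\<close> and
  kills \<open>bas []\<close>, from which the \<open>vE\<close> generate all words.\<close>

lemma verma_serre_F:
  assumes "j \<noteq> l"
  shows "qserre (q_of D j) (vF m i j) (vF m i l) (serre_deg j l) = 0"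
proof (rule endo_eq_on_basis)
  interpret pre_quantum D vE "vF m i" "vK m i" by (rule pre_quantum_verma)
  let ?s = "qserre (q_of D j) (vF m i j) (vF m i l) (serre_deg j l)"
  have comm: "?s \<bullet> vE h \<bullet> v = vE h \<bullet> ?s \<bullet> v" for h v
    by (metis e_serre_f[OF assms] app_simps(6))
  have Nil: "vF m i h \<bullet> bas [] = 0" for h by simp
  have pow: "(vF m i j ^ n) \<bullet> bas [] = (if n = 0 then bas [] else 0)" for n
    by (induction n) (simp_all add: power_Suc2 del: power_Suc)
  have "?s \<bullet> bas [] = 0"
    by (auto simp: qserre_def app_sum_left pow intro!: sum.neutral)
  then have "?s \<bullet> bas w = 0" for w
    by (induction w) (simp_all flip: vE_bas add: comm)
  then show "?s \<bullet> bas w = 0 \<bullet> bas w" for w by simp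
qed

text \<open>With words read as products this is the two-sided ideal generated by the Serre elements:
  the arbitrary \<open>v\<close> gives multiplication on the right, \<open>vE\<close> on the left.
  Computing modulo this set stands in for the quotient module, which depends on the datum.\<close>

inductive_set serre_module :: "'i list vec set" where
  serre: "j \<noteq> l \<Longrightarrow> qserre (q_of D j) (vE j) (vE l) (serre_deg j l) \<bullet> v \<in> serre_module"
| vE: "s \<in> serre_module \<Longrightarrow> vE j \<bullet> s \<in> serre_module"
| add: "s \<in> serre_module \<Longrightarrow> t \<in> serre_module \<Longrightarrow> s + t \<in> serre_module"
| scl: "s \<in> serre_module \<Longrightarrow> a *q s \<in> serre_module"
| zero: "0 \<in> serre_module"

lemma serre_module_diff: "s \<in> serre_module \<Longrightarrow> t \<in> serre_module \<Longrightarrow> s - t \<in> serre_module"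
  using serre_module.add[of s "(-1) *q t"] serre_module.scl[of t "-1"] by simp

lemma serre_module_vK: "s \<in> serre_module \<Longrightarrow> vK m i \<mu> \<bullet> s \<in> serre_module"
proof (induction s rule: serre_module.induct)
  interpret pre_quantum D vE "vF m i" "vK m i" by (rule pre_quantum_verma)
  case (serre j l v)
  define s where "s = qserre (q_of D j) (vE j) (vE l) (serre_deg j l)"
  have c: "cartan D j l = 1 - int (serre_deg j l)" using serre serre_deg by blast
  define a b where "a = qnf (q_of D j) (serre_deg j l) * (-1) ^ serre_deg j l"
    and "b = qvar powi (pair \<mu> l + int (serre_deg j l) * pair \<mu> j)"
  have a: "a \<noteq> 0" using qnf_nonzero[OF generic_q_of] by (simp add: a_def)
  have "a *q (vK m i \<mu> * s) = a *q (b *q (s * vK m i \<mu>))"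
    using k_qcomm[of \<mu> "q_of D j" "cartan D j l" j l "serre_deg j l"]
    unfolding qcomm_eq_qserre[OF generic_q_of c]
    by (simp add: a_def b_def s_def mult.commute)
  then have "vK m i \<mu> * s = b *q (s * vK m i \<mu>)"
    using a by (simp del: scl_scl)
  then have "vK m i \<mu> \<bullet> s \<bullet> v = b *q (s \<bullet> vK m i \<mu> \<bullet> v)"
    by (metis app_simps(6,7))
  then show ?case
    using serre_module.serre[OF serre, of "vK m i \<mu> \<bullet> v"] by (simp add: s_def serre_module.scl)
next
  interpret pre_quantum D vE "vF m i" "vK m i" by (rule pre_quantum_verma)
  case (vE s j)
  have "vK m i \<mu> \<bullet> vE j \<bullet> s = qvar powi pair \<mu> j *q (vE j \<bullet> vK m i \<mu> \<bullet> s)"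
    by (metis k_e app_simps(6,7))
  with vE show ?case by (simp add: serre_module.scl serre_module.vE)
qed (simp_all add: serre_module.intros)

lemma serre_module_vF: "s \<in> serre_module \<Longrightarrow> vF m i h \<bullet> s \<in> serre_module"
proof (induction s rule: serre_module.induct)
  interpret pre_quantum D vE "vF m i" "vK m i" by (rule pre_quantum_verma)
  case (serre j l v)
  have "vF m i h \<bullet> qserre (q_of D j) (vE j) (vE l) (serre_deg j l) \<bullet> v
      = qserre (q_of D j) (vE j) (vE l) (serre_deg j l) \<bullet> vF m i h \<bullet> v"
    by (metis f_serre_e[OF serre] app_simps(6))
  with serre_module.serre[OF serre] show ?case by simp
next
  interpret pre_quantum D vE "vF m i" "vK m i" by (rule pre_quantum_verma)
  case (vE s j)
  have "vE j \<bullet> vF m i h \<bullet> s - vF m i h \<bullet> vE j \<bullet> s = (if j = h then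
      (1 / (q_of D j - inverse (q_of D j))) *q (vK m i (kexp D j) \<bullet> s - vK m i (- kexp D j) \<bullet> s) else 0)"
    using arg_cong[OF e_f[of j h], of "\<lambda>t. t \<bullet> s"] by (simp split: if_splits)
  then have "vF m i h \<bullet> vE j \<bullet> s = vE j \<bullet> vF m i h \<bullet> s - (if j = h then
      (1 / (q_of D j - inverse (q_of D j))) *q (vK m i (kexp D j) \<bullet> s - vK m i (- kexp D j) \<bullet> s) else 0)"
    by (simp add: algebra_simps split: if_splits)
  with vE show ?case
    by (simp add: serre_module_diff serre_module.vE serre_module.scl serre_module_vK)
qed (simp_all add: serre_module.intros)

definition verma :: "int \<Rightarrow> 'i \<Rightarrow> ('i, 'y) free \<Rightarrow> 'i list vec endo" where
  "verma m i = ev (\<lambda>g. case g of GenE j \<Rightarrow> vE j | GenF j \<Rightarrow> vF m i j | GenK \<mu> \<Rightarrow> vK m i \<mu>)"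

lemma verma_hom: "alg_hom (verma m i)"
  unfolding verma_def by (rule ev_alg_hom)

lemma verma_gen [simp]:
  "verma m i (fE j) = vE j" "verma m i (fF j) = vF m i j" "verma m i (fK \<mu>) = vK m i \<mu>"
  by (simp_all add: verma_def ev_word fE_def fF_def fK_def)

lemma verma_serre_module:
  assumes "s \<in> serre_module"
  shows "verma m i t \<bullet> s \<in> serre_module"
proof -
  have "prod_list (map (\<lambda>g. case g of GenE j \<Rightarrow> vE j | GenF j \<Rightarrow> vF m i j | GenK \<mu> \<Rightarrow> vK m i \<mu>) w) \<bullet> s
      \<in> serre_module" for w
    by (induction w)
      (use assms in \<open>auto simp: serre_module.vE serre_module_vF serre_module_vK split: gen.split\<close>)
  then have "verma m i (Poly_Mapping.single w a) \<bullet> s \<in> serre_module" for w a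
    by (simp add: verma_def ev_def serre_module.scl)
  then show ?thesis
    by (induction t rule: poly_mapping_additive_induct)
      (auto simp: alg_hom_simps[OF verma_hom] serre_module.zero serre_module.add)
qed

lemma verma_rel_ideal:
  assumes "t \<in> rel_ideal D"
  shows "verma m i t \<bullet> v \<in> serre_module"
proof -
  have "rel_ideal D \<subseteq> {t. \<forall>v. verma m i t \<bullet> v \<in> serre_module}"
  proof (rule rel_ideal_minimal)
    have "pre_quantum D (\<lambda>j. verma m i (fE j)) (\<lambda>j. verma m i (fF j)) (\<lambda>\<mu>. verma m i (fK \<mu>))"
      using pre_quantum_verma[of m i] by simp
    from alg_hom_relation_cases[OF verma_hom this]
    show "relations D \<subseteq> {t. \<forall>v. verma m i t \<bullet> v \<in> serre_module}"
      using verma_serre_F serre_module.serre serre_module.zero by fastforce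
  qed (auto simp: alg_hom_simps[OF verma_hom] serre_module.zero serre_module.add verma_serre_module)
  with assms show ?thesis by blast
qed

end

section \<open>Generated subalgebras and the evaluation of words in the model\<close>

inductive_set alg_span :: "'r::qalg set \<Rightarrow> 'r set" for X where
  base: "x \<in> X \<Longrightarrow> x \<in> alg_span X"
| const: "a *q 1 \<in> alg_span X"
| add: "x \<in> alg_span X \<Longrightarrow> y \<in> alg_span X \<Longrightarrow> x + y \<in> alg_span X"
| mult: "x \<in> alg_span X \<Longrightarrow> y \<in> alg_span X \<Longrightarrow> x * y \<in> alg_span X"

lemma alg_span_one: "1 \<in> alg_span X"
  using alg_span.const[of 1] by simp

lemma alg_span_zero: "0 \<in> alg_span X"
  using alg_span.const[of 0] by simp

lemma alg_span_scl: "x \<in> alg_span X \<Longrightarrow> a *q x \<in> alg_span X"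
  using alg_span.mult[OF alg_span.const[of a]] by simp

lemma alg_span_uminus: "x \<in> alg_span X \<Longrightarrow> - x \<in> alg_span X"
  using alg_span_scl[of x X "-1"] by simp

lemma alg_span_diff: "x \<in> alg_span X \<Longrightarrow> y \<in> alg_span X \<Longrightarrow> x - y \<in> alg_span X"
  using alg_span.add[OF _ alg_span_uminus] by fastforce

lemma alg_span_power: "x \<in> alg_span X \<Longrightarrow> x ^ n \<in> alg_span X"
  by (induction n) (simp_all add: alg_span_one alg_span.mult)

lemma alg_span_sum: "(\<And>a. a \<in> A \<Longrightarrow> F a \<in> alg_span X) \<Longrightarrow> sum F A \<in> alg_span X"
  by (induction A rule: infinite_finite_induct) (simp_all add: alg_span_zero alg_span.add)

lemma alg_span_subset:
  assumes "X \<subseteq> alg_span Y"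
  shows "alg_span X \<subseteq> alg_span Y"
proof
  show "x \<in> alg_span Y" if "x \<in> alg_span X" for x
    using that by induction (use assms in \<open>auto intro: alg_span.intros\<close>)
qed

context model
begin

text \<open>Since it kills \<open>serre_module\<close>, this is the map from the true lowest weight
  module to U^+ that sends the lowest weight vector to 1.\<close>

definition \<Theta> :: "'i list vec \<Rightarrow> 'r" where
  "\<Theta> = vext (\<lambda>w. prod_list (map e w))"

lemma \<Theta>_simps [simp]: "\<Theta> (x + y) = \<Theta> x + \<Theta> y" "\<Theta> (a *q x) = a *q \<Theta> x" "\<Theta> (bas w) = prod_list (map e w)"
  by (simp_all add: \<Theta>_def vext_add vext_scl)

lemma \<Theta>_zero [simp]: "\<Theta> 0 = 0"
  using \<Theta>_simps(1)[of 0 0] by simp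

lemma \<Theta>_sum: "\<Theta> (sum F A) = (\<Sum>a\<in>A. \<Theta> (F a))"
  by (induction A rule: infinite_finite_induct) simp_all

lemma \<Theta>_vE [simp]: "\<Theta> (vE j \<bullet> v) = e j * \<Theta> v"
  by (induction v rule: vec_induct) (simp_all add: distrib_left)

lemma \<Theta>_serre_module: "s \<in> serre_module \<Longrightarrow> \<Theta> s = 0"
proof (induction s rule: serre_module.induct)
  case (serre j l v)
  have pow: "\<Theta> ((vE j ^ n) \<bullet> v) = e j ^ n * \<Theta> v" for n v
    by (induction n) (simp_all add: mult.assoc)
  have "\<Theta> (qserre (q_of D j) (vE j) (vE l) n \<bullet> v) = qserre (q_of D j) (e j) (e l) n * \<Theta> v" for n
    by (simp add: qserre_def app_sum_left \<Theta>_sum pow sum_distrib_right mult.assoc)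
  then show ?case using serre_e[OF serre] by simp
qed simp_all

abbreviation Upos :: "'r set" where "Upos \<equiv> alg_span (range e)"

text \<open>One representative \<open>t\<close> has to work for all \<open>m\<close> at once; this
  is what makes different lowest weights comparable.\<close>

lemma Upos_verma:
  assumes "B \<in> Upos"
  shows "\<exists>t. \<Phi> t = B \<and> (\<forall>m i v. \<Theta> (verma m i t \<bullet> v) = B * \<Theta> v)"
  using assms
proof induction
  case (base x)
  then obtain j where "x = e j" by blast
  then show ?case by (intro exI[of _ "fE j"]) simp
next
  case (const a)
  show ?case
    by (intro exI[of _ "fconst a"]) (simp add: alg_hom_const[OF hom] alg_hom_const[OF verma_hom])
next
  case (add x y)
  then obtain s t where "\<Phi> s = x" "\<Phi> t = y" "\<forall>m i v. \<Theta> (verma m i s \<bullet> v) = x * \<Theta> v"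
    "\<forall>m i v. \<Theta> (verma m i t \<bullet> v) = y * \<Theta> v" by blast
  then show ?case
    by (intro exI[of _ "s + t"]) (simp add: alg_hom_add[OF hom] alg_hom_add[OF verma_hom] distrib_right)
next
  case (mult x y)
  then obtain s t where "\<Phi> s = x" "\<Phi> t = y" "\<forall>m i v. \<Theta> (verma m i s \<bullet> v) = x * \<Theta> v"
    "\<forall>m i v. \<Theta> (verma m i t \<bullet> v) = y * \<Theta> v" by blast
  then show ?case
    by (intro exI[of _ "s * t"]) (simp add: alg_hom_mult[OF hom] alg_hom_mult[OF verma_hom] mult.assoc)
qed

text \<open>Comparing the lowest weight modules for two different weights separates \<open>U\<^sup>+ k\<^sub>\<mu>\<close> from \<open>U\<^sup>+\<close>.\<close>

lemma Upos_k_zero: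
  assumes "B \<in> Upos" "B * k \<mu> \<in> Upos" "pair \<mu> i \<noteq> 0"
  shows "B = 0"
proof -
  from Upos_verma[OF assms(1)] obtain t
    where t: "\<Phi> t = B" "\<And>m i v. \<Theta> (verma m i t \<bullet> v) = B * \<Theta> v" by blast
  from Upos_verma[OF assms(2)] obtain t'
    where t': "\<Phi> t' = B * k \<mu>" "\<And>m i v. \<Theta> (verma m i t' \<bullet> v) = B * k \<mu> * \<Theta> v" by blast
  have "\<Phi> (t * fK \<mu> - t') = 0" by (simp add: alg_hom_simps[OF hom] t t')
  then have J: "t * fK \<mu> - t' \<in> rel_ideal D" by (simp add: kernel)
  \<comment> \<open>Both representatives are applied to \<open>bas []\<close>, whose image under
    \<open>\<Theta>\<close> is 1. The left side depends on \<open>m\<close>, the right side does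
    not.\<close>
  have eq: "qvar powi (m * pair \<mu> i) *q B = B * k \<mu>" for m
  proof -
    have "\<Theta> (verma m i (t * fK \<mu> - t') \<bullet> bas []) = 0"
      by (rule \<Theta>_serre_module[OF verma_rel_ideal[OF J]])
    moreover have "\<Theta> (x - y) = \<Theta> x - \<Theta> y" for x y
      using \<Theta>_simps(1)[of "x - y" y] by simp
    ultimately show ?thesis
      by (simp add: alg_hom_simps[OF verma_hom] t t' vK_bas wt_def)
  qed
  have "qvar powi pair \<mu> i *q B = B" using eq[of 1] eq[of 0] by simp
  then have "(qvar powi pair \<mu> i - 1) *q B = 0" by (simp add: scl_simps)
  moreover have "qvar powi pair \<mu> i \<noteq> 1"
    using generic_qvar assms(3) by (auto simp: generic_def)
  ultimately show ?thesis by simp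
qed

end


section \<open>The subalgebra \<open>U\<^sup>+[i]\<close>\<close>

text \<open>By the Leibniz rule each application of \<open>A\<close> lowers the order of nilpotence
  of one of the two factors, while the twists \<open>P\<close> and \<open>R\<close> raise none;
  hence induction on n + m.\<close>

lemma twisted_nilpotent:
  fixes x y :: "'r::qalg"
  assumes twist: "\<And>x y. A \<bullet> (x * y) = (A \<bullet> x) * (P \<bullet> y) + (R \<bullet> x) * (A \<bullet> y)"
    and P: "\<And>n x. (A ^ n) \<bullet> x = 0 \<Longrightarrow> (A ^ n) \<bullet> P \<bullet> x = 0"
    and R: "\<And>n x. (A ^ n) \<bullet> x = 0 \<Longrightarrow> (A ^ n) \<bullet> R \<bullet> x = 0"
    and "(A ^ n) \<bullet> x = 0" "(A ^ m) \<bullet> y = 0"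
  shows "(A ^ (n + m)) \<bullet> (x * y) = 0"
  using assms(4,5)
proof (induction "n + m" arbitrary: n m x y)
  case (Suc N)
  show ?case
  proof (cases n)
    case 0
    then show ?thesis using Suc.prems by simp
  next
    case n: (Suc n')
    show ?thesis
    proof (cases m)
      case 0
      then show ?thesis using Suc.prems by simp
    next
      case m: (Suc m')
      have "(A ^ n') \<bullet> A \<bullet> x = 0" "(A ^ m') \<bullet> A \<bullet> y = 0"
        using Suc.prems unfolding n m power_Suc2 by simp_all
      then have "(A ^ (n' + m)) \<bullet> ((A \<bullet> x) * (P \<bullet> y)) = 0" "(A ^ (n + m')) \<bullet> ((R \<bullet> x) * (A \<bullet> y)) = 0"
        using Suc(1)[of n' m "A \<bullet> x" "P \<bullet> y"] Suc(1)[of n m' "R \<bullet> x" "A \<bullet> y"] Suc(2) n m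
          P[OF Suc.prems(2)] R[OF Suc.prems(1)] by simp_all
      moreover have "A ^ (n + m) = A ^ (n' + m) * A" "n + m' = n' + m"
        unfolding n m by (simp_all add: power_Suc2 del: power_Suc)
      ultimately show ?thesis by (simp add: twist)
    qed
  qed
qed simp

lemma nilpotent_mono: "(A ^ n) \<bullet> x = 0 \<Longrightarrow> n \<le> m \<Longrightarrow> (A ^ m) \<bullet> x = 0"
  by (metis app_simps(6) app_zero le_add_diff_inverse2 power_add)

lemma power_scalar_commute:
  fixes A K :: "'v::qmod endo"
  assumes "A * K = s *q (K * A)"
  shows "(A ^ n) \<bullet> K \<bullet> x = s ^ n *q (K \<bullet> (A ^ n) \<bullet> x)"
proof -
  have "A ^ n * K = s ^ n *q (K * A ^ n)"
  proof (induction n)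
    case (Suc n)
    have "A ^ Suc n * K = A * (A ^ n * K)" by (simp add: mult.assoc)
    also have "\<dots> = s ^ n *q (A * K * A ^ n)" by (simp add: Suc mult.assoc)
    finally show ?case by (simp add: assms mult.assoc mult.commute)
  qed simp
  then show ?thesis by (metis app_simps(6,7))
qed

lemma eigenvectors_independent:
  fixes c :: "int \<Rightarrow> 'v::qmod"
  assumes Q: "generic Q" and "finite A"
    and "\<And>w. w \<in> A \<Longrightarrow> K \<bullet> c w = Q powi w *q c w" "(\<Sum>w\<in>A. c w) = 0"
  shows "\<forall>w\<in>A. c w = 0"
  using assms(2-4)
proof (induction A arbitrary: c rule: finite_induct)
  case (insert z A)
  \<comment> \<open>Applying K - Q^z removes the component at \<open>z\<close> and rescales the
    others by nonzero factors.\<close>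
  define c' where "c' w = (Q powi w - Q powi z) *q c w" for w
  have "0 = K \<bullet> (\<Sum>w\<in>insert z A. c w) - Q powi z *q (\<Sum>w\<in>insert z A. c w)"
    using insert.prems(2) by simp
  also have "\<dots> = (\<Sum>w\<in>insert z A. c' w)"
    unfolding app_sum qmod.scale_sum_right sum_subtractf[symmetric] c'_def
    by (intro sum.cong) (simp_all add: insert.prems(1) scl_simps)
  also have "\<dots> = (\<Sum>w\<in>A. c' w)"
    using insert.hyps by (simp add: c'_def)
  finally have "\<forall>w\<in>A. c' w = 0"
    by (intro insert.IH) (simp_all add: c'_def insert.prems(1) mult.commute)
  moreover have "Q powi w - Q powi z \<noteq> 0" if "w \<in> A" for w
  proof
    assume "Q powi w - Q powi z = 0"
    then have "Q powi (w - z) = 1"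
      using generic_nonzero[OF Q] by (simp add: power_int_diff)
    with Q that insert.hyps show False by (auto simp: generic_def)
  qed
  ultimately have "\<forall>w\<in>A. c w = 0" by (auto simp: c'_def)
  with insert.prems(2) insert.hyps show ?case by simp
qed simp

text \<open>Sums without scalars suffice: the sets it is applied to are closed under
  scaling.\<close>

inductive_set add_span :: "'a::comm_monoid_add set \<Rightarrow> 'a set" for Y where
  zero: "0 \<in> add_span Y"
| step: "y \<in> Y \<Longrightarrow> s \<in> add_span Y \<Longrightarrow> y + s \<in> add_span Y"

lemma add_span_base: "y \<in> Y \<Longrightarrow> y \<in> add_span Y"
  using add_span.step[OF _ add_span.zero] by fastforce

lemma add_span_add: "s \<in> add_span Y \<Longrightarrow> t \<in> add_span Y \<Longrightarrow> s + t \<in> add_span Y"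
  by (induction rule: add_span.induct) (simp_all add: add.assoc add_span.step)

lemma add_span_map:
  assumes "s \<in> add_span Y" "\<And>y. y \<in> Y \<Longrightarrow> g y \<in> add_span Z" "\<And>x y. g (x + y) = g x + g y" "g 0 = 0"
  shows "g s \<in> add_span Z"
  using assms(1)
  by induction (simp_all add: assms add_span.zero add_span_add)

section \<open>Twisted derivation rules, root strings and local nilpotence\<close>

context quantum
begin

lemma adE_mult: "adE i \<bullet> (x * y) = (adE i \<bullet> x) * y + (adK (kexp D i) \<bullet> x) * (adE i \<bullet> y)"
  and adF_mult: "adF i \<bullet> (x * y) = (adF i \<bullet> x) * (adK (- kexp D i) \<bullet> y) + x * (adF i \<bullet> y)"
  and adK_mult: "adK \<mu> \<bullet> (x * y) = (adK \<mu> \<bullet> x) * (adK \<mu> \<bullet> y)"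
  by (simp_all add: adE_app adF_app adK_app mult.assoc left_diff_distrib right_diff_distrib
      k_add k_add')

lemma ad_one: "adE i \<bullet> 1 = 0" "adF i \<bullet> 1 = 0" "adK \<mu> \<bullet> 1 = 1"
  by (simp_all add: adE_app adF_app adK_app k_add k_add')

text \<open>The element ad_{e_i}^m(e_j) in explicit form: its weight for k_i has exponent c + 2m,
  exactly the exponent of the next factor in \<open>qcomm\<close>.\<close>

definition estring :: "'i \<Rightarrow> 'i \<Rightarrow> nat \<Rightarrow> 'r" where
  "estring i j = qcomm (q_of D i) (cartan D i j) (e i) (e j)"

lemma estring_zero: "estring i j 0 = e j"
  by (simp add: estring_def)

lemma adK_estring:
  "adK \<mu> \<bullet> estring i j m = qvar powi (pair \<mu> j + int m * pair \<mu> i) *q estring i j m"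
  by (simp add: adK_app estring_def k_qcomm mult.assoc k_add)

lemma weight_estring: "qvar powi (dot D i j + int m * dot D i i) = q_of D i powi (cartan D i j + 2 * int m)"
  by (simp add: q_of_powi distrib_left flip: d_of_cartan) (simp add: cartan_self mult_ac)

lemma adE_estring: "adE i \<bullet> estring i j m = estring i j (Suc m)"
proof -
  have "adE i \<bullet> estring i j m = e i * estring i j m - (adK (kexp D i) \<bullet> estring i j m) * e i"
    by (simp add: adE_app adK_app)
  then show ?thesis
    by (simp add: adK_estring weight_estring) (simp add: estring_def)
qed

lemma adE_power_estring: "(adE i ^ n) \<bullet> estring i j m = estring i j (m + n)"
  by (induction n) (simp_all add: adE_estring)

text \<open>The clause for \<open>m = 0\<close> guards the truncated \<open>m - 1\<close>: there f_i
  commutes with e_j.\<close>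

lemma adF_estring:
  assumes "i \<noteq> j"
  shows "\<exists>a. adF i \<bullet> estring i j m = a *q estring i j (m - 1) \<and> (m = 0 \<longrightarrow> a = 0)"
proof -
  have "f i * estring i j m - estring i j m * f i
      = (- (qn (q_of D i) (int m) * qn (q_of D i) (cartan D i j + int m - 1))) *q (estring i j (m - 1) * k (- kexp D i))"
    unfolding estring_def by (simp add: f_qcomm[OF assms])
  then have "adF i \<bullet> estring i j m
      = (- (qn (q_of D i) (int m) * qn (q_of D i) (cartan D i j + int m - 1))) *q estring i j (m - 1)"
    by (simp add: adF_app mult.assoc k_add)
  then show ?thesis by (intro exI conjI) (assumption, simp)
qed

lemma adF_power_estring:
  assumes "i \<noteq> j"
  shows "(adF i ^ Suc m) \<bullet> estring i j m = 0"
proof (induction m)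
  case 0
  show ?case using adF_estring[OF assms, of 0] by auto
next
  case (Suc m)
  obtain a where "adF i \<bullet> estring i j (Suc m) = a *q estring i j m"
    using adF_estring[OF assms, of "Suc m"] by auto
  then show ?case using Suc unfolding power_Suc2[of _ "Suc m"] by simp
qed

lemma estring_vanishes:
  assumes "i \<noteq> j" "serre_deg i j \<le> m"
  shows "estring i j m = 0"
  using assms(2)
proof (induction m rule: dec_induct)
  case base
  show ?case
    unfolding estring_def using qcomm_zero_iff[OF generic_q_of serre_deg[OF assms(1)]] serre_e[OF assms(1)]
    by blast
qed (simp add: estring_def)

text \<open>Plain powers replace divided ones; the q-factorials are nonzero, so the generated
  subalgebra is the same.\<close>

definition Ubr :: "'i \<Rightarrow> 'r set" where
  "Ubr i = alg_span {estring i j m | j m. j \<noteq> i}"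

lemma Ubr_estring: "j \<noteq> i \<Longrightarrow> estring i j m \<in> Ubr i"
  unfolding Ubr_def by (rule alg_span.base) blast

lemmas Ubr_closed = alg_span.add[of _ "{estring i j m | j m. j \<noteq> i}" for i, folded Ubr_def]
  alg_span.mult[of _ "{estring i j m | j m. j \<noteq> i}" for i, folded Ubr_def]
  alg_span_scl[of _ "{estring i j m | j m. j \<noteq> i}" for i, folded Ubr_def]
  alg_span_zero[of "{estring i j m | j m. j \<noteq> i}" for i, folded Ubr_def]
  alg_span_one[of "{estring i j m | j m. j \<noteq> i}" for i, folded Ubr_def]

lemma Ubr_induct [consumes 1, case_names estring const add mult]:
  assumes "x \<in> Ubr i"
    and "\<And>j m. j \<noteq> i \<Longrightarrow> P (estring i j m)" "\<And>a. P (a *q 1)"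
    and "\<And>x y. x \<in> Ubr i \<Longrightarrow> P x \<Longrightarrow> y \<in> Ubr i \<Longrightarrow> P y \<Longrightarrow> P (x + y)"
    and "\<And>x y. x \<in> Ubr i \<Longrightarrow> P x \<Longrightarrow> y \<in> Ubr i \<Longrightarrow> P y \<Longrightarrow> P (x * y)"
  shows "P x"
  using assms(1) unfolding Ubr_def
  by (induction rule: alg_span.induct) (use assms(2-5) in \<open>auto simp: Ubr_def\<close>)

lemma Ubr_adK: "x \<in> Ubr i \<Longrightarrow> adK \<mu> \<bullet> x \<in> Ubr i"
  by (induction rule: Ubr_induct)
    (simp_all add: adK_estring adK_mult ad_one Ubr_estring Ubr_closed)

lemma Ubr_adE: "x \<in> Ubr i \<Longrightarrow> adE i \<bullet> x \<in> Ubr i"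
  by (induction rule: Ubr_induct)
    (simp_all add: adE_estring adE_mult ad_one Ubr_estring Ubr_closed Ubr_adK)

lemma Ubr_adF: "x \<in> Ubr i \<Longrightarrow> adF i \<bullet> x \<in> Ubr i"
proof (induction rule: Ubr_induct)
  case (estring j m)
  then obtain a where "adF i \<bullet> estring i j m = a *q estring i j (m - 1)"
    using adF_estring by metis
  with estring show ?case by (simp add: Ubr_estring Ubr_closed)
qed (simp_all add: adF_mult ad_one Ubr_closed Ubr_adK)

lemma Ubr_nilpotent:
  assumes "x \<in> Ubr i"
  shows "\<exists>n. (adE i ^ n) \<bullet> x = 0 \<and> (adF i ^ n) \<bullet> x = 0"
proof -
  interpret ad: quantum D adE adF adK by (rule quantum_ad)
  \<comment> \<open>Commuting with the twist up to a scalar is what lets the twist preserve the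
    order of nilpotence.\<close>
  have K: "adE i * adK (kexp D i) = qvar powi (- dot D i i) *q (adK (kexp D i) * adE i)"
    by (simp add: ad.k_e power_int_minus)
  have K': "adF i * adK (- kexp D i) = qvar powi (- dot D i i) *q (adK (- kexp D i) * adF i)"
    by (simp add: ad.k_f power_int_minus)
  have "\<exists>n. (adE i ^ n) \<bullet> x = 0" using assms
  proof (induction rule: Ubr_induct)
    case (estring j m)
    then have "(adE i ^ serre_deg i j) \<bullet> estring i j m = 0"
      by (simp add: adE_power_estring estring_vanishes)
    then show ?case ..
  next
    case (const a)
    show ?case by (rule exI[of _ 1]) (simp add: ad_one)
  next
    case (add x y)
    then obtain n m where "(adE i ^ n) \<bullet> x = 0" "(adE i ^ m) \<bullet> y = 0" by blast
    then have "(adE i ^ (n + m)) \<bullet> (x + y) = 0" by (simp add: nilpotent_mono)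
    then show ?case ..
  next
    case (mult x y)
    then obtain n m where nm: "(adE i ^ n) \<bullet> x = 0" "(adE i ^ m) \<bullet> y = 0" by blast
    have "(adE i ^ (n + m)) \<bullet> (x * y) = 0"
      by (rule twisted_nilpotent[of _ 1 "adK (kexp D i)", OF _ _ _ nm])
        (simp_all add: adE_mult power_scalar_commute[OF K])
    then show ?case ..
  qed
  then obtain n where n: "(adE i ^ n) \<bullet> x = 0" ..
  have "\<exists>n. (adF i ^ n) \<bullet> x = 0" using assms
  proof (induction rule: Ubr_induct)
    case (estring j m)
    then show ?case using adF_power_estring by metis
  next
    case (const a)
    show ?case by (rule exI[of _ 1]) (simp add: ad_one)
  next
    case (add x y)
    then obtain n m where "(adF i ^ n) \<bullet> x = 0" "(adF i ^ m) \<bullet> y = 0" by blast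
    then have "(adF i ^ (n + m)) \<bullet> (x + y) = 0" by (simp add: nilpotent_mono)
    then show ?case ..
  next
    case (mult x y)
    then obtain n m where nm: "(adF i ^ n) \<bullet> x = 0" "(adF i ^ m) \<bullet> y = 0" by blast
    have "(adF i ^ (n + m)) \<bullet> (x * y) = 0"
      by (rule twisted_nilpotent[of _ "adK (- kexp D i)" 1, OF _ _ _ nm])
        (simp_all add: adF_mult power_scalar_commute[OF K'])
    then show ?case ..
  qed
  then obtain m where m: "(adF i ^ m) \<bullet> x = 0" ..
  have "(adE i ^ (n + m)) \<bullet> x = 0 \<and> (adF i ^ (n + m)) \<bullet> x = 0"
    using n m by (simp add: nilpotent_mono)
  then show ?thesis ..
qed

section \<open>Weight decomposition of U^+[i]\<close>

definition weight_vectors :: "'i \<Rightarrow> int \<Rightarrow> 'r set" where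
  "weight_vectors i w = {x \<in> Ubr i. adK (kexp D i) \<bullet> x = q_of D i powi w *q x}"

lemma Ubr_weight_span:
  assumes "x \<in> Ubr i"
  shows "x \<in> add_span (\<Union>w. weight_vectors i w)"
  using assms
proof (induction rule: Ubr_induct)
  case (estring j m)
  have "estring i j m \<in> weight_vectors i (cartan D i j + 2 * int m)"
    using estring by (simp add: weight_vectors_def Ubr_estring adK_estring weight_estring)
  then show ?case by (blast intro: add_span_base)
next
  case (const a)
  have "a *q 1 \<in> weight_vectors i 0"
    by (simp add: weight_vectors_def Ubr_closed ad_one)
  then show ?case by (blast intro: add_span_base)
next
  case (add x y)
  then show ?case by (simp add: add_span_add)
next
  case (mult x y)
  have "u * v \<in> add_span (\<Union>w. weight_vectors i w)"
    if "u \<in> (\<Union>w. weight_vectors i w)" "v \<in> (\<Union>w. weight_vectors i w)" for u v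
  proof -
    from that obtain w w' where "u \<in> weight_vectors i w" "v \<in> weight_vectors i w'" by blast
    then have "u * v \<in> weight_vectors i (w + w')"
      by (simp add: weight_vectors_def Ubr_closed adK_mult power_int_add)
    then show ?thesis by (blast intro: add_span_base)
  qed
  note prod = this
  have "u * y \<in> add_span (\<Union>w. weight_vectors i w)" if u: "u \<in> (\<Union>w. weight_vectors i w)" for u
    by (rule add_span_map[where g = "(*) u", OF \<open>y \<in> add_span _\<close>]) (simp_all only: prod[OF u] distrib_left mult_zero_right)
  then show ?case
    by (rule add_span_map[where g = "\<lambda>u. u * y", OF \<open>x \<in> add_span _\<close>]) (simp_all only: distrib_right mult_zero_left)
qed

lemma Ubr_weight_decomposition:
  assumes "x \<in> Ubr i"
  shows "\<exists>c. (\<forall>w. c w \<in> weight_vectors i w) \<and> finite {w. c w \<noteq> 0} \<and> x = (\<Sum>w | c w \<noteq> 0. c w)"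
  using Ubr_weight_span[OF assms]
proof induction
  case zero
  show ?case by (rule exI[of _ "\<lambda>_. 0"]) (simp add: weight_vectors_def Ubr_closed)
next
  case (step y s)
  then obtain c z where c: "\<forall>w. c w \<in> weight_vectors i w" "finite {w. c w \<noteq> 0}" "s = (\<Sum>w | c w \<noteq> 0. c w)"
    and y: "y \<in> weight_vectors i z" by blast
  let ?c = "c(z := y + c z)"
  have yc: "y + c z \<in> weight_vectors i z"
    using y c(1)[rule_format, of z] by (simp add: weight_vectors_def Ubr_closed scl_simps)
  have sub: "{w. ?c w \<noteq> 0} \<subseteq> insert z {w. c w \<noteq> 0}" by auto
  have sum: "y + s = (\<Sum>w | ?c w \<noteq> 0. ?c w)"
  proof -
    have "(\<Sum>w | ?c w \<noteq> 0. ?c w) = (\<Sum>w\<in>insert z {w. c w \<noteq> 0}. ?c w)"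
      by (rule sum.mono_neutral_left) (use sub c(2) in auto)
    also have "\<dots> = ?c z + (\<Sum>w\<in>{w. c w \<noteq> 0} - {z}. c w)"
      using c(2) by (simp add: sum.insert_remove)
    also have "\<dots> = y + (\<Sum>w\<in>insert z {w. c w \<noteq> 0}. c w)"
      using c(2) by (simp add: sum.insert_remove add.assoc)
    also have "(\<Sum>w\<in>insert z {w. c w \<noteq> 0}. c w) = s"
      unfolding c(3) by (rule sum.mono_neutral_right) (use c(2) in auto)
    finally show ?thesis by simp
  qed
  have fin: "finite {w. ?c w \<noteq> 0}"
    by (rule finite_subset[OF sub]) (use c(2) in simp)
  have "\<forall>w. ?c w \<in> weight_vectors i w" using c(1) yc by simp
  from conjI[OF this conjI[OF fin sum]] show ?case by (rule exI[of _ ?c])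
qed

section \<open>Expansion in powers of e_i\<close>

lemma Upos_span:
  assumes "x \<in> alg_span (range e)"
  shows "x \<in> add_span {a * e i ^ n | a n. a \<in> Ubr i}"
proof -
  let ?Y = "{a * e i ^ n | a n. a \<in> Ubr i}"
  have Y: "a * e i ^ n \<in> add_span ?Y" if "a \<in> Ubr i" for a n
    using that by (intro add_span_base) blast
  \<comment> \<open>Proved as stability of the span under left multiplication by U^+, so that
    products in the induction on \<open>x\<close> are immediate; \<open>s = 1\<close> gives the
    claim.\<close>
  have "x * s \<in> add_span ?Y" if "s \<in> add_span ?Y" for s
    using assms that
  proof (induction arbitrary: s)
    case (base x)
    then obtain j where j: "x = e j" by blast
    have "x * y \<in> add_span ?Y" if "y \<in> ?Y" for y
    proof -
      from that obtain a n where y: "y = a * e i ^ n" and a: "a \<in> Ubr i" by blast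
      show ?thesis
      proof (cases "j = i")
        case True
        have "x * y = (adE i \<bullet> a) * e i ^ n + (adK (kexp D i) \<bullet> a) * e i ^ Suc n"
          by (simp add: y j True adE_app adK_app left_diff_distrib mult.assoc)
        moreover have "(adE i \<bullet> a) * e i ^ n \<in> add_span ?Y" "(adK (kexp D i) \<bullet> a) * e i ^ Suc n \<in> add_span ?Y"
          by (intro Y Ubr_adE Ubr_adK a)+
        ultimately show ?thesis by (simp add: add_span_add)
      next
        case False
        then have "e j * a \<in> Ubr i"
          using Ubr_estring[of j i 0] a by (simp add: Ubr_closed estring_zero)
        from Y[OF this] show ?thesis by (simp add: y j mult.assoc)
      qed
    qed
    then show ?case
      by (intro add_span_map[where g = "(*) x", OF base(2)]) (simp_all add: distrib_left)
  next
    case (const a)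
    have "(a *q 1) * y \<in> add_span ?Y" if "y \<in> ?Y" for y
    proof -
      from that obtain b n where y: "y = b * e i ^ n" and b: "b \<in> Ubr i" by blast
      have "(a *q b) * e i ^ n \<in> add_span ?Y" by (intro Y Ubr_closed b)
      then show ?thesis by (simp add: y)
    qed
    then show ?case
      by (intro add_span_map[where g = "(*) (a *q 1)", OF const]) (simp_all add: distrib_left scl_simps)
  next
    case (add x y)
    then show ?case by (simp add: distrib_right add_span_add)
  next
    case (mult x y)
    then show ?case by (simp add: mult.assoc)
  qed
  moreover have "1 \<in> add_span ?Y" using Y[of 1 0] Ubr_closed(5) by simp
  ultimately show ?thesis by fastforce
qed

lemma span_coefficients:
  assumes "x \<in> add_span {a * e i ^ n | a n. a \<in> Ubr i}"
  shows "\<exists>a N. (\<forall>n. a n \<in> Ubr i) \<and> (\<forall>n>N. a n = 0) \<and> x = (\<Sum>n\<le>N. a n * e i ^ n)"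
  using assms
proof induction
  case zero
  show ?case by (rule exI[of _ "\<lambda>_. 0"]) (simp add: Ubr_closed)
next
  case (step y s)
  then obtain a N b m where a: "\<And>n. a n \<in> Ubr i" "\<And>n. n > N \<Longrightarrow> a n = 0" "s = (\<Sum>n\<le>N. a n * e i ^ n)"
    and y: "y = b * e i ^ m" "b \<in> Ubr i" by blast
  let ?a = "\<lambda>n. a n + (if n = m then b else 0)"
  let ?N = "max N m"
  have "s = (\<Sum>n\<le>?N. a n * e i ^ n)"
    unfolding a(3) by (rule sum.mono_neutral_left) (auto simp: a(2))
  moreover have "(\<Sum>n\<le>?N. (if n = m then b else 0) * e i ^ n) = y"
    by (simp add: y(1) if_distrib[of "\<lambda>t. t * _"] cong: if_cong)
  ultimately have "y + s = (\<Sum>n\<le>?N. ?a n * e i ^ n)"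
    by (simp add: distrib_right sum.distrib add.commute)
  then show ?case
    using a y by (intro exI[of _ ?a] exI[of _ ?N]) (auto simp: Ubr_closed)
qed

text \<open>The sl_2 formula for the commutator of f_i with e_i^n, multiplied on the right by k_i:
  k_i becomes L = k_i^2 and k_i^-1 becomes 1. For \<open>n = 0\<close> the truncated
  \<open>n - 1\<close> is harmless because [0] = 0.\<close>

lemma adF_e_power:
  fixes i :: 'i
  defines "Q \<equiv> q_of D i" and "L \<equiv> k (kexp D i + kexp D i)"
  shows "adF i \<bullet> (e i ^ n) = (- (qn (Q) (int n) / (Q - inverse Q))) *q
    (e i ^ (n - 1) * (Q powi (int n - 1) *q L - Q powi (1 - int n) *q 1))"
proof (induction n)
  case 0
  show ?case by (simp add: ad_one)
next
  case (Suc n)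
  define q h where "q = Q" and "h = Q - inverse Q"
  have q: "generic q" "q \<noteq> 0" unfolding q_def Q_def using generic_q_of by simp_all
  have fe: "adF i \<bullet> e i = (- (1 / h)) *q (L - 1)"
  proof -
    have "f i * e i - e i * f i = (- (1 / h)) *q (k (kexp D i) - k (- kexp D i))"
      using e_f[of i i] by (simp add: h_def Q_def algebra_simps)
    then show ?thesis by (simp add: adF_app L_def left_diff_distrib k_add)
  qed
  have Ke: "adK (- kexp D i) \<bullet> e i = q powi (-2) *q e i"
  proof -
    have "q powi (-2) = qvar powi (- dot D i i)"
      unfolding q_def Q_def power_int_minus q_of_two ..
    then show ?thesis
      by (simp only: adK_app k_e mult.assoc scl_mult_left k_add pair_simps pair_kexp minus_minus) simp
  qed
  have Le: "L * e i = q powi 4 *q (e i * L)"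
  proof -
    have "L * e i = (q powi 2 * q powi 2) *q (e i * L)"
      unfolding q_def Q_def q_of_two by (simp add: L_def k_e qvar_mult)
    moreover have "q powi 4 = q powi 2 * q powi 2"
      using power_int_add[of q 2 2] q(2) by simp
    ultimately show ?thesis by (simp only:)
  qed
  have IH: "adF i \<bullet> (e i ^ n) = (- (qn q (int n) / h)) *q
     (e i ^ (n - 1) * (q powi (int n - 1) *q L - q powi (1 - int n) *q 1))"
    using Suc by (simp add: q_def h_def)
  have "(adF i \<bullet> (e i ^ n)) * (adK (- kexp D i) \<bullet> e i) =
      (- (qn q (int n) / h)) *q (e i ^ n * (q powi (int n + 1) *q L - q powi (- int n - 1) *q 1))"
  proof (cases n)
    case 0
    then show ?thesis by (simp add: ad_one)
  next
    case (Suc n')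
    have "q powi (int n - 1) * (q powi (-2) * q powi 4) = q powi (int n + 1)"
      "q powi (1 - int n) * q powi (-2) = q powi (- int n - 1)"
      by (simp_all only: power_int_add[OF disjI1[OF q(2)], symmetric]) (auto intro: arg_cong[where f = "(powi) q"])
    moreover have "(q powi (int n - 1) *q L - q powi (1 - int n) *q 1) * (q powi (-2) *q e i)
        = (q powi (int n - 1) * (q powi (-2) * q powi 4)) *q (e i * L)
          - (q powi (1 - int n) * q powi (-2)) *q e i"
      by (simp only: left_diff_distrib scl_mult_left scl_mult_right scl_scl Le mult_1_left mult.assoc)
        (simp add: scl_simps mult_ac)
    ultimately have *: "(q powi (int n - 1) *q L - q powi (1 - int n) *q 1) * (q powi (-2) *q e i)
        = e i * (q powi (int n + 1) *q L - q powi (- int n - 1) *q 1)"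
      by (simp add: right_diff_distrib)
    have "e i ^ (n - 1) * e i = e i ^ n" using Suc by (simp flip: power_Suc2)
    then show ?thesis
      unfolding IH Ke by (simp only: scl_mult_left mult.assoc *) (simp flip: mult.assoc)
  qed
  then have "adF i \<bullet> (e i ^ Suc n) =
      (- (qn q (int n) / h)) *q (e i ^ n * (q powi (int n + 1) *q L - q powi (- int n - 1) *q 1))
      + (- (1 / h)) *q (e i ^ n * (L - 1))"
    unfolding power_Suc2 adF_mult fe by simp
  also have "\<dots> = e i ^ n * ((- ((qn q (int n) * q powi (int n + 1) + 1) / h)) *q L
      - (- ((qn q (int n) * q powi (- int n - 1) + 1) / h)) *q 1)"
    by (simp add: right_diff_distrib scl_simps add_divide_distrib)
  also have "qn q (int n) * q powi (int n + 1) + 1 = qn q (int (Suc n)) * q powi int n"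
  proof -
    have "q powi (- int n) * q powi int n = 1" using q(2) by (simp add: power_int_minus)
    then show ?thesis
      using qn_split[OF q(1), of 1 "int n"] q(2) qn_one[OF q(1)]
      by (simp add: power_int_add distrib_left distrib_right mult_ac)
  qed
  also have "qn q (int n) * q powi (- int n - 1) + 1 = qn q (int (Suc n)) * q powi (- int n)"
  proof -
    have "q powi (- int n) * q powi int n = 1" "q powi (- int n - 1) = q powi (- int n) * q powi (- 1)"
      using q(2) by (simp_all add: power_int_minus power_int_diff divide_inverse)
    then show ?thesis
      using qn_split[OF q(1), of "int n" 1] q(2) qn_one[OF q(1)]
      by (simp add: distrib_left distrib_right mult_ac add.commute)
  qed
  finally show ?case
    by (simp add: q_def h_def right_diff_distrib scl_simps)
qed

end

context model
begin

lemma Ubr_subset_Upos: "Ubr i \<subseteq> Upos"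
proof -
  have "estring i j m \<in> Upos" for j m
    by (induction m)
      (simp_all add: estring_def alg_span.base alg_span_diff alg_span.mult alg_span_scl)
  then show ?thesis unfolding Ubr_def by (intro alg_span_subset) blast
qed

lemma adK_Upos: "x \<in> Upos \<Longrightarrow> adK \<mu> \<bullet> x \<in> Upos"
proof (induction rule: alg_span.induct)
  case (base x)
  then obtain j where "x = estring j j 0" unfolding estring_zero by blast
  with base show ?case by (metis adK_estring alg_span.base alg_span_scl)
qed (simp_all add: adK_mult ad_one alg_span.intros)

text \<open>This includes the directness of the sum: if the sum is 0, then \<open>F\<close> holds
  trivially. The induction step uses its hypothesis in precisely this case.\<close>

lemma adF_stable_coefficients:
  assumes a: "\<And>n. a n \<in> Ubr i" and F: "adF i \<bullet> (\<Sum>n\<le>N. a n * e i ^ n) \<in> Upos"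
  shows "\<forall>n. 1 \<le> n \<and> n \<le> N \<longrightarrow> a n = 0"
  using assms
proof (induction N arbitrary: a)
  case (Suc N)
  define Q h L where "Q = q_of D i" and "h = Q - inverse Q" and "L = k (kexp D i + kexp D i)"
  have Q: "generic Q" unfolding Q_def by (rule generic_q_of)
  \<comment> \<open>The coefficient of \<open>L\<close> in \<open>adF_e_power\<close> up to sign. It
    is 0 for n = 0 and nonzero for n > 0.\<close>
  define \<beta> where "\<beta> n = qn Q (int n) * Q powi (int n - 1) / h" for n
  define B where "B = (\<Sum>n\<le>Suc N. \<beta> n *q (a n * e i ^ (n - 1)))"
  \<comment> \<open>The part of ad_{f_i}(a_n e_i^n) free of \<open>L\<close>, visibly in
    U^+.\<close>
  define u where "u n = (adF i \<bullet> a n) * (adK (- kexp D i) \<bullet> (e i ^ n))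
      + (qn Q (int n) * Q powi (1 - int n) / h) *q (a n * e i ^ (n - 1))" for n
  have aP: "a n \<in> Upos" "adF i \<bullet> a n \<in> Upos" "e i ^ n \<in> Upos" for n
    using Ubr_subset_Upos[of i] Suc.prems(1) Ubr_adF[OF Suc.prems(1)]
    by (blast intro: alg_span_power alg_span.base)+
  have "adF i \<bullet> (a n * e i ^ n) = u n - \<beta> n *q (a n * e i ^ (n - 1)) * L" for n
    unfolding adF_mult adF_e_power u_def \<beta>_def
    by (simp add: Q_def[symmetric] h_def[symmetric] L_def[symmetric] right_diff_distrib scl_simps
        mult.assoc)
  then have "adF i \<bullet> (\<Sum>n\<le>Suc N. a n * e i ^ n) = (\<Sum>n\<le>Suc N. u n) - B * L"
    by (simp only: app_sum B_def sum_subtractf sum_distrib_right)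
  moreover have U: "(\<Sum>n\<le>Suc N. u n) \<in> Upos"
    unfolding u_def by (intro alg_span_sum alg_span.add alg_span.mult alg_span_scl adK_Upos aP)
  ultimately have "B * L = (\<Sum>n\<le>Suc N. u n) - adF i \<bullet> (\<Sum>n\<le>Suc N. a n * e i ^ n)"
    by simp
  then have BL: "B * L \<in> Upos" using alg_span_diff[OF U Suc.prems(2)] by simp
  have B: "B \<in> Upos" unfolding B_def by (intro alg_span_sum alg_span.mult alg_span_scl aP)
  have "pair (kexp D i + kexp D i) i \<noteq> 0"
    using d_of_pos[of i] by (simp add: dot_self)
  from Upos_k_zero[OF B BL[unfolded L_def] this] have "B = 0" .
  \<comment> \<open>Shifting the index exhibits B as a sum of degree at most \<open>N\<close> in
    e_i.\<close>
  define b where "b n = \<beta> (Suc n) *q a (Suc n)" for n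
  have b: "b n \<in> Ubr i" for n unfolding b_def by (intro Ubr_closed Suc.prems)
  have "(\<Sum>n\<le>N. b n * e i ^ n) = B"
    unfolding B_def sum.atMost_Suc_shift by (simp add: b_def \<beta>_def)
  with \<open>B = 0\<close> have s: "(\<Sum>n\<le>N. b n * e i ^ n) = 0" by simp
  \<comment> \<open>Since B = 0, its image under \<open>adF i\<close> is 0 and lies in U^+.\<close>
  have b1: "\<forall>n. 1 \<le> n \<and> n \<le> N \<longrightarrow> b n = 0"
    by (rule Suc.IH[of b, OF b]) (simp add: s alg_span_zero)
  \<comment> \<open>The induction hypothesis leaves \<open>b 0\<close> open; it is all that remains
    of the vanishing sum.\<close>
  have "(\<Sum>n\<le>N. b n * e i ^ n) = (\<Sum>n\<in>{0}. b n * e i ^ n)"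
    by (rule sum.mono_neutral_right) (use b1 in auto)
  then have "b 0 = 0" using s by simp
  with b1 have b0: "b n = 0" if "n \<le> N" for n
    using that by (cases "n = 0") (simp_all add: Suc_le_eq)
  have "\<beta> (Suc n) \<noteq> 0" for n
    using generic_nonzero[OF Q] generic_denominator[OF Q] qn_nonzero[OF Q, of "int (Suc n)"]
    by (simp add: \<beta>_def h_def)
  then have aS: "a (Suc n) = 0" if "n \<le> N" for n using b0[OF that] by (simp add: b_def)
  have "a n = 0" if "1 \<le> n" "n \<le> Suc N" for n
    using aS[of "n - 1"] that by simp
  then show ?case by blast
qed simp

lemma Ubr_maximal:
  assumes "y \<in> Upos" "adF i \<bullet> y \<in> Upos"
  shows "y \<in> Ubr i"
proof -
  obtain a N where a: "\<And>n. a n \<in> Ubr i" and y: "y = (\<Sum>n\<le>N. a n * e i ^ n)"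
    using span_coefficients[OF Upos_span[OF assms(1)]] by blast
  have "\<forall>n. 1 \<le> n \<and> n \<le> N \<longrightarrow> a n = 0"
    by (rule adF_stable_coefficients[of a i N, OF a]) (use assms(2) y in simp)
  then have "y = (\<Sum>n\<in>{0}. a n * e i ^ n)"
    unfolding y by (intro sum.mono_neutral_right) (simp_all add: Suc_le_eq)
  with a show ?thesis by simp
qed

end


section \<open>Translation to the quotient ring\<close>

lemma cring_type_ring: "cring (type_ring :: 'a::comm_ring_1 ring)"
  by (rule cringI)
    (auto simp: algebra_simps intro: ring.is_abelian_group[OF ring_type_ring] comm_monoidI)

context model
begin

text \<open>Cosets are the fibres of \<open>\<Phi>\<close>, so identities in the quotient can be
  checked in the model.\<close>

lemma cls_eq: "cls D t = {x. \<Phi> x = \<Phi> t}"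
proof -
  have "x \<in> cls D t \<longleftrightarrow> \<Phi> x = \<Phi> t" for x
  proof -
    have "x \<in> cls D t \<longleftrightarrow> (\<exists>h\<in>rel_ideal D. x = h + t)"
      by (simp add: cls_def a_r_coset_def')
    also have "\<dots> \<longleftrightarrow> x - t \<in> rel_ideal D"
      by (metis add_diff_cancel diff_add_cancel)
    also have "\<dots> \<longleftrightarrow> \<Phi> x = \<Phi> t"
      by (simp add: alg_hom_diff[OF hom] flip: kernel)
    finally show ?thesis .
  qed
  then show ?thesis by blast
qed

lemma cls_eq_iff: "cls D s = cls D t \<longleftrightarrow> \<Phi> s = \<Phi> t"
  by (auto simp: cls_eq)

lemma Uq_carrier: "carrier (Uq D) = range (cls D)"
  by (auto simp: Uq_def ring.defs module.defs FactRing_def A_RCOSETS_def' cls_def)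

lemma Uq_add: "cls D s \<oplus>\<^bsub>Uq D\<^esub> cls D t = cls D (s + t)"
proof -
  have "\<exists>b. \<Phi> b = \<Phi> t \<and> x = s + b" if "\<Phi> x = \<Phi> s + \<Phi> t" for x
    using that by (intro exI[of _ "x - s"]) (simp add: alg_hom_diff[OF hom])
  then show ?thesis
    by (auto simp: Uq_def ring.defs module.defs FactRing_def set_add_def' cls_eq alg_hom_add[OF hom])
qed

lemma rcoset_mult_cls: "rcoset_mult type_ring (rel_ideal D) (cls D s) (cls D t) = cls D (s * t)"
proof -
  have "rcoset_mult type_ring (rel_ideal D) (cls D s) (cls D t) = (\<Union>a\<in>cls D s. \<Union>b\<in>cls D t. cls D (a * b))"
    by (simp add: rcoset_mult_def cls_def)
  also have "\<dots> = (\<Union>a\<in>cls D s. \<Union>b\<in>cls D t. cls D (s * t))"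
    by (intro SUP_cong refl) (simp add: cls_eq alg_hom_mult[OF hom])
  also have "\<dots> = cls D (s * t)"
    by (auto simp: cls_eq)
  finally show ?thesis .
qed

lemma Uq_mult: "cls D s \<otimes>\<^bsub>Uq D\<^esub> cls D t = cls D (s * t)"
  by (simp add: Uq_def ring.defs module.defs FactRing_def rcoset_mult_cls)

lemma Uq_smult: "c \<odot>\<^bsub>Uq D\<^esub> cls D t = cls D (fconst c * t)"
  by (simp add: Uq_def ring.defs module.defs FactRing_def rcoset_mult_cls)

lemma Uq_one: "\<one>\<^bsub>Uq D\<^esub> = cls D 1"
  by (simp add: Uq_def ring.defs module.defs FactRing_def cls_def)

lemma Uq_zero: "\<zero>\<^bsub>Uq D\<^esub> = cls D 0"
  by (auto simp: Uq_def ring.defs module.defs FactRing_def cls_eq alg_hom_zero[OF hom] kernel)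

lemma ad_cls: "ad D (cls D t) (cls D s) = cls D (free_ad D t s)"
proof -
  have "adh t' = adh t" if "\<Phi> t' = \<Phi> t" for t' t
  proof -
    have "adh (t' - t) = 0"
      using that by (intro adh_kills) (simp add: alg_hom_diff[OF hom] flip: kernel)
    then show ?thesis by (simp add: alg_hom_diff[OF ev_alg_hom])
  qed
  then have "cls D (free_ad D t' s') = cls D (free_ad D t s)" if "t' \<in> cls D t" "s' \<in> cls D s" for t' s'
    using that unfolding cls_eq_iff \<Phi>_free_ad by (metis (mono_tags) cls_eq mem_Collect_eq)
  then have "ad D (cls D t) (cls D s) = (\<Union>t'\<in>cls D t. \<Union>s'\<in>cls D s. cls D (free_ad D t s))"
    unfolding ad_def by (intro SUP_cong refl)
  also have "\<dots> = cls D (free_ad D t s)"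
    by (auto simp: cls_eq)
  finally show ?thesis .
qed

lemma ring_Uq: "ring (Uq D)"
proof (rule ringI)
  show "abelian_group (Uq D)"
  proof (rule abelian_groupI)
    fix x assume "x \<in> carrier (Uq D)"
    then obtain t where "x = cls D t" by (auto simp: Uq_carrier)
    then show "\<exists>y\<in>carrier (Uq D). y \<oplus>\<^bsub>Uq D\<^esub> x = \<zero>\<^bsub>Uq D\<^esub>"
      by (intro bexI[of _ "cls D (- t)"]) (auto simp: Uq_add Uq_zero Uq_carrier)
  qed (auto simp: Uq_carrier Uq_add Uq_zero ac_simps)
  show "Group.monoid (Uq D)"
    by (rule monoidI) (auto simp: Uq_carrier Uq_mult Uq_one mult.assoc)
qed (auto simp: Uq_carrier Uq_add Uq_mult algebra_simps)

lemma fconst_simps: "fconst (a + b) = fconst a + fconst b" "fconst (a * b) = fconst a * fconst b" "fconst 1 = 1"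
  by (simp_all add: fconst_def single_add mult_single)

lemma module_Uq: "module type_ring (Uq D)"
  by (rule moduleI[OF cring_type_ring])
    (auto simp: Uq_carrier Uq_add Uq_smult fconst_simps algebra_simps intro: ring.is_abelian_group[OF ring_Uq])

interpretation U: ring "Uq D" by (rule ring_Uq)
interpretation Um: module type_ring "Uq D" by (rule module_Uq)

text \<open>The representative chosen here and in \<open>act\<close> is immaterial by
  \<open>val_cls\<close> and \<open>act_cls\<close>.\<close>

definition val :: "('i, 'y) free set \<Rightarrow> 'r" where "val z = \<Phi> (SOME t. t \<in> z)"

definition act :: "('i, 'y) free set \<Rightarrow> 'r endo" where "act z = adh (SOME t. t \<in> z)"

lemma val_cls [simp]: "val (cls D t) = \<Phi> t"
  unfolding val_def by (rule someI2[of _ t]) (simp_all add: cls_eq)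

lemma act_cls [simp]: "act (cls D t) = adh t"
proof -
  have "\<Phi> (SOME s. s \<in> cls D t) = \<Phi> t"
    by (rule someI2[of _ t]) (simp_all add: cls_eq)
  then have "adh ((SOME s. s \<in> cls D t) - t) = 0"
    by (intro adh_kills) (simp add: alg_hom_diff[OF hom] flip: kernel)
  then show ?thesis by (simp add: act_def alg_hom_diff[OF ev_alg_hom])
qed

lemma Uq_cases: "z \<in> carrier (Uq D) \<Longrightarrow> (\<And>t. z = cls D t \<Longrightarrow> P) \<Longrightarrow> P"
  by (auto simp: Uq_carrier)

lemma val_inject: "y \<in> carrier (Uq D) \<Longrightarrow> z \<in> carrier (Uq D) \<Longrightarrow> val y = val z \<longleftrightarrow> y = z"
  by (elim Uq_cases) (simp add: cls_eq_iff)

lemma Uq_eqI: "y \<in> carrier (Uq D) \<Longrightarrow> z \<in> carrier (Uq D) \<Longrightarrow> val y = val z \<Longrightarrow> y = z"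
  by (simp add: val_inject)

lemma val_simps:
  assumes "y \<in> carrier (Uq D)" "z \<in> carrier (Uq D)"
  shows "val (y \<oplus>\<^bsub>Uq D\<^esub> z) = val y + val z" "val (y \<otimes>\<^bsub>Uq D\<^esub> z) = val y * val z"
    "val (ad D y z) = act y \<bullet> val z"
  using assms
  by (auto elim!: Uq_cases simp: Uq_add Uq_mult ad_cls alg_hom_simps[OF hom] \<Phi>_free_ad)

lemma val_smult: "z \<in> carrier (Uq D) \<Longrightarrow> val (c \<odot>\<^bsub>Uq D\<^esub> z) = c *q val z"
  and act_smult: "z \<in> carrier (Uq D) \<Longrightarrow> act (c \<odot>\<^bsub>Uq D\<^esub> z) = c *q act z"
  by (auto elim!: Uq_cases simp: Uq_smult alg_hom_simps[OF hom] alg_hom_simps[OF ev_alg_hom])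

lemma val_zero: "val \<zero>\<^bsub>Uq D\<^esub> = 0" and val_one: "val \<one>\<^bsub>Uq D\<^esub> = 1"
  by (simp_all add: Uq_zero Uq_one alg_hom_simps[OF hom])

lemma val_uminus: "z \<in> carrier (Uq D) \<Longrightarrow> val (\<ominus>\<^bsub>Uq D\<^esub> z) = - val z"
  using val_simps(1)[of "\<ominus>\<^bsub>Uq D\<^esub> z" z] by (simp add: U.l_neg val_zero eq_neg_iff_add_eq_0)

lemma ad_closed: "y \<in> carrier (Uq D) \<Longrightarrow> z \<in> carrier (Uq D) \<Longrightarrow> ad D y z \<in> carrier (Uq D)"
  by (auto simp: Uq_carrier ad_cls)

lemma act_simps:
  assumes "y \<in> carrier (Uq D)" "z \<in> carrier (Uq D)"
  shows "act (y \<oplus>\<^bsub>Uq D\<^esub> z) = act y + act z" "act (y \<otimes>\<^bsub>Uq D\<^esub> z) = act y * act z"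
  using assms
  by (auto elim!: Uq_cases simp: Uq_add Uq_mult alg_hom_simps[OF ev_alg_hom])

lemma act_one: "act \<one>\<^bsub>Uq D\<^esub> = 1"
  by (simp add: Uq_one alg_hom_simps[OF ev_alg_hom])

lemma gens_closed: "eU D j \<in> carrier (Uq D)" "fU D j \<in> carrier (Uq D)" "kU D \<mu> \<in> carrier (Uq D)"
  and val_gens: "val (eU D j) = e j" "val (fU D j) = f j" "val (kU D \<mu>) = k \<mu>"
  and act_gens: "act (eU D j) = adE j" "act (fU D j) = adF j" "act (kU D \<mu>) = adK \<mu>"
  by (simp_all add: Uq_carrier eU_def fU_def kU_def)

lemma act_power: "z \<in> carrier (Uq D) \<Longrightarrow> act (z [^]\<^bsub>Uq D\<^esub> n) = act z ^ n"
  by (induction n) (simp_all add: act_one act_simps power_Suc2 del: power_Suc)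

text \<open>The induction builds a lift that lies in every subalgebra of the intersection;
  injectivity of \<open>val\<close> later identifies it with any given element of the same
  value.\<close>

lemma gen_subalgebra_exists:
  assumes S: "S \<subseteq> carrier (Uq D)" and r: "r \<in> alg_span (val ` S)"
  shows "\<exists>z\<in>gen_subalgebra (Uq D) S. z \<in> carrier (Uq D) \<and> val z = r"
  using r
proof induction
  case (base x)
  with S show ?case by (auto simp: gen_subalgebra_def)
next
  case (const a)
  have "\<one>\<^bsub>Uq D\<^esub> \<in> B \<Longrightarrow> submodule B type_ring (Uq D) \<Longrightarrow> a \<odot>\<^bsub>Uq D\<^esub> \<one>\<^bsub>Uq D\<^esub> \<in> B" for B
    using Um.submoduleE(4) by simp
  then have "a \<odot>\<^bsub>Uq D\<^esub> \<one>\<^bsub>Uq D\<^esub> \<in> gen_subalgebra (Uq D) S"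
    by (auto simp: gen_subalgebra_def subringE(3))
  moreover have "val (a \<odot>\<^bsub>Uq D\<^esub> \<one>\<^bsub>Uq D\<^esub>) = a *q 1"
    by (simp add: val_smult val_one)
  ultimately show ?case
    by (intro bexI[of _ "a \<odot>\<^bsub>Uq D\<^esub> \<one>\<^bsub>Uq D\<^esub>"]) simp_all
next
  case (add x y)
  then obtain u v where "u \<in> gen_subalgebra (Uq D) S" "u \<in> carrier (Uq D)" "val u = x"
    "v \<in> gen_subalgebra (Uq D) S" "v \<in> carrier (Uq D)" "val v = y" by blast
  then show ?case
    by (intro bexI[of _ "u \<oplus>\<^bsub>Uq D\<^esub> v"]) (auto simp: val_simps gen_subalgebra_def subringE(7))
next
  case (mult x y)
  then obtain u v where "u \<in> gen_subalgebra (Uq D) S" "u \<in> carrier (Uq D)" "val u = x"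
    "v \<in> gen_subalgebra (Uq D) S" "v \<in> carrier (Uq D)" "val v = y" by blast
  then show ?case
    by (intro bexI[of _ "u \<otimes>\<^bsub>Uq D\<^esub> v"]) (auto simp: val_simps gen_subalgebra_def subringE(6))
qed

lemma gen_subalgebra_eq:
  assumes S: "S \<subseteq> carrier (Uq D)"
  shows "gen_subalgebra (Uq D) S = {z \<in> carrier (Uq D). val z \<in> alg_span (val ` S)}" (is "_ = ?B")
    and "submodule (gen_subalgebra (Uq D) S) type_ring (Uq D)"
proof -
  have "subring ?B (Uq D)"
    by (rule U.subringI)
      (auto simp: val_simps val_one val_uminus alg_span_one alg_span_uminus alg_span.add alg_span.mult)
  moreover have sub: "submodule ?B type_ring (Uq D)"
    by (rule Um.submoduleI)
      (auto simp: val_simps val_smult val_zero val_uminus alg_span_zero alg_span_uminus alg_span.add alg_span_scl)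
  ultimately have "gen_subalgebra (Uq D) S \<subseteq> ?B"
    using S by (auto simp: gen_subalgebra_def intro: alg_span.base)
  moreover have "z \<in> gen_subalgebra (Uq D) S" if "z \<in> ?B" for z
    using gen_subalgebra_exists[OF S, of "val z"] that val_inject by auto
  ultimately show eq: "gen_subalgebra (Uq D) S = ?B" by blast
  show "submodule (gen_subalgebra (Uq D) S) type_ring (Uq D)" unfolding eq by (rule sub)
qed

lemma Uplus_eq: "Uplus D = {z \<in> carrier (Uq D). val z \<in> Upos}"
proof -
  have S: "{eU D j | j. True} \<subseteq> carrier (Uq D)" using gens_closed by blast
  have "val ` {eU D j | j. True} = range e"
    by (simp add: full_SetCompr_eq image_image val_gens flip: image_def)
  then show ?thesis
    unfolding Uplus_def gen_subalgebra_eq(1)[OF S] by simp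
qed

lemma ad_e_div_val:
  "ad_e_div D i n (eU D j) \<in> carrier (Uq D)"
  "val (ad_e_div D i n (eU D j)) = (1 / qnf (q_of D i) n) *q estring i j n"
proof -
  have "(ad D (eU D i) ^^ n) (eU D j) \<in> carrier (Uq D) \<and> val ((ad D (eU D i) ^^ n) (eU D j)) = estring i j n"
    by (induction n) (simp_all add: gens_closed val_gens estring_zero ad_closed val_simps act_gens adE_estring)
  then show "ad_e_div D i n (eU D j) \<in> carrier (Uq D)"
    "val (ad_e_div D i n (eU D j)) = (1 / qnf (q_of D i) n) *q estring i j n"
    unfolding ad_e_div_def qfact_eq by (simp_all add: val_smult)
qed

lemma
  shows Uplus_br_eq: "Uplus_br D i = {z \<in> carrier (Uq D). val z \<in> Ubr i}"
    and Uplus_br_submodule: "submodule (Uplus_br D i) type_ring (Uq D)"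
    and Uplus_br_exists: "r \<in> Ubr i \<Longrightarrow> \<exists>z\<in>Uplus_br D i. val z = r"
proof -
  let ?S = "{ad_e_div D i n (eU D j) | n j. j \<noteq> i}"
  have S: "?S \<subseteq> carrier (Uq D)" using ad_e_div_val(1) by auto
  have span: "alg_span (val ` ?S) = Ubr i"
  proof
    have "val ` ?S \<subseteq> Ubr i"
      by (auto simp: ad_e_div_val Ubr_closed Ubr_estring)
    then show "alg_span (val ` ?S) \<subseteq> Ubr i"
      unfolding Ubr_def by (rule alg_span_subset)
    \<comment> \<open>Multiplying by the q-factorial turns the divided power back into the plain
      one.\<close>
    have "estring i j m \<in> alg_span (val ` ?S)" if "j \<noteq> i" for j m
    proof -
      have "val (ad_e_div D i m (eU D j)) \<in> alg_span (val ` ?S)"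
        using that by (intro alg_span.base) blast
      from alg_span_scl[OF this, of "qnf (q_of D i) m"] show ?thesis
        using qnf_nonzero[OF generic_q_of, of i m] by (simp add: ad_e_div_val)
    qed
    then show "Ubr i \<subseteq> alg_span (val ` ?S)"
      unfolding Ubr_def by (intro alg_span_subset) blast
  qed
  show "Uplus_br D i = {z \<in> carrier (Uq D). val z \<in> Ubr i}"
    unfolding Uplus_br_def gen_subalgebra_eq(1)[OF S] span ..
  show "submodule (Uplus_br D i) type_ring (Uq D)"
    unfolding Uplus_br_def by (rule gen_subalgebra_eq(2)[OF S])
  show "\<exists>z\<in>Uplus_br D i. val z = r" if "r \<in> Ubr i"
    using gen_subalgebra_exists[OF S, unfolded span, OF that] unfolding Uplus_br_def by blast
qed

lemma Usub_gens: "{eU D i, fU D i, kU D (kexp D i)} \<subseteq> Usub D i"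
  unfolding Usub_def gen_subalgebra_def by blast

lemma Usub_act:
  assumes "z \<in> Usub D i"
  shows "z \<in> carrier (Uq D)" "x \<in> Ubr i \<Longrightarrow> act z \<bullet> x \<in> Ubr i"
proof -
  \<comment> \<open>\<open>adh\<close> is defined on the free algebra and not on values, so the
    induction carries a representative \<open>t\<close>; \<open>val_inject\<close> then shows that
    \<open>z\<close> is its class.\<close>
  have "\<exists>t. \<Phi> t = r \<and> (\<forall>x\<in>Ubr i. adh t \<bullet> x \<in> Ubr i)" if "r \<in> alg_span {e i, f i, k (kexp D i)}" for r
    using that
  proof induction
    case (base r)
    then consider "r = e i" | "r = f i" | "r = k (kexp D i)" by blast
    then show ?case
      by cases (use Ubr_adE Ubr_adF Ubr_adK in \<open>metis adh_gen\<close>)+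
  next
    case (const a)
    show ?case
      by (rule exI[of _ "fconst a"])
        (simp add: alg_hom_const[OF hom] alg_hom_const[OF ev_alg_hom] Ubr_closed)
  next
    case (add r s)
    then obtain t u where "\<Phi> t = r" "\<Phi> u = s" "\<forall>x\<in>Ubr i. adh t \<bullet> x \<in> Ubr i" "\<forall>x\<in>Ubr i. adh u \<bullet> x \<in> Ubr i"
      by blast
    then show ?case
      by (intro exI[of _ "t + u"]) (simp add: alg_hom_add[OF hom] alg_hom_add[OF ev_alg_hom] Ubr_closed)
  next
    case (mult r s)
    then obtain t u where "\<Phi> t = r" "\<Phi> u = s" "\<forall>x\<in>Ubr i. adh t \<bullet> x \<in> Ubr i" "\<forall>x\<in>Ubr i. adh u \<bullet> x \<in> Ubr i"
      by blast
    then show ?case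
      by (intro exI[of _ "t * u"]) (simp add: alg_hom_mult[OF hom] alg_hom_mult[OF ev_alg_hom])
  qed
  moreover have "Usub D i = {z \<in> carrier (Uq D). val z \<in> alg_span {e i, f i, k (kexp D i)}}"
    unfolding Usub_def by (subst gen_subalgebra_eq) (simp_all add: gens_closed val_gens)
  ultimately obtain t where z: "z \<in> carrier (Uq D)" and t: "\<Phi> t = val z" "\<forall>x\<in>Ubr i. adh t \<bullet> x \<in> Ubr i"
    using assms by blast
  then have "z = cls D t" by (intro val_inject[THEN iffD1]) (simp_all add: Uq_carrier)
  with z t show "z \<in> carrier (Uq D)" "x \<in> Ubr i \<Longrightarrow> act z \<bullet> x \<in> Ubr i" by auto
qed

section \<open>The representation on U^+[i] and its maximality\<close>

lemma ad_submodule_Uplus_br: "ad_submodule D i (Uplus_br D i)"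
  unfolding ad_submodule_def
  using Uplus_br_submodule Usub_act by (auto simp: Uplus_br_eq ad_closed val_simps)

lemma algebra_rep_ad:
  assumes "ad_submodule D i V"
  shows "algebra_rep (Uq D) (Usub D i) ((Uq D)\<lparr>carrier := V\<rparr>) (ad D)"
proof -
  have sub: "submodule V type_ring (Uq D)" and st: "\<And>z v. z \<in> Usub D i \<Longrightarrow> v \<in> V \<Longrightarrow> ad D z v \<in> V"
    using assms by (auto simp: ad_submodule_def)
  have V: "v \<in> carrier (Uq D)" if "v \<in> V" for v using Um.submoduleE(1)[OF sub] that by blast
  have Z: "z \<in> carrier (Uq D)" if "z \<in> Usub D i" for z using Usub_act(1) that .
  show ?thesis
    unfolding algebra_rep_def
  proof (intro conjI ballI allI)
    show "module type_ring ((Uq D)\<lparr>carrier := V\<rparr>)"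
      by (rule submodule.submodule_is_module[OF sub module_Uq])
  qed (simp_all add: st, (rule Uq_eqI; simp add: V Z ad_closed val_simps val_smult act_simps act_smult act_one)+)
qed

lemma val_finsum:
  assumes sub: "submodule V type_ring (Uq D)" and "finite A" "\<And>a. a \<in> A \<Longrightarrow> c a \<in> V"
  shows "finsum ((Uq D)\<lparr>carrier := V\<rparr>) c A \<in> V \<and>
    val (finsum ((Uq D)\<lparr>carrier := V\<rparr>) c A) = (\<Sum>a\<in>A. val (c a))"
proof -
  interpret M: module type_ring "(Uq D)\<lparr>carrier := V\<rparr>"
    by (rule submodule.submodule_is_module[OF sub module_Uq])
  have V: "v \<in> carrier (Uq D)" if "v \<in> V" for v using Um.submoduleE(1)[OF sub] that by blast
  show ?thesis
    using assms(2,3)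
  proof (induction A rule: finite_induct)
    case empty
    show ?case using M.zero_closed by (simp add: val_zero)
  next
    case (insert a A)
    then have "finsum ((Uq D)\<lparr>carrier := V\<rparr>) c (insert a A) =
        c a \<oplus>\<^bsub>Uq D\<^esub> finsum ((Uq D)\<lparr>carrier := V\<rparr>) c A"
      using M.finsum_insert[of A a c] by simp
    with insert show ?case
      using Um.submoduleE(5)[OF sub] by (simp add: val_simps V)
  qed
qed

lemma weight_space_iff:
  assumes "V \<subseteq> carrier (Uq D)"
  shows "v \<in> weight_space D i ((Uq D)\<lparr>carrier := V\<rparr>) (ad D) w \<longleftrightarrow>
    v \<in> V \<and> adK (kexp D i) \<bullet> val v = q_of D i powi w *q val v"
proof -
  have "ad D (kU D (kexp D i)) v = (q_of D i powi w) \<odot>\<^bsub>Uq D\<^esub> v \<longleftrightarrow>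
      adK (kexp D i) \<bullet> val v = q_of D i powi w *q val v" if "v \<in> carrier (Uq D)"
    using that
    by (subst val_inject[symmetric]) (simp_all add: ad_closed gens_closed Um.smult_closed val_simps val_smult act_gens)
  with assms show ?thesis by (auto simp: weight_space_def)
qed

lemma is_direct_sum_Uplus_br:
  "is_direct_sum ((Uq D)\<lparr>carrier := Uplus_br D i\<rparr>)
     (weight_space D i ((Uq D)\<lparr>carrier := Uplus_br D i\<rparr>) (ad D))"
proof -
  let ?V = "Uplus_br D i"
  let ?M = "(Uq D)\<lparr>carrier := ?V\<rparr>"
  let ?W = "weight_space D i ?M (ad D)"
  have VU: "?V \<subseteq> carrier (Uq D)" by (auto simp: Uplus_br_eq)
  note W = weight_space_iff[OF VU]
  note fs = val_finsum[OF Uplus_br_submodule]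
  have zero: "u \<noteq> \<zero>\<^bsub>Uq D\<^esub> \<longleftrightarrow> val u \<noteq> 0" if "u \<in> ?V" for u
    using val_inject[of u "\<zero>\<^bsub>Uq D\<^esub>"] that VU by (auto simp: val_zero)
  let ?P = "\<lambda>v c. (\<forall>w. c w \<in> ?W w) \<and> finite {w. c w \<noteq> \<zero>\<^bsub>Uq D\<^esub>} \<and> v = finsum ?M c {w. c w \<noteq> \<zero>\<^bsub>Uq D\<^esub>}"
  have "\<exists>!c. ?P v c" if v: "v \<in> ?V" for v
  proof (rule ex_ex1I)
    from v have "val v \<in> Ubr i" by (simp add: Uplus_br_eq)
    from Ubr_weight_decomposition[OF this] obtain c where c: "\<And>w. c w \<in> weight_vectors i w"
      "finite {w. c w \<noteq> 0}" "val v = (\<Sum>w | c w \<noteq> 0. c w)" by blast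
    have "\<forall>w. \<exists>z\<in>?V. val z = c w"
      using c(1) Uplus_br_exists by (auto simp: weight_vectors_def)
    then obtain z where z: "\<And>w. z w \<in> ?V" "\<And>w. val (z w) = c w" by metis
    have eq: "{w. z w \<noteq> \<zero>\<^bsub>Uq D\<^esub>} = {w. c w \<noteq> 0}" using zero z by simp
    have "val v = val (finsum ?M z {w. c w \<noteq> 0})" "finsum ?M z {w. c w \<noteq> 0} \<in> ?V"
      using fs[OF c(2), of z] z c(3) by simp_all
    then have "v = finsum ?M z {w. c w \<noteq> 0}" using v VU val_inject by blast
    then show "\<exists>c. ?P v c"
      using z c(1,2) by (intro exI[of _ z]) (auto simp: eq W weight_vectors_def)
  next
    fix c c' assume c: "?P v c" and c': "?P v c'"
    \<comment> \<open>The two decompositions may have different supports; both are extended by zero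
      to the union, where their differences are eigenvectors with sum 0.\<close>
    let ?A = "{w. c w \<noteq> \<zero>\<^bsub>Uq D\<^esub>} \<union> {w. c' w \<noteq> \<zero>\<^bsub>Uq D\<^esub>}"
    have fin: "finite ?A" using c c' by blast
    have V: "c w \<in> ?V" "c' w \<in> ?V" for w using c c' W by blast+
    have sum: "val v = (\<Sum>w\<in>?A. val (b w))" if "?P v b" "{w. b w \<noteq> \<zero>\<^bsub>Uq D\<^esub>} \<subseteq> ?A" for b
    proof -
      have bV: "b w \<in> ?V" for w using that(1) W by blast
      have "val v = val (finsum ?M b {w. b w \<noteq> \<zero>\<^bsub>Uq D\<^esub>})" using that(1) by simp
      also have "\<dots> = (\<Sum>w | b w \<noteq> \<zero>\<^bsub>Uq D\<^esub>. val (b w))" using fs[of _ b] that(1) bV by blast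
      also have "\<dots> = (\<Sum>w\<in>?A. val (b w))"
        by (rule sum.mono_neutral_left) (use fin that(2) zero[OF bV] in auto)
      finally show ?thesis .
    qed
    have "(\<Sum>w\<in>?A. val (c w) - val (c' w)) = 0"
      using sum[OF c] sum[OF c'] by (simp add: sum_subtractf)
    moreover have "adK (kexp D i) \<bullet> (val (c w) - val (c' w)) = q_of D i powi w *q (val (c w) - val (c' w))" for w
    proof -
      have "c w \<in> ?W w" "c' w \<in> ?W w" using c c' by blast+
      then show ?thesis unfolding W by (simp add: qmod.scale_right_diff_distrib)
    qed
    ultimately have "\<forall>w\<in>?A. val (c w) - val (c' w) = 0"
      using eigenvectors_independent[OF generic_q_of fin, where c = "\<lambda>w. val (c w) - val (c' w)"] by blast
    then have eq: "c w = c' w" if "w \<in> ?A" for w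
      using that V[of w] VU by (intro Uq_eqI) (blast, blast, simp)
    show "c = c'"
    proof
      fix w
      show "c w = c' w"
      proof (cases "w \<in> ?A")
        case True
        then show ?thesis by (rule eq)
      qed simp
    qed
  qed
  then show ?thesis by (simp add: is_direct_sum_def)
qed

lemma integrable_Uplus_br: "integrable_rep D i ((Uq D)\<lparr>carrier := Uplus_br D i\<rparr>) (ad D)"
  unfolding integrable_rep_def
proof (intro conjI ballI)
  show "algebra_rep (Uq D) (Usub D i) ((Uq D)\<lparr>carrier := Uplus_br D i\<rparr>) (ad D)"
    by (rule algebra_rep_ad[OF ad_submodule_Uplus_br])
  fix v assume "v \<in> carrier ((Uq D)\<lparr>carrier := Uplus_br D i\<rparr>)"
  then have v: "v \<in> carrier (Uq D)" "val v \<in> Ubr i" by (simp_all add: Uplus_br_eq)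
  obtain n where n: "(adE i ^ n) \<bullet> val v = 0" "(adF i ^ n) \<bullet> val v = 0"
    using Ubr_nilpotent[OF v(2)] by blast
  have "ad D (eU D i [^]\<^bsub>Uq D\<^esub> n) v = \<zero>\<^bsub>Uq D\<^esub>" "ad D (fU D i [^]\<^bsub>Uq D\<^esub> n) v = \<zero>\<^bsub>Uq D\<^esub>"
    using n v(1)
    by (intro Uq_eqI; simp add: ad_closed gens_closed val_simps val_zero act_power act_gens)+
  then show "\<exists>n::nat. ad D (eU D i [^]\<^bsub>Uq D\<^esub> n) v = \<zero>\<^bsub>(Uq D)\<lparr>carrier := Uplus_br D i\<rparr>\<^esub> \<and>
      ad D (fU D i [^]\<^bsub>Uq D\<^esub> n) v = \<zero>\<^bsub>(Uq D)\<lparr>carrier := Uplus_br D i\<rparr>\<^esub>"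
    by auto
qed (rule is_direct_sum_Uplus_br)

lemma Uplus_br_maximal:
  assumes "V \<subseteq> Uplus D" "ad_submodule D i V"
  shows "V \<subseteq> Uplus_br D i"
proof
  fix v assume v: "v \<in> V"
  then have "ad D (fU D i) v \<in> V"
    using assms(2) Usub_gens by (auto simp: ad_submodule_def)
  with v assms(1) have "val v \<in> Upos" "val (ad D (fU D i) v) \<in> Upos" and vc: "v \<in> carrier (Uq D)"
    by (auto simp: Uplus_eq)
  then have "val v \<in> Ubr i"
    by (intro Ubr_maximal) (simp_all add: val_simps gens_closed act_gens)
  with vc show "v \<in> Uplus_br D i" by (simp add: Uplus_br_eq)
qed

end

theorem proposition2p4:
  fixes D :: "('i, 'x::ab_group_add, 'y::ab_group_add) root_datum"
    and i :: 'i
  assumes "is_root_datum D"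
  shows "Uplus_br D i \<subseteq> Uplus D \<and> ad_submodule D i (Uplus_br D i) \<and>
    integrable_rep D i ((Uq D)\<lparr>carrier := Uplus_br D i\<rparr>) (ad D) \<and>
    (\<forall>V. V \<subseteq> Uplus D \<and> ad_submodule D i V \<and>
         integrable_rep D i ((Uq D)\<lparr>carrier := V\<rparr>) (ad D)
       \<longrightarrow> V \<subseteq> Uplus_br D i)"
proof -
  interpret root_datum D by unfold_locales (fact assms)
  obtain \<Phi> :: "('i, 'y) free \<Rightarrow> ('i, 'y) gen list vec endo" where "model D \<Phi>"
    using model_exists by blast
  then interpret model D \<Phi> .
  have "Uplus_br D i \<subseteq> Uplus D"
    using Ubr_subset_Upos by (auto simp: Uplus_br_eq Uplus_eq)
  then show ?thesis
    using ad_submodule_Uplus_br integrable_Uplus_br Uplus_br_maximal by blast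
qed

end
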